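(* Let $N\in\mathbb{N}$ be squarefree and $p$ a prime. The primary component $\mathcal H(\widehat\Gamma_N,\widehat{\mathcal G}_{N,p})$ consists of all polynomials (with integer coefficients) in $T_{N,1}(p)$ and $T_{N,2}(p)$, and $T_{N,1}(p)$, $T_{N,2}(p)$ are algebraically independent. Moreover, $\mathcal H(\widehat\Gamma_N,\widehat{\mathcal G}_N)$ does not contain any zero-divisors.
   Context: For matrices $A,B$ of compatible size, $A[B]:=B'AB$ ($'$ = transpose). $S_N=\begin{pmatrix}0&0&1\\0&-2N&0\\1&0&0\end{pmatrix}$, $\widehat S_N=\begin{pmatrix}0&0&1\\0&S_N&0\\1&0&0\end{pmatrix}$ ($5\times5$). $SO(\widehat S_N;\mathbb{R})=\{M\in SL_5(\mathbb{R}):\widehat S_N[M]=\widehat S_N\}$, $SO_0(\widehat S_N;\mathbb{R})$ its identity component; $\widehat\Gamma_N=SO_0(\widehat S_N;\mathbb{R})\cap\mathbb{Z}^{5\times5}$, $\widehat{\mathcal G}_N=SO_0(\widehat S_N;\mathbb{R})\cap\mathbb{Q}^{5\times5}$, and $\widehat{\mathcal G}_{N,p}=\{p^{-r}M\in\widehat{\mathcal G}_N: M\text{ integral},\ r\in\mathbb{N}_0\}$. $\mathcal H(U,G)$ denotes the Hecke algebra over $\mathbb{Z}$ of a Hecke pair $(U,G)$ (free $\mathbb{Z}$-module on double cosets $UgU$ with the standard multiplication). Define the double cosets $T_{N,1}(p)=\widehat\Gamma_N\tfrac1p\operatorname{diag}(1,p,p,p,p^2)\widehat\Gamma_N$ and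 $T_{N,2}(p)=\widehat\Gamma_N\tfrac1p\operatorname{diag}(1,1,p,p^2,p^2)\widehat\Gamma_N$. *)

theory Defs
  imports
    "HOL-Analysis.Analysis"
    "HOL-Algebra.Coset"
    "HOL-Algebra.Ring"
    "HOL-Library.Poly_Mapping"
    "HOL-Computational_Algebra.Primes"
    "HOL-Computational_Algebra.Squarefree"
begin

section \<open>The Hecke algebra of a Hecke pair\<close>

definition double_coset :: "('a, 'b) monoid_scheme \<Rightarrow> 'a set \<Rightarrow> 'a \<Rightarrow> 'a set" where
  "double_coset G U g = U <#>\<^bsub>G\<^esub> {g} <#>\<^bsub>G\<^esub> U"

definition double_cosets :: "('a, 'b) monoid_scheme \<Rightarrow> 'a set \<Rightarrow> 'a set set" where
  "double_cosets G U = double_coset G U ` carrier G"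

definition rep :: "'a set \<Rightarrow> 'a" where
  "rep X = (SOME x. x \<in> X)"

text \<open>
  If \<open>A\<close> and \<open>B\<close> are double cosets with decompositions into right cosets \<open>A = \<Squnion>\<^sub>i U a\<^sub>i\<close> and
  \<open>B = \<Squnion>\<^sub>j U b\<^sub>j\<close>, then the coefficient of \<open>U x U\<close> in the product of \<open>A\<close> and \<open>B\<close> is the number
  of pairs \<open>(i, j)\<close> with \<open>U a\<^sub>i b\<^sub>j = U x\<close>. The lemmas below show that neither the
  representatives \<open>a\<^sub>i, b\<^sub>j\<close> nor the choice of \<open>x\<close> in its double coset matter.
\<close>
definition hecke_coeff ::
  "('a, 'b) monoid_scheme \<Rightarrow> 'a set \<Rightarrow> 'a set \<Rightarrow> 'a set \<Rightarrow> 'a \<Rightarrow> nat" where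
  "hecke_coeff G U A B x =
     card {(X, Y). X \<in> rcosets\<^bsub>G\<^esub> U \<and> X \<subseteq> A \<and> Y \<in> rcosets\<^bsub>G\<^esub> U \<and> Y \<subseteq> B \<and>
                   U #>\<^bsub>G\<^esub> (rep X \<otimes>\<^bsub>G\<^esub> rep Y) = U #>\<^bsub>G\<^esub> x}"

text \<open>For a Hecke pair the double cosets contained in \<open>A B\<close> are finite in number.\<close>
definition double_coset_prod ::
  "('a, 'b) monoid_scheme \<Rightarrow> 'a set \<Rightarrow> 'a set \<Rightarrow> 'a set \<Rightarrow> ('a set \<Rightarrow>\<^sub>0 int)" where
  "double_coset_prod G U A B =
     (\<Sum>C \<in> {C \<in> double_cosets G U. C \<subseteq> A <#>\<^bsub>G\<^esub> B}.
        frag_cmul (int (hecke_coeff G U A B (rep C))) (frag_of C))"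

definition hecke_algebra ::
  "'a set \<Rightarrow> ('a, 'b) monoid_scheme \<Rightarrow> ('a set \<Rightarrow>\<^sub>0 int) ring" where
  "hecke_algebra U G =
     \<lparr>carrier = {f. Poly_Mapping.keys f \<subseteq> double_cosets G U},
      mult = (\<lambda>f g. frag_extend (\<lambda>A. frag_extend (\<lambda>B. double_coset_prod G U A B) g) f),
      one = frag_of U,
      zero = 0,
      add = (+)\<rparr>"

lemma rep_in: "x \<in> X \<Longrightarrow> rep X \<in> X"
  unfolding rep_def by (rule someI)

context group
begin

lemma double_coset_alt: "double_coset G U g = {u \<otimes> g \<otimes> v | u v. u \<in> U \<and> v \<in> U}"
  unfolding double_coset_def set_mult_def by auto

lemma rep_rcoset:
  assumes "subgroup U G" "X \<in> rcosets U"
  shows "rep X \<in> X" "rep X \<in> carrier G" "X = U #> rep X"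
proof -
  obtain a where a: "a \<in> carrier G" "X = U #> a"
    using assms(2) unfolding RCOSETS_def by auto
  show 1: "rep X \<in> X"
    using rcos_self[OF a(1) assms(1)] a(2) rep_in by fast
  show 2: "rep X \<in> carrier G"
    using 1 a assms(1) r_coset_subset_G subgroup.subset by blast
  show "X = U #> rep X"
    using 1 a assms(1) repr_independence by blast
qed

lemma double_coset_mult_closed:
  assumes "subgroup U G" "A \<in> double_cosets G U" "a \<in> A" "u \<in> U"
  shows "a \<in> carrier G" "a \<otimes> u \<in> A" "u \<otimes> a \<in> A"
proof -
  interpret U: subgroup U G by fact
  obtain g where g: "g \<in> carrier G" "A = double_coset G U g"
    using assms(2) unfolding double_cosets_def by auto
  obtain s t where st: "s \<in> U" "t \<in> U" "a = s \<otimes> g \<otimes> t"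
    using assms(3) g(2) unfolding double_coset_alt by auto
  note c = U.mem_carrier[OF st(1)] U.mem_carrier[OF st(2)] U.mem_carrier[OF assms(4)] g(1)
  show "a \<in> carrier G" using st c by simp
  have "a \<otimes> u = s \<otimes> g \<otimes> (t \<otimes> u)" using st c by (simp add: m_assoc)
  then show "a \<otimes> u \<in> A"
    using g(2) st assms(4) unfolding double_coset_alt by blast
  have "u \<otimes> a = (u \<otimes> s) \<otimes> g \<otimes> t" using st c by (simp add: m_assoc)
  then show "u \<otimes> a \<in> A"
    using g(2) st assms(4) unfolding double_coset_alt by blast
qed

lemma hecke_coeff_eq:
  assumes U: "subgroup U G" and A: "A \<in> double_cosets G U" and B: "B \<in> double_cosets G U"
    and x: "x \<in> carrier G"
  shows "hecke_coeff G U A B x = card {Y \<in> rcosets U. Y \<subseteq> B \<and> x \<in> A <#> Y}"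
proof -
  interpret U: subgroup U G by fact
  let ?P = "{(X, Y). X \<in> rcosets U \<and> X \<subseteq> A \<and> Y \<in> rcosets U \<and> Y \<subseteq> B \<and>
              U #> (rep X \<otimes> rep Y) = U #> x}"
  have uniq: "X = U #> (x \<otimes> inv (rep Y))"
    if "X \<in> rcosets U" "Y \<in> rcosets U" "U #> (rep X \<otimes> rep Y) = U #> x" for X Y
  proof -
    note X = rep_rcoset[OF U that(1)] and Y = rep_rcoset[OF U that(2)]
    have "U #> (x \<otimes> inv (rep Y)) = (U #> x) #> inv (rep Y)"
      using x Y(2) by (simp add: coset_mult_assoc U.subset)
    also have "\<dots> = U #> (rep X \<otimes> rep Y \<otimes> inv (rep Y))"
      using that(3)[symmetric] X(2) Y(2) by (simp add: coset_mult_assoc U.subset)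
    also have "\<dots> = X"
      using X(2) X(3)[symmetric] Y(2) by (simp add: m_assoc)
    finally show ?thesis ..
  qed
  have inj: "inj_on snd ?P"
  proof (rule inj_onI)
    fix q q' assume q: "q \<in> ?P" "q' \<in> ?P" and eq: "snd q = snd q'"
    have "fst q = U #> (x \<otimes> inv (rep (snd q)))" "fst q' = U #> (x \<otimes> inv (rep (snd q')))"
      using q by (intro uniq; simp add: case_prod_beta)+
    then show "q = q'" using eq by (simp add: prod_eq_iff)
  qed
  have "snd ` ?P = {Y \<in> rcosets U. Y \<subseteq> B \<and> x \<in> A <#> Y}"
  proof (intro equalityI subsetI)
    fix Y assume "Y \<in> snd ` ?P"
    then obtain X where P: "X \<in> rcosets U" "X \<subseteq> A" "Y \<in> rcosets U" "Y \<subseteq> B"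
      "U #> (rep X \<otimes> rep Y) = U #> x" by auto
    note X = rep_rcoset[OF U P(1)] and Y = rep_rcoset[OF U P(3)]
    have "x \<in> U #> (rep X \<otimes> rep Y)" using P(5) rcos_self[OF x U] by simp
    then obtain u where u: "u \<in> U" "x = u \<otimes> (rep X \<otimes> rep Y)" unfolding r_coset_def by auto
    have "u \<otimes> rep X \<in> A"
      using double_coset_mult_closed(3)[OF U A _ u(1)] X P(2) by blast
    moreover have "x = (u \<otimes> rep X) \<otimes> rep Y"
      using u X(2) Y(2) by (simp add: m_assoc)
    ultimately have "x \<in> A <#> Y" using Y(1) unfolding set_mult_def by blast
    then show "Y \<in> {Y \<in> rcosets U. Y \<subseteq> B \<and> x \<in> A <#> Y}" using P by blast
  next
    fix Y assume "Y \<in> {Y \<in> rcosets U. Y \<subseteq> B \<and> x \<in> A <#> Y}"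
    then have P: "Y \<in> rcosets U" "Y \<subseteq> B" "x \<in> A <#> Y" by auto
    note Y = rep_rcoset[OF U P(1)]
    obtain a y where ay: "a \<in> A" "y \<in> Y" "x = a \<otimes> y"
      using P(3) unfolding set_mult_def by auto
    have "y \<in> U #> rep Y" using ay(2) Y(3) by (rule back_subst)
    then obtain u where u: "u \<in> U" "y = u \<otimes> rep Y"
      unfolding r_coset_def by auto
    define b where "b = a \<otimes> u"
    have a: "a \<in> carrier G" and b: "b \<in> A"
      using double_coset_mult_closed[OF U A ay(1) u(1)] by (auto simp: b_def)
    have bc: "b \<in> carrier G" using a u by (simp add: b_def)
    have xb: "x = b \<otimes> rep Y" using ay u a Y(2) by (simp add: b_def m_assoc)
    let ?X = "U #> b"
    have XR: "?X \<in> rcosets U" using bc unfolding RCOSETS_def by blast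
    have XA: "?X \<subseteq> A"
      using double_coset_mult_closed(3)[OF U A b] unfolding r_coset_def by auto
    note X = rep_rcoset[OF U XR]
    have "U #> (rep ?X \<otimes> rep Y) = (U #> rep ?X) #> rep Y"
      using X(2) Y(2) by (simp add: coset_mult_assoc U.subset)
    also have "\<dots> = U #> x"
      using X(3)[symmetric] bc Y(2) xb by (simp add: coset_mult_assoc U.subset)
    finally have "(?X, Y) \<in> ?P" using XR XA P by auto
    then have "snd (?X, Y) \<in> snd ` ?P" by (rule imageI)
    then show "Y \<in> snd ` ?P" by (simp only: snd_conv)
  qed
  then show ?thesis
    unfolding hecke_coeff_def using card_image[OF inj] by (simp only:)
qed

lemma hecke_coeff_cong:
  assumes U: "subgroup U G" and A: "A \<in> double_cosets G U" and B: "B \<in> double_cosets G U"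
    and C: "C \<in> double_cosets G U" and "x \<in> C" "y \<in> C"
  shows "hecke_coeff G U A B x = hecke_coeff G U A B y"
proof -
  interpret U: subgroup U G by fact
  have xc: "x \<in> carrier G" and yc: "y \<in> carrier G"
    using double_coset_mult_closed(1)[OF U C _ U.one_closed] assms by auto
  have Bc: "b \<in> carrier G" if "b \<in> B" for b
    using double_coset_mult_closed(1)[OF U B that U.one_closed] .
  have Ac: "a \<in> carrier G" if "a \<in> A" for a
    using double_coset_mult_closed(1)[OF U A that U.one_closed] .
  let ?S = "\<lambda>x. {Y \<in> rcosets U. Y \<subseteq> B \<and> x \<in> A <#> Y}"
  have sub: "(\<lambda>Y. Y #> v) ` ?S x \<subseteq> ?S (u \<otimes> x \<otimes> v)"
    if "u \<in> U" "v \<in> U" and x: "x \<in> carrier G" for u v x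
  proof (intro image_subsetI)
    fix Y assume "Y \<in> ?S x"
    then have P: "Y \<in> rcosets U" "Y \<subseteq> B" "x \<in> A <#> Y" by auto
    obtain g where g: "g \<in> carrier G" "Y = U #> g" using P(1) unfolding RCOSETS_def by auto
    have "Y #> v = U #> (g \<otimes> v)" using g that by (simp add: coset_mult_assoc U.subset)
    then have 1: "Y #> v \<in> rcosets U" using g that unfolding RCOSETS_def by auto
    have 2: "Y #> v \<subseteq> B"
      using P(2) double_coset_mult_closed(2)[OF U B _ that(2)] unfolding r_coset_def by auto
    obtain a b where ab: "a \<in> A" "b \<in> Y" "x = a \<otimes> b"
      using P(3) unfolding set_mult_def by auto
    have "u \<otimes> x \<otimes> v = (u \<otimes> a) \<otimes> (b \<otimes> v)"
      using ab Ac Bc P(2) that by (simp add: m_assoc subset_iff)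
    moreover have "u \<otimes> a \<in> A" using double_coset_mult_closed(3)[OF U A ab(1) that(1)] .
    moreover have "b \<otimes> v \<in> Y #> v" using ab(2) unfolding r_coset_def by auto
    ultimately have "u \<otimes> x \<otimes> v \<in> A <#> (Y #> v)" unfolding set_mult_def by blast
    then show "Y #> v \<in> ?S (u \<otimes> x \<otimes> v)" using 1 2 by blast
  qed
  have cancel_left: "inv a \<otimes> (a \<otimes> b) = b" "a \<otimes> (inv a \<otimes> b) = b"
    if "a \<in> carrier G" "b \<in> carrier G" for a b
    using that by (simp_all add: m_assoc[symmetric])
  obtain u v where uv: "u \<in> U" "v \<in> U" "y = u \<otimes> x \<otimes> v"
  proof -
    obtain g where g: "g \<in> carrier G" "C = double_coset G U g"
      using C unfolding double_cosets_def by auto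
    obtain s t s' t' where st: "s \<in> U" "t \<in> U" "x = s \<otimes> g \<otimes> t"
      "s' \<in> U" "t' \<in> U" "y = s' \<otimes> g \<otimes> t'"
      using assms(5,6) g(2) unfolding double_coset_alt by auto
    have "y = (s' \<otimes> inv s) \<otimes> x \<otimes> (inv t \<otimes> t')"
      using st g(1) by (simp add: m_assoc cancel_left)
    then show ?thesis using st by (intro that[of "s' \<otimes> inv s" "inv t \<otimes> t'"]) auto
  qed
  have cancel: "(Y #> v) #> inv v = Y" "(Y #> inv v) #> v = Y" if "Y \<subseteq> B" "v \<in> U" for Y v
  proof -
    have "Y \<subseteq> carrier G" using that Bc by auto
    then show "(Y #> v) #> inv v = Y" "(Y #> inv v) #> v = Y"
      using that by (simp_all add: coset_mult_assoc coset_mult_one)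
  qed
  have x_eq: "inv u \<otimes> y \<otimes> inv v = x"
    using uv xc by (simp add: m_assoc cancel_left)
  have "bij_betw (\<lambda>Y. Y #> v) (?S x) (?S y)"
  proof (rule bij_betw_byWitness[where f' = "\<lambda>Y. Y #> inv v"])
    show "(\<lambda>Y. Y #> v) ` ?S x \<subseteq> ?S y" using sub[OF uv(1,2) xc] uv(3) by simp
    show "(\<lambda>Y. Y #> inv v) ` ?S y \<subseteq> ?S x"
      using sub[of "inv u" "inv v" y] uv yc x_eq by simp
  qed (use cancel uv(2) in auto)
  then show ?thesis
    unfolding hecke_coeff_eq[OF U A B xc] hecke_coeff_eq[OF U A B yc] by (rule bij_betw_same_card)
qed

end


section \<open>Integral polynomials in two elements of a ring\<close>

text \<open>
  A finitely supported \<open>P :: nat \<times> nat \<Rightarrow>\<^sub>0 int\<close> stands for the polynomial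
  \<open>\<Sum>(i, j). P (i, j) X\<^sup>i Y\<^sup>j\<close> with integer coefficients.
\<close>
definition eval_poly2 ::
  "('a, 'b) ring_scheme \<Rightarrow> (nat \<times> nat \<Rightarrow>\<^sub>0 int) \<Rightarrow> 'a \<Rightarrow> 'a \<Rightarrow> 'a" where
  "eval_poly2 R P x y =
     (\<Oplus>\<^bsub>R\<^esub>m \<in> Poly_Mapping.keys P.
        [Poly_Mapping.lookup P m] \<cdot>\<^bsub>R\<^esub> (x [^]\<^bsub>R\<^esub> fst m \<otimes>\<^bsub>R\<^esub> y [^]\<^bsub>R\<^esub> snd m))"

text \<open>
  Algebraic independence is a notion for commuting elements; as the ambient ring is not
  assumed to be commutative, this is part of the definition.
\<close>
definition algebraically_independent2 :: "('a, 'b) ring_scheme \<Rightarrow> 'a \<Rightarrow> 'a \<Rightarrow> bool" where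
  "algebraically_independent2 R x y \<longleftrightarrow>
     x \<in> carrier R \<and> y \<in> carrier R \<and> x \<otimes>\<^bsub>R\<^esub> y = y \<otimes>\<^bsub>R\<^esub> x \<and>
     (\<forall>P. eval_poly2 R P x y = \<zero>\<^bsub>R\<^esub> \<longrightarrow> P = 0)"


section \<open>The orthogonal groups\<close>

definition congruent_by :: "real^'n^'n \<Rightarrow> real^'m^'n \<Rightarrow> real^'m^'m" where
  "congruent_by A B = transpose B ** A ** B"

text \<open>
  The block matrix with antidiagonal corners \<open>1\<close> and middle block
  \<open>S\<^sub>N = ((0, 0, 1), (0, - 2 N, 0), (1, 0, 0))\<close>, written out.
\<close>
definition S_hat :: "nat \<Rightarrow> real^5^5" where
  "S_hat N = vector [vector [0, 0, 0, 0, 1],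
                     vector [0, 0, 0, 1, 0],
                     vector [0, 0, - 2 * real N, 0, 0],
                     vector [0, 1, 0, 0, 0],
                     vector [1, 0, 0, 0, 0]]"

definition diag5 :: "real \<Rightarrow> real \<Rightarrow> real \<Rightarrow> real \<Rightarrow> real \<Rightarrow> real^5^5" where
  "diag5 a b c d e = vector [vector [a, 0, 0, 0, 0],
                             vector [0, b, 0, 0, 0],
                             vector [0, 0, c, 0, 0],
                             vector [0, 0, 0, d, 0],
                             vector [0, 0, 0, 0, e]]"

definition SO_hat :: "nat \<Rightarrow> (real^5^5) set" where
  "SO_hat N = {M. det M = 1 \<and> congruent_by (S_hat N) M = S_hat N}"

definition SO0_hat :: "nat \<Rightarrow> (real^5^5) set" where
  "SO0_hat N = connected_component_set (SO_hat N) (mat 1)"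

definition integral_matrix :: "real^'n^'m \<Rightarrow> bool" where
  "integral_matrix M \<longleftrightarrow> (\<forall>i j. M $ i $ j \<in> \<int>)"

definition rational_matrix :: "real^'n^'m \<Rightarrow> bool" where
  "rational_matrix M \<longleftrightarrow> (\<forall>i j. M $ i $ j \<in> \<rat>)"

definition matrix_group :: "(real^'n^'n) set \<Rightarrow> (real^'n^'n) monoid" where
  "matrix_group X = \<lparr>carrier = X, mult = (**), one = mat 1\<rparr>"

definition Gamma_hat :: "nat \<Rightarrow> (real^5^5) set" where
  "Gamma_hat N = {M \<in> SO0_hat N. integral_matrix M}"

definition G_hat :: "nat \<Rightarrow> (real^5^5) monoid" where
  "G_hat N = matrix_group {M \<in> SO0_hat N. rational_matrix M}"

definition G_hat_p :: "nat \<Rightarrow> nat \<Rightarrow> (real^5^5) monoid" where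
  "G_hat_p N p = matrix_group
     {g \<in> carrier (G_hat N). \<exists>(r::nat) M. integral_matrix M \<and> g = (1 / real p ^ r) *\<^sub>R M}"

text \<open>
  The double cosets are the same sets whether formed in \<open>G_hat N\<close> or in \<open>G_hat_p N p\<close>,
  as both carry the matrix product.
\<close>
definition T1 :: "nat \<Rightarrow> nat \<Rightarrow> ((real^5^5) set \<Rightarrow>\<^sub>0 int)" where
  "T1 N p = frag_of (double_coset (G_hat N) (Gamma_hat N)
     ((1 / real p) *\<^sub>R diag5 1 (real p) (real p) (real p) (real p ^ 2)))"

definition T2 :: "nat \<Rightarrow> nat \<Rightarrow> ((real^5^5) set \<Rightarrow>\<^sub>0 int)" where
  "T2 N p = frag_of (double_coset (G_hat N) (Gamma_hat N)
     ((1 / real p) *\<^sub>R diag5 1 1 (real p) (real p ^ 2) (real p ^ 2)))"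

end

theory Submission
  imports Defs "HOL-Number_Theory.Cong" "HOL-Computational_Algebra.Nth_Powers"
begin

text \<open>
  Every double coset contains exactly one matrix
  \<open>D(m, n) = diag(1/(mn), 1/n, 1, n, mn)\<close> with positive integers \<open>m, n\<close>. Its invariants are the common
  denominators \<open>mn\<close> of the entries and \<open>mn\<^sup>2\<close> of the \<open>2 \<times> 2\<close> minors. They are submultiplicative on products
  of matrices, and the double coset of \<open>D(m, n) D(m', n')\<close>, where both reach the product bound, occurs in the
  product of the double cosets of \<open>D(m, n)\<close> and \<open>D(m', n')\<close> with coefficient 1. Hence, for the lexicographic
  order on the pairs of invariants, leading terms multiply. This excludes zero-divisors, and as
  \<open>T\<^sub>1(p)\<^sup>i T\<^sub>2(p)\<^sup>j\<close> is monic with leading term \<open>D(p\<^sup>i, p\<^sup>j)\<close>, these monomials form a basis of the primary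
  component. Commutativity comes from the fact that every double coset is closed under inversion.

  The representatives are obtained by scaling \<open>g\<close> to a primitive integral matrix, moving a primitive
  isotropic vector with primitive image to \<open>e\<^sub>1\<close> on both sides (\<open>\<Gamma>\<close> is transitive on these vectors because \<open>N\<close>
  is squarefree), and repeating this in the remaining \<open>3 \<times> 3\<close> block, where transitivity needs Atkin--Lehner
  elements.
\<close>

section \<open>Hecke pairs with a Cartan decomposition\<close>

text \<open>The form is not unimodular: its inverse has denominator 2N at the third coordinate.
  Squarefreeness enters mainly through the fact that 4N | r^2 forces 2N | r. Integral vectors
  isotropic for the inverse form therefore have third coordinate divisible by 2N, so a matrix and
  its inverse have the same denominators, and every unipotent clearing step is done by an integral
  element. In dimension 5 a second hyperbolic plane allows a Euclidean descent. In the ternary block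
  none is left: the integral group there contains an image of Gamma_0(N), whose cusps correspond to
  the divisors d of N, and the primitive isotropic vectors are, up to sign, (d s^2, s t, e t^2) with
  N = d e. So d has to be chosen together with the vector. On the Hecke side the crucial point is
  the coefficient 1: if a b = D(s) D(t) with a, b in the double cosets of D(s), D(t), then a already
  lies in D(s) \<Gamma>. Elements are placed in the identity component by connecting them to 1
  inside the orthogonal group; in the other direction, the sign of a 2 x 2 determinant excludes the
  one wrong diagonal form that determinant 1 still allows.\<close>

text \<open>A pair \<open>(m, n)\<close> stands for the diagonal matrix \<open>D(m, n)\<close>; the two levels are the least common
  denominators of its entries and of its \<open>2 \<times> 2\<close> minors.\<close>
definition entry_level :: "nat \<times> nat \<Rightarrow> nat" where
  "entry_level s = fst s * snd s"

definition minor_level :: "nat \<times> nat \<Rightarrow> nat" where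
  "minor_level s = fst s * (snd s)\<^sup>2"

definition pair_times :: "nat \<times> nat \<Rightarrow> nat \<times> nat \<Rightarrow> nat \<times> nat" where
  "pair_times s t = (fst s * fst t, snd s * snd t)"

definition level_le :: "nat \<times> nat \<Rightarrow> nat \<times> nat \<Rightarrow> bool" where
  "level_le s t \<longleftrightarrow> entry_level s < entry_level t \<or>
     (entry_level s = entry_level t \<and> minor_level s \<le> minor_level t)"

definition pos_pair :: "nat \<times> nat \<Rightarrow> bool" where
  "pos_pair s \<longleftrightarrow> fst s > 0 \<and> snd s > 0"

lemma level_pos: "pos_pair s \<Longrightarrow> entry_level s > 0" "pos_pair s \<Longrightarrow> minor_level s > 0"
  by (auto simp: pos_pair_def entry_level_def minor_level_def)

lemma level_times:
  "entry_level (pair_times s t) = entry_level s * entry_level t"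
  "minor_level (pair_times s t) = minor_level s * minor_level t"
  by (auto simp: entry_level_def minor_level_def pair_times_def power_mult_distrib)

lemma level_eqD:
  assumes "pos_pair s" "pos_pair t" "entry_level s = entry_level t" "minor_level s = minor_level t"
  shows "s = t"
proof -
  have m: "minor_level u = entry_level u * snd u" for u
    by (simp add: minor_level_def entry_level_def power2_eq_square)
  have "snd s = snd t"
    using assms level_pos(1)[OF assms(1)] by (simp add: m)
  moreover from this have "fst s = fst t"
    using assms by (simp add: entry_level_def pos_pair_def)
  ultimately show ?thesis by (simp add: prod_eq_iff)
qed

lemma level_le_refl: "level_le s s"
  by (simp add: level_le_def)

lemma level_le_antisym:
  "level_le s t \<Longrightarrow> level_le t s \<Longrightarrow> pos_pair s \<Longrightarrow> pos_pair t \<Longrightarrow> s = t"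
  by (rule level_eqD) (auto simp: level_le_def)

lemma level_le_max:
  assumes "finite A" "A \<noteq> {}"
  shows "\<exists>s\<in>A. \<forall>t\<in>A. level_le t s"
proof -
  define e where "e = Max (entry_level ` A)"
  define B where "B = {s \<in> A. entry_level s = e}"
  have "e \<in> entry_level ` A" unfolding e_def using assms by (intro Max_in) auto
  then have B: "finite B" "B \<noteq> {}" using assms by (auto simp: B_def)
  have "Max (minor_level ` B) \<in> minor_level ` B" using B by (intro Max_in) auto
  then obtain s where s: "s \<in> B" "minor_level s = Max (minor_level ` B)" by auto
  have "level_le t s" if "t \<in> A" for t
  proof -
    have "entry_level t \<le> e" unfolding e_def using assms that by auto
    moreover have "minor_level t \<le> minor_level s" if "entry_level t = e"
      unfolding s(2) using B \<open>t \<in> A\<close> that by (auto simp: B_def)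
    ultimately show ?thesis using s(1) by (auto simp: level_le_def B_def)
  qed
  moreover have "s \<in> A" using s by (simp add: B_def)
  ultimately show ?thesis by blast
qed

lemma mult_le_factor:
  fixes a b c d :: nat
  assumes "a \<le> c" "b \<le> d" "c * d \<le> a * b" "c > 0" "d > 0"
  shows "a = c \<and> b = d"
proof -
  have "a * b \<le> c * b" "c * b \<le> c * d" using assms by auto
  then have "c * b = c * d" "a * b = c * b" using assms(3) by linarith+
  then show ?thesis using assms by auto
qed

lemma level_le_mult:
  assumes pos: "pos_pair s" "pos_pair t" and le: "level_le s' s" "level_le t' t"
    and u: "entry_level u \<le> entry_level s' * entry_level t'"
      "minor_level u \<le> minor_level s' * minor_level t'"
  shows "level_le u (pair_times s t)"
proof -
  have e: "entry_level s' \<le> entry_level s" "entry_level t' \<le> entry_level t"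
    using le by (auto simp: level_le_def)
  have "entry_level u \<le> entry_level s * entry_level t"
    using u(1) mult_le_mono[OF e] by linarith
  moreover have "minor_level u \<le> minor_level s * minor_level t"
    if "entry_level u = entry_level s * entry_level t"
  proof -
    have "entry_level s' = entry_level s \<and> entry_level t' = entry_level t"
      using e u(1) that pos by (intro mult_le_factor) (auto simp: level_pos)
    then have "minor_level s' \<le> minor_level s" "minor_level t' \<le> minor_level t"
      using le by (auto simp: level_le_def)
    then show ?thesis using u(2) mult_le_mono[of "minor_level s'"] by (meson le_trans)
  qed
  ultimately show ?thesis unfolding level_le_def level_times by linarith
qed

text \<open>Both levels are multiplicative. If the product bound of \<open>s'\<close>,
  \<open>t'\<close> reaches that of the larger pairs \<open>s\<close>, \<open>t\<close>, the entry
  levels agree by \<open>mult_le_factor\<close>; only then does the order compare the minor levels,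
  to which the same argument applies.\<close>

lemma level_le_mult_eq:
  assumes pos: "pos_pair s" "pos_pair t" "pos_pair s'" "pos_pair t'"
    and le: "level_le s' s" "level_le t' t"
    and u: "entry_level (pair_times s t) \<le> entry_level s' * entry_level t'"
      "minor_level (pair_times s t) \<le> minor_level s' * minor_level t'"
  shows "s' = s \<and> t' = t"
proof -
  have e: "entry_level s' = entry_level s \<and> entry_level t' = entry_level t"
    using le u pos by (intro mult_le_factor) (auto simp: level_pos level_times level_le_def)
  then have "minor_level s' = minor_level s \<and> minor_level t' = minor_level t"
    using le u pos by (intro mult_le_factor) (auto simp: level_pos level_times level_le_def)
  then show ?thesis using e pos by (auto intro: level_eqD)
qed

lemma finite_level_le: "finite {s. pos_pair s \<and> entry_level s \<le> k}"
proof (rule finite_subset)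
  show "{s. pos_pair s \<and> entry_level s \<le> k} \<subseteq> {..k} \<times> {..k}"
  proof
    fix s assume s: "s \<in> {s. pos_pair s \<and> entry_level s \<le> k}"
    then have "fst s * 1 \<le> fst s * snd s" "1 * snd s \<le> fst s * snd s"
      by (intro mult_le_mono; simp add: pos_pair_def)+
    then have "fst s \<le> k" "snd s \<le> k" using s unfolding entry_level_def by (simp_all only: mult_1 mult_1_right mem_Collect_eq; linarith)+
    then show "s \<in> {..k} \<times> {..k}" by (cases s) auto
  qed
qed auto

section \<open>Coefficients, multiples and polynomial values in the Hecke algebra\<close>

lemma lookup_sum_poly_mapping:
  "Poly_Mapping.lookup (sum f A) x = (\<Sum>a\<in>A. Poly_Mapping.lookup (f a) x)"
  by (induction A rule: infinite_finite_induct) (auto simp: lookup_add)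

lemma hecke_algebra_simps [simp]:
  "carrier (hecke_algebra U G) = {f. Poly_Mapping.keys f \<subseteq> double_cosets G U}"
  "\<zero>\<^bsub>hecke_algebra U G\<^esub> = 0"
  "\<one>\<^bsub>hecke_algebra U G\<^esub> = frag_of U"
  "f \<oplus>\<^bsub>hecke_algebra U G\<^esub> g = f + g"
  by (auto simp: hecke_algebra_def)

lemma lookup_hecke_mult:
  "Poly_Mapping.lookup (f \<otimes>\<^bsub>hecke_algebra U G\<^esub> g) Z =
     (\<Sum>A\<in>Poly_Mapping.keys f. \<Sum>B\<in>Poly_Mapping.keys g.
        Poly_Mapping.lookup f A * Poly_Mapping.lookup g B *
        Poly_Mapping.lookup (double_coset_prod G U A B) Z)"
  by (simp add: hecke_algebra_def frag_extend_def lookup_sum_poly_mapping sum_distrib_left mult.assoc)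

lemma keys_double_coset_prod: "Poly_Mapping.keys (double_coset_prod G U A B) \<subseteq> double_cosets G U"
proof -
  have "Poly_Mapping.keys (sum h T) \<subseteq> (\<Union>t\<in>T. Poly_Mapping.keys (h t))" for h :: "'a set \<Rightarrow> 'a set \<Rightarrow>\<^sub>0 int" and T
    by (rule keys_sum)
  from this[of "\<lambda>C. frag_cmul (int (hecke_coeff G U A B (rep C))) (frag_of C)"]
  show ?thesis unfolding double_coset_prod_def by (force simp: keys_frag_of)
qed

lemma hecke_mult_closed:
  "f \<otimes>\<^bsub>hecke_algebra U G\<^esub> g \<in> carrier (hecke_algebra U G)"
proof -
  have "Poly_Mapping.keys (f \<otimes>\<^bsub>hecke_algebra U G\<^esub> g) \<subseteq> double_cosets G U"
  proof
    fix Z assume "Z \<in> Poly_Mapping.keys (f \<otimes>\<^bsub>hecke_algebra U G\<^esub> g)"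
    then have "Poly_Mapping.lookup (f \<otimes>\<^bsub>hecke_algebra U G\<^esub> g) Z \<noteq> 0"
      by (simp add: in_keys_iff)
    then obtain A where "(\<Sum>B\<in>Poly_Mapping.keys g.
        Poly_Mapping.lookup f A * Poly_Mapping.lookup g B *
        Poly_Mapping.lookup (double_coset_prod G U A B) Z) \<noteq> 0"
      unfolding lookup_hecke_mult by (meson sum.not_neutral_contains_not_neutral)
    then obtain B where "Poly_Mapping.lookup f A * Poly_Mapping.lookup g B *
        Poly_Mapping.lookup (double_coset_prod G U A B) Z \<noteq> 0"
      by (meson sum.not_neutral_contains_not_neutral)
    then have "Poly_Mapping.lookup (double_coset_prod G U A B) Z \<noteq> 0" by simp
    then have "Z \<in> Poly_Mapping.keys (double_coset_prod G U A B)" by (simp add: in_keys_iff)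
    then show "Z \<in> double_cosets G U" using keys_double_coset_prod by blast
  qed
  then show ?thesis by simp
qed

lemma abelian_group_hecke: "abelian_group (hecke_algebra U G)"
proof (rule abelian_groupI)
  fix x y z assume *: "x \<in> carrier (hecke_algebra U G)" "y \<in> carrier (hecke_algebra U G)"
  show "x \<oplus>\<^bsub>hecke_algebra U G\<^esub> y \<in> carrier (hecke_algebra U G)"
    using * keys_add[of x y] by auto
  show "\<exists>y\<in>carrier (hecke_algebra U G). y \<oplus>\<^bsub>hecke_algebra U G\<^esub> x = \<zero>\<^bsub>hecke_algebra U G\<^esub>"
    using * by (intro bexI[of _ "- x"]) auto
qed (auto simp: add.assoc add.commute)

lemma hecke_add_pow:
  assumes "x \<in> carrier (hecke_algebra U G)"
  shows "[(k::int)] \<cdot>\<^bsub>hecke_algebra U G\<^esub> x = frag_cmul k x"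
proof -
  interpret abelian_group "hecke_algebra U G" by (rule abelian_group_hecke)
  have nat: "[(n::nat)] \<cdot>\<^bsub>hecke_algebra U G\<^esub> x = frag_cmul (int n) x" for n
    by (induction n) (use assms in \<open>auto simp: frag_cmul_distrib add.commute\<close>)
  have neg: "\<ominus>\<^bsub>hecke_algebra U G\<^esub> y = - y" if "y \<in> carrier (hecke_algebra U G)" for y
    using that by (intro minus_equality) auto
  show ?thesis
  proof (cases "k \<ge> 0")
    case True
    then show ?thesis using nat[of "nat k"] by (simp add: add_pow_int_ge)
  next
    case False
    have "frag_cmul (int (nat (- k))) x \<in> carrier (hecke_algebra U G)"
      using assms by (auto split: if_splits)
    then show ?thesis
      using False nat[of "nat (- k)"] neg by (simp add: add_pow_int_lt)
  qed
qed

lemma hecke_finsum: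
  assumes "finite A" "\<And>a. a \<in> A \<Longrightarrow> f a \<in> carrier (hecke_algebra U G)"
  shows "(\<Oplus>\<^bsub>hecke_algebra U G\<^esub>a\<in>A. f a) = (\<Sum>a\<in>A. f a)"
proof -
  interpret abelian_group "hecke_algebra U G" by (rule abelian_group_hecke)
  show ?thesis using assms
  proof (induction A rule: finite_induct)
    case (insert a A)
    have "(\<Oplus>\<^bsub>hecke_algebra U G\<^esub>a\<in>insert a A. f a) = f a \<oplus>\<^bsub>hecke_algebra U G\<^esub> (\<Oplus>\<^bsub>hecke_algebra U G\<^esub>a\<in>A. f a)"
      using insert by (intro finsum_insert) blast+
    then show ?case using insert by simp
  qed simp
qed

lemma eval_poly2_hecke:
  "eval_poly2 (hecke_algebra U G) P x y =
     (\<Sum>m\<in>Poly_Mapping.keys P. frag_cmul (Poly_Mapping.lookup P m)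
        (x [^]\<^bsub>hecke_algebra U G\<^esub> fst m \<otimes>\<^bsub>hecke_algebra U G\<^esub> y [^]\<^bsub>hecke_algebra U G\<^esub> snd m))"
proof -
  let ?R = "hecke_algebra U G"
  have c: "frag_cmul k (x [^]\<^bsub>?R\<^esub> i \<otimes>\<^bsub>?R\<^esub> y [^]\<^bsub>?R\<^esub> j) \<in> carrier ?R" for k and i j :: nat
    using hecke_mult_closed[where U = U and G = G and f = "x [^]\<^bsub>?R\<^esub> i" and g = "y [^]\<^bsub>?R\<^esub> j"]
    by (auto split: if_splits)
  show ?thesis
    unfolding eval_poly2_def
    by (subst hecke_add_pow[OF hecke_mult_closed], subst hecke_finsum) (use c in auto)
qed

locale cartan_pair = group G for G (structure) +
  fixes U :: "'a set" and D :: "nat \<times> nat \<Rightarrow> 'a" and S :: "(nat \<times> nat) set"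
  assumes subgroup_U: "subgroup U G"
    and D_carrier: "s \<in> S \<Longrightarrow> D s \<in> carrier G"
    and S_pos: "s \<in> S \<Longrightarrow> pos_pair s"
    and S_one: "(1, 1) \<in> S"
    and D_one: "D (1, 1) = \<one>"
    and S_times: "s \<in> S \<Longrightarrow> t \<in> S \<Longrightarrow> pair_times s t \<in> S"
    and D_times: "s \<in> S \<Longrightarrow> t \<in> S \<Longrightarrow> D (pair_times s t) = D s \<otimes> D t"
    and cover: "g \<in> carrier G \<Longrightarrow> \<exists>s\<in>S. g \<in> double_coset G U (D s)"
    and level_bound: "s \<in> S \<Longrightarrow> t \<in> S \<Longrightarrow> u \<in> S \<Longrightarrow>
      D u \<in> double_coset G U (D s) <#> double_coset G U (D t) \<Longrightarrow>
      entry_level u dvd entry_level s * entry_level t \<and>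
      minor_level u dvd minor_level s * minor_level t"
    and extremal: "s \<in> S \<Longrightarrow> t \<in> S \<Longrightarrow> a \<in> double_coset G U (D s) \<Longrightarrow>
      b \<in> double_coset G U (D t) \<Longrightarrow> a \<otimes> b = D (pair_times s t) \<Longrightarrow> inv (D s) \<otimes> a \<in> U"
    and inv_D: "s \<in> S \<Longrightarrow> inv (D s) \<in> double_coset G U (D s)"
begin

abbreviation R where "R \<equiv> hecke_algebra U G"

definition C :: "nat \<times> nat \<Rightarrow> 'a set" where "C s = double_coset G U (D s)"

lemma C_double_coset: "s \<in> S \<Longrightarrow> C s \<in> double_cosets G U"
  by (auto simp: C_def double_cosets_def D_carrier)

lemma C_mult_closed:
  assumes "s \<in> S" "a \<in> C s" "u \<in> U"
  shows "a \<in> carrier G" "a \<otimes> u \<in> C s" "u \<otimes> a \<in> C s"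
  using double_coset_mult_closed[OF subgroup_U C_double_coset[OF assms(1)] assms(2,3)] by auto

lemma U_one: "\<one> \<in> U" using subgroup_U by (rule subgroup.one_closed)
lemma U_inv: "u \<in> U \<Longrightarrow> inv u \<in> U" using subgroup_U by (simp add: subgroup.m_inv_closed)
lemma U_mult: "u \<in> U \<Longrightarrow> v \<in> U \<Longrightarrow> u \<otimes> v \<in> U" using subgroup_U by (simp add: subgroup.m_closed)
lemma U_carrier: "u \<in> U \<Longrightarrow> u \<in> carrier G" using subgroup_U by (rule subgroup.mem_carrier)
lemma C_carrier: "s \<in> S \<Longrightarrow> a \<in> C s \<Longrightarrow> a \<in> carrier G"
  using C_mult_closed(1)[OF _ _ U_one] .

lemma D_in_C: "s \<in> S \<Longrightarrow> D s \<in> C s"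
  unfolding C_def double_coset_alt using U_one D_carrier[of s]
  by (auto intro!: exI[of _ \<one>])

lemma cancel_left: "a \<in> carrier G \<Longrightarrow> b \<in> carrier G \<Longrightarrow> inv a \<otimes> (a \<otimes> b) = b"
    "a \<in> carrier G \<Longrightarrow> b \<in> carrier G \<Longrightarrow> a \<otimes> (inv a \<otimes> b) = b"
  by (simp_all add: m_assoc[symmetric])

lemma in_C_eq:
  assumes "g \<in> carrier G" "a \<in> double_coset G U g"
  shows "double_coset G U g = double_coset G U a"
proof -
  obtain u v where uv: "u \<in> U" "v \<in> U" "a = u \<otimes> g \<otimes> v"
    using assms unfolding double_coset_alt by auto
  note c = U_carrier[OF uv(1)] U_carrier[OF uv(2)] assms(1)
  have 1: "s \<otimes> g \<otimes> t = (s \<otimes> inv u) \<otimes> a \<otimes> (inv v \<otimes> t)" if "s \<in> U" "t \<in> U" for s t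
    using uv c U_carrier that by (simp add: m_assoc cancel_left)
  have 2: "s \<otimes> a \<otimes> t = (s \<otimes> u) \<otimes> g \<otimes> (v \<otimes> t)" if "s \<in> U" "t \<in> U" for s t
    using uv c U_carrier that by (simp add: m_assoc)
  show ?thesis
  proof (intro equalityI subsetI)
    fix x assume "x \<in> double_coset G U g"
    then obtain s t where st: "s \<in> U" "t \<in> U" "x = s \<otimes> g \<otimes> t" unfolding double_coset_alt by auto
    show "x \<in> double_coset G U a"
      unfolding double_coset_alt st(3) 1[OF st(1,2)]
      using U_mult[OF st(1) U_inv[OF uv(1)]] U_mult[OF U_inv[OF uv(2)] st(2)] by blast
  next
    fix x assume "x \<in> double_coset G U a"
    then obtain s t where st: "s \<in> U" "t \<in> U" "x = s \<otimes> a \<otimes> t" unfolding double_coset_alt by auto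
    show "x \<in> double_coset G U g"
      unfolding double_coset_alt st(3) 2[OF st(1,2)]
      using U_mult[OF st(1) uv(1)] U_mult[OF uv(2) st(2)] by blast
  qed
qed

lemma double_cosets_eq: "double_cosets G U = C ` S"
proof
  show "C ` S \<subseteq> double_cosets G U" using C_double_coset by auto
  show "double_cosets G U \<subseteq> C ` S"
  proof
    fix Z assume "Z \<in> double_cosets G U"
    then obtain g where g: "g \<in> carrier G" "Z = double_coset G U g" by (auto simp: double_cosets_def)
    then obtain s where s: "s \<in> S" "g \<in> double_coset G U (D s)" using cover by blast
    then have "Z = C s" using in_C_eq[OF D_carrier] g by (auto simp: C_def)
    then show "Z \<in> C ` S" using s by auto
  qed
qed

lemma C_one: "C (1, 1) = U"
proof -
  have "C (1, 1) \<subseteq> U" 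
  proof
    fix x assume "x \<in> C (1, 1)"
    then obtain u v where "u \<in> U" "v \<in> U" "x = u \<otimes> \<one> \<otimes> v"
      unfolding C_def double_coset_alt D_one by auto
    then show "x \<in> U" using U_carrier U_mult by simp
  qed
  moreover have "u \<in> C (1, 1)" if "u \<in> U" for u
    unfolding C_def double_coset_alt D_one using that U_carrier U_one
    by (intro CollectI exI[of _ u] exI[of _ \<one>]) auto
  ultimately show ?thesis by auto
qed

lemma level_bound_C:
  assumes "s \<in> S" "t \<in> S" "u \<in> S" "C u \<subseteq> C s <#> C t"
  shows "entry_level u \<le> entry_level s * entry_level t"
    "minor_level u \<le> minor_level s * minor_level t"
proof -
  have "D u \<in> C s <#> C t" using assms D_in_C by blast
  from level_bound[OF assms(1-3) this[unfolded C_def]]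
  show "entry_level u \<le> entry_level s * entry_level t"
    "minor_level u \<le> minor_level s * minor_level t"
    using level_pos[OF S_pos[OF assms(1)]] level_pos[OF S_pos[OF assms(2)]] by (auto intro!: dvd_imp_le)
qed

text \<open>The double coset of \<open>D (1, 1)\<close> is \<open>U\<close>, so
  \<open>level_bound\<close> with \<open>(1, 1)\<close> as second factor makes the levels of two
  representatives of one double coset divide each other; the levels determine the pair.\<close>

lemma inj_C: "inj_on C S"
proof (rule inj_onI)
  have *: "entry_level s dvd entry_level t" "minor_level s dvd minor_level t"
    if "s \<in> S" "t \<in> S" "C s = C t" for s t
  proof -
    have "D s \<in> C t" using that D_in_C by blast
    then have "D s \<in> C t <#> C (1, 1)"
      unfolding set_mult_def C_one using U_one r_one[OF D_carrier[OF that(1)]] by force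
    from level_bound[OF that(2) S_one that(1) this[unfolded C_def]]
    show "entry_level s dvd entry_level t" "minor_level s dvd minor_level t"
      by (auto simp: entry_level_def minor_level_def)
  qed
  fix s t assume "s \<in> S" "t \<in> S" "C s = C t"
  then show "s = t" using *[of s t] *[of t s] S_pos[of s] S_pos[of t] by (auto intro!: level_eqD dvd_antisym)
qed

lemma lookup_double_coset_prod:
  assumes "s \<in> S" "t \<in> S" "u \<in> S"
  shows "Poly_Mapping.lookup (double_coset_prod G U (C s) (C t)) (C u) =
    (if C u \<subseteq> C s <#> C t then int (hecke_coeff G U (C s) (C t) (D u)) else 0)"
proof -
  let ?A = "{Z \<in> double_cosets G U. Z \<subseteq> C s <#> C t}"
  have "?A \<subseteq> C ` {v. pos_pair v \<and> entry_level v \<le> entry_level s * entry_level t}"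
    using level_bound_C[OF assms(1,2)] S_pos unfolding double_cosets_eq by auto
  \<comment> \<open>The product is defined as a sum over this set, which would be 0 by convention if
    the set were infinite.\<close>
  then have fin: "finite ?A" using finite_level_le finite_surj by blast
  have "Poly_Mapping.lookup (double_coset_prod G U (C s) (C t)) (C u) =
    (\<Sum>Z\<in>?A. if Z = C u then int (hecke_coeff G U (C s) (C t) (rep Z)) else 0)"
    unfolding double_coset_prod_def lookup_sum_poly_mapping
    by (intro sum.cong) auto
  also have "\<dots> = (if C u \<in> ?A then int (hecke_coeff G U (C s) (C t) (rep (C u))) else 0)"
    using fin by (simp add: sum.delta)
  also have "hecke_coeff G U (C s) (C t) (rep (C u)) = hecke_coeff G U (C s) (C t) (D u)"
    using D_in_C[OF assms(3)] rep_in[OF D_in_C[OF assms(3)]]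
    by (rule hecke_coeff_cong[OF subgroup_U C_double_coset[OF assms(1)] C_double_coset[OF assms(2)]
      C_double_coset[OF assms(3)], rotated])
  finally show ?thesis using assms C_double_coset by auto
qed

text \<open>In a factorization \<open>a \<otimes> y\<close> of the product of \<open>D s\<close> and
  \<open>D t\<close>, \<open>extremal\<close> puts \<open>a\<close> into \<open>D s\<close> times
  \<open>U\<close>, hence \<open>y\<close> into \<open>U #> D t\<close>. So this is the only right
  coset counted.\<close>

lemma hecke_coeff_extremal:
  assumes s: "s \<in> S" and t: "t \<in> S"
  shows "hecke_coeff G U (C s) (C t) (D (pair_times s t)) = 1"
proof -
  interpret U: subgroup U G by (rule subgroup_U)
  note Ds = D_carrier[OF s] and Dt = D_carrier[OF t]
  have "{Y \<in> rcosets U. Y \<subseteq> C t \<and> D (pair_times s t) \<in> C s <#> Y} = {U #> D t}"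
  proof (intro equalityI subsetI)
    fix Y assume "Y \<in> {Y \<in> rcosets U. Y \<subseteq> C t \<and> D (pair_times s t) \<in> C s <#> Y}"
    then obtain a y where Y: "Y \<in> rcosets U" "a \<in> C s" "y \<in> Y" "Y \<subseteq> C t" "a \<otimes> y = D (pair_times s t)"
      by (auto simp: set_mult_def)
    have a: "a \<in> carrier G" and y: "y \<in> carrier G" "y \<in> C t"
      using Y C_carrier s t by blast+
    have u: "inv (D s) \<otimes> a \<in> U"
      using extremal[OF s t] Y y unfolding C_def by blast
    have e: "a \<otimes> y = D s \<otimes> D t" using Y(5) D_times s t by simp
    have "(inv (D s) \<otimes> a) \<otimes> y = inv (D s) \<otimes> (a \<otimes> y)" using a y Ds by (simp add: m_assoc)
    also have "\<dots> = D t" unfolding e using Ds Dt by (simp add: cancel_left)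
    finally have "D t = (inv (D s) \<otimes> a) \<otimes> y" ..
    then have "D t \<in> U #> y" using u unfolding r_coset_def by blast
    then have "U #> y = U #> D t" using repr_independence[OF _ y(1) subgroup_U] by blast
    moreover have "Y = U #> y"
      using Y(1,3) repr_independence[OF _ _ subgroup_U] unfolding RCOSETS_def by auto
    ultimately show "Y \<in> {U #> D t}" by simp
  next
    fix Y assume "Y \<in> {U #> D t}"
    then have Y: "Y = U #> D t" by simp
    have "Y \<in> rcosets U" unfolding Y RCOSETS_def using Dt by auto
    moreover have "Y \<subseteq> C t" unfolding Y r_coset_def using C_mult_closed(3)[OF t D_in_C[OF t]] by auto
    moreover have "D t \<in> Y" unfolding Y using rcos_self[OF Dt subgroup_U] .
    then have "D (pair_times s t) \<in> C s <#> Y"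
      unfolding set_mult_def D_times[OF s t] using D_in_C[OF s] by blast
    ultimately show "Y \<in> {Y \<in> rcosets U. Y \<subseteq> C t \<and> D (pair_times s t) \<in> C s <#> Y}" by simp
  qed
  then show ?thesis
    using hecke_coeff_eq[OF subgroup_U C_double_coset[OF s] C_double_coset[OF t] D_carrier[OF S_times[OF s t]]]
    by simp
qed

lemma inv_in_C:
  assumes "s \<in> S" "a \<in> C s"
  shows "inv a \<in> C s"
proof -
  obtain u v where uv: "u \<in> U" "v \<in> U" "a = u \<otimes> D s \<otimes> v"
    using assms unfolding C_def double_coset_alt by auto
  have "inv a = inv v \<otimes> inv (D s) \<otimes> inv u"
    using uv U_carrier D_carrier[OF assms(1)] by (simp add: inv_mult_group m_assoc)
  moreover have "inv v \<otimes> inv (D s) \<otimes> inv u \<in> C s"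
    using C_mult_closed[OF assms(1)] inv_D[OF assms(1)] U_inv uv unfolding C_def by blast
  ultimately show ?thesis by simp
qed

text \<open>If x = a y then y x^-1 = a^-1, and a^-1 lies in the double coset of a. Right translation
  by x^-1 therefore carries the right cosets in \<open>C t\<close> counted at x to those in
  \<open>C s\<close> counted at x^-1, and translation by x carries them back.\<close>

lemma hecke_coeff_swap:
  assumes s: "s \<in> S" and t: "t \<in> S" and x: "x \<in> carrier G"
  shows "hecke_coeff G U (C s) (C t) x = hecke_coeff G U (C t) (C s) (inv x)"
proof -
  interpret U: subgroup U G by (rule subgroup_U)
  let ?M = "\<lambda>s t x. {Y \<in> rcosets U. Y \<subseteq> C t \<and> x \<in> C s <#> Y}"
  have sub: "(\<lambda>Y. Y #> inv x) ` ?M s t x \<subseteq> ?M t s (inv x)"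
    if s: "s \<in> S" and t: "t \<in> S" and x: "x \<in> carrier G" for s t x
  proof (intro image_subsetI)
    fix Y assume "Y \<in> ?M s t x"
    then obtain a y where Y: "Y \<in> rcosets U" "a \<in> C s" "y \<in> Y" "Y \<subseteq> C t" "x = a \<otimes> y"
      by (auto simp: set_mult_def)
    have a: "a \<in> carrier G" and y: "y \<in> carrier G" "y \<in> C t"
      using Y C_carrier s t by blast+
    have "Y = U #> y"
      using Y(1,3) repr_independence[OF _ _ subgroup_U] unfolding RCOSETS_def by auto
    then have "Y #> inv x = U #> (y \<otimes> inv x)"
      using y x by (simp add: coset_mult_assoc U.subset)
    also have "y \<otimes> inv x = inv a"
      unfolding Y(5) using a y by (simp add: inv_mult_group cancel_left)
    finally have e: "Y #> inv x = U #> inv a" .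
    have ia: "inv a \<in> C s" using inv_in_C[OF s Y(2)] .
    have "U #> inv a \<in> rcosets U" using a unfolding RCOSETS_def by auto
    moreover have "U #> inv a \<subseteq> C s"
      unfolding r_coset_def using C_mult_closed(3)[OF s ia] by auto
    moreover have "inv x = inv y \<otimes> inv a"
      unfolding Y(5) using a y by (simp add: inv_mult_group)
    then have "inv x \<in> C t <#> (U #> inv a)"
      using inv_in_C[OF t y(2)] rcos_self[OF inv_closed[OF a] subgroup_U] unfolding set_mult_def by blast
    ultimately show "Y #> inv x \<in> ?M t s (inv x)" unfolding e by simp
  qed
  have cancel: "(Y #> inv x) #> x = Y" "(Y #> x) #> inv x = Y" if "Y \<in> rcosets U" for Y
  proof -
    have "Y \<subseteq> carrier G" using that using rcosets_part_G[OF subgroup_U] by blast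
    then show "(Y #> inv x) #> x = Y" "(Y #> x) #> inv x = Y"
      using x by (simp_all add: coset_mult_assoc coset_mult_one)
  qed
  have "bij_betw (\<lambda>Y. Y #> inv x) (?M s t x) (?M t s (inv x))"
  proof (rule bij_betw_byWitness[where f' = "\<lambda>Y. Y #> x"])
    show "(\<lambda>Y. Y #> inv x) ` ?M s t x \<subseteq> ?M t s (inv x)" using sub[OF s t x] .
    show "(\<lambda>Y. Y #> x) ` ?M t s (inv x) \<subseteq> ?M s t x" using sub[OF t s, of "inv x"] x by simp
  qed (use cancel in auto)
  from bij_betw_same_card[OF this] show ?thesis
    using hecke_coeff_eq[OF subgroup_U C_double_coset[OF s] C_double_coset[OF t] x]
      hecke_coeff_eq[OF subgroup_U C_double_coset[OF t] C_double_coset[OF s] inv_closed[OF x]] by simp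
qed

lemma poly_mapping_eqI_C:
  assumes "f \<in> carrier R" "g \<in> carrier R"
    and "\<And>u. u \<in> S \<Longrightarrow> Poly_Mapping.lookup f (C u) = Poly_Mapping.lookup g (C u)"
  shows "f = g"
proof (rule poly_mapping_eqI)
  fix Z show "Poly_Mapping.lookup f Z = Poly_Mapping.lookup g Z"
  proof (cases "Z \<in> double_cosets G U")
    case True then show ?thesis using assms(3) by (auto simp: double_cosets_eq)
  next
    case False
    then have "Z \<notin> Poly_Mapping.keys f" "Z \<notin> Poly_Mapping.keys g" using assms by auto
    then show ?thesis by (simp add: in_keys_iff)
  qed
qed

text \<open>Exchanging the factors replaces \<open>D u\<close> by its inverse, which lies in the
  same double coset, where the coefficient is constant.\<close>

lemma double_coset_prod_commute:
  assumes s: "s \<in> S" and t: "t \<in> S"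
  shows "double_coset_prod G U (C s) (C t) = double_coset_prod G U (C t) (C s)"
proof (rule poly_mapping_eqI_C)
  have sub: "C u \<subseteq> C t <#> C s" if s: "s \<in> S" and t: "t \<in> S" and u: "u \<in> S" and *: "C u \<subseteq> C s <#> C t" for s t u
  proof
    fix c assume c: "c \<in> C u"
    then obtain a b where ab: "a \<in> C s" "b \<in> C t" "inv c = a \<otimes> b"
      using inv_in_C[OF u c] * unfolding set_mult_def by blast
    have "c = inv (inv c)" using C_carrier[OF u c] by simp
    also have "\<dots> = inv b \<otimes> inv a" using ab C_carrier s t by (simp add: inv_mult_group)
    finally show "c \<in> C t <#> C s"
      using inv_in_C[OF s ab(1)] inv_in_C[OF t ab(2)] unfolding set_mult_def by blast
  qed
  fix u assume u: "u \<in> S"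
  have "hecke_coeff G U (C s) (C t) (D u) = hecke_coeff G U (C t) (C s) (inv (D u))"
    using s t D_carrier[OF u] by (rule hecke_coeff_swap)
  also have "\<dots> = hecke_coeff G U (C t) (C s) (D u)"
    using hecke_coeff_cong[OF subgroup_U C_double_coset[OF t] C_double_coset[OF s] C_double_coset[OF u]]
      inv_D[OF u] D_in_C[OF u] unfolding C_def by blast
  finally show "Poly_Mapping.lookup (double_coset_prod G U (C s) (C t)) (C u) =
      Poly_Mapping.lookup (double_coset_prod G U (C t) (C s)) (C u)"
    using sub[OF s t u] sub[OF t s u] by (auto simp: lookup_double_coset_prod s t u)
qed (simp_all add: keys_double_coset_prod)

lemma carrier_key:
  assumes "f \<in> carrier R" "Z \<in> Poly_Mapping.keys f"
  obtains s where "s \<in> S" "Z = C s" "Poly_Mapping.lookup f (C s) \<noteq> 0"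
  using assms by (auto simp: double_cosets_eq in_keys_iff)

lemma lookup_mult_nonzero:
  assumes f: "f \<in> carrier R" and g: "g \<in> carrier R" and u: "u \<in> S"
    and nz: "Poly_Mapping.lookup (f \<otimes>\<^bsub>R\<^esub> g) (C u) \<noteq> 0"
  obtains s t where "s \<in> S" "t \<in> S" "Poly_Mapping.lookup f (C s) \<noteq> 0" "Poly_Mapping.lookup g (C t) \<noteq> 0"
    "entry_level u \<le> entry_level s * entry_level t" "minor_level u \<le> minor_level s * minor_level t"
proof -
  obtain A where A: "A \<in> Poly_Mapping.keys f" "(\<Sum>B\<in>Poly_Mapping.keys g.
        Poly_Mapping.lookup f A * Poly_Mapping.lookup g B *
        Poly_Mapping.lookup (double_coset_prod G U A B) (C u)) \<noteq> 0"
    using nz unfolding lookup_hecke_mult by (meson sum.not_neutral_contains_not_neutral)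
  then obtain B where B: "B \<in> Poly_Mapping.keys g"
    "Poly_Mapping.lookup f A * Poly_Mapping.lookup g B *
        Poly_Mapping.lookup (double_coset_prod G U A B) (C u) \<noteq> 0"
    by (meson sum.not_neutral_contains_not_neutral)
  then have nz': "Poly_Mapping.lookup (double_coset_prod G U A B) (C u) \<noteq> 0" by simp
  obtain s where s: "s \<in> S" "A = C s" "Poly_Mapping.lookup f (C s) \<noteq> 0"
    using carrier_key[OF f A(1)] .
  obtain t where t: "t \<in> S" "B = C t" "Poly_Mapping.lookup g (C t) \<noteq> 0"
    using carrier_key[OF g B(1)] .
  have "C u \<subseteq> C s <#> C t"
    using nz' unfolding s(2) t(2) lookup_double_coset_prod[OF s(1) t(1) u] by presburger
  from that[OF s(1) t(1) s(3) t(3) level_bound_C[OF s(1) t(1) u this]] show ?thesis .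
qed

section \<open>Leading terms\<close>

definition dominated :: "('a set \<Rightarrow>\<^sub>0 int) \<Rightarrow> nat \<times> nat \<Rightarrow> bool" where
  "dominated f s \<longleftrightarrow> (\<forall>t\<in>S. Poly_Mapping.lookup f (C t) \<noteq> 0 \<longrightarrow> level_le t s)"

lemma dominatedD: "dominated f s \<Longrightarrow> t \<in> S \<Longrightarrow> Poly_Mapping.lookup f (C t) \<noteq> 0 \<Longrightarrow> level_le t s"
  by (simp add: dominated_def)

text \<open>By \<open>level_le_mult_eq\<close> no pair of keys other than \<open>C s\<close> and
  \<open>C t\<close> can contribute to the double coset of the product pair, and these two
  contribute with coefficient 1.\<close>

lemma lookup_mult_extremal:
  assumes f: "f \<in> carrier R" and g: "g \<in> carrier R" and s: "s \<in> S" and t: "t \<in> S"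
    and f': "dominated f s" and g': "dominated g t"
  shows "Poly_Mapping.lookup (f \<otimes>\<^bsub>R\<^esub> g) (C (pair_times s t)) =
     Poly_Mapping.lookup f (C s) * Poly_Mapping.lookup g (C t)"
proof -
  let ?u = "pair_times s t"
  have u: "?u \<in> S" using s t by (rule S_times)
  have "C ?u \<subseteq> C s <#> C t"
  proof
    fix x assume "x \<in> C ?u"
    then obtain p q where pq: "p \<in> U" "q \<in> U" "x = p \<otimes> (D s \<otimes> D t) \<otimes> q"
      unfolding C_def double_coset_alt D_times[OF s t] by auto
    then have "x = (p \<otimes> D s) \<otimes> (D t \<otimes> q)"
      using U_carrier[OF pq(1)] U_carrier[OF pq(2)] D_carrier[OF s] D_carrier[OF t] by (simp add: m_assoc)
    moreover have "p \<otimes> D s \<in> C s" "D t \<otimes> q \<in> C t"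
      using C_mult_closed(3)[OF s D_in_C[OF s] pq(1)] C_mult_closed(2)[OF t D_in_C[OF t] pq(2)] .
    ultimately show "x \<in> C s <#> C t" unfolding set_mult_def by blast
  qed
  then have one: "Poly_Mapping.lookup (double_coset_prod G U (C s) (C t)) (C ?u) = 1"
    unfolding lookup_double_coset_prod[OF s t u] hecke_coeff_extremal[OF s t] by simp
  have zero: "Poly_Mapping.lookup (double_coset_prod G U A B) (C ?u) = 0"
    if A: "A \<in> Poly_Mapping.keys f" and B: "B \<in> Poly_Mapping.keys g" and ne: "\<not> (A = C s \<and> B = C t)" for A B
  proof (rule ccontr)
    assume nz: "Poly_Mapping.lookup (double_coset_prod G U A B) (C ?u) \<noteq> 0"
    obtain s' where s': "s' \<in> S" "A = C s'" "Poly_Mapping.lookup f (C s') \<noteq> 0"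
      using carrier_key[OF f A] .
    obtain t' where t': "t' \<in> S" "B = C t'" "Poly_Mapping.lookup g (C t') \<noteq> 0"
      using carrier_key[OF g B] .
    have "C ?u \<subseteq> C s' <#> C t'"
      using nz unfolding s'(2) t'(2) lookup_double_coset_prod[OF s'(1) t'(1) u] by presburger
    note b = level_bound_C[OF s'(1) t'(1) u this]
    have "s' = s \<and> t' = t"
      by (rule level_le_mult_eq[OF S_pos[OF s] S_pos[OF t] S_pos[OF s'(1)] S_pos[OF t'(1)]
          dominatedD[OF f' s'(1,3)] dominatedD[OF g' t'(1,3)] b])
    then show False using ne s' t' by simp
  qed
  have inner: "(\<Sum>B\<in>Poly_Mapping.keys g.
        Poly_Mapping.lookup f A * Poly_Mapping.lookup g B *
        Poly_Mapping.lookup (double_coset_prod G U A B) (C ?u)) =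
      (if A = C s then Poly_Mapping.lookup f (C s) * Poly_Mapping.lookup g (C t) else 0)"
    if A: "A \<in> Poly_Mapping.keys f" for A
  proof -
    have "(\<Sum>B\<in>Poly_Mapping.keys g.
        Poly_Mapping.lookup f A * Poly_Mapping.lookup g B *
        Poly_Mapping.lookup (double_coset_prod G U A B) (C ?u)) =
       (\<Sum>B\<in>Poly_Mapping.keys g. if B = C t then (if A = C s then
          Poly_Mapping.lookup f (C s) * Poly_Mapping.lookup g (C t) else 0) else 0)"
    proof (intro sum.cong refl)
      fix B assume "B \<in> Poly_Mapping.keys g"
      then show "Poly_Mapping.lookup f A * Poly_Mapping.lookup g B *
        Poly_Mapping.lookup (double_coset_prod G U A B) (C ?u) = (if B = C t then (if A = C s then
          Poly_Mapping.lookup f (C s) * Poly_Mapping.lookup g (C t) else 0) else 0)"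
        using zero[OF A, of B] one by (cases "A = C s \<and> B = C t") (simp, auto)
    qed
    also have "\<dots> = (if A = C s then Poly_Mapping.lookup f (C s) * Poly_Mapping.lookup g (C t) else 0)"
      unfolding sum.delta[OF finite_keys] by (simp add: in_keys_iff)
    finally show ?thesis .
  qed
  have "Poly_Mapping.lookup (f \<otimes>\<^bsub>R\<^esub> g) (C ?u) =
    (\<Sum>A\<in>Poly_Mapping.keys f. if A = C s then Poly_Mapping.lookup f (C s) * Poly_Mapping.lookup g (C t) else 0)"
    unfolding lookup_hecke_mult by (rule sum.cong[OF refl inner])
  also have "\<dots> = Poly_Mapping.lookup f (C s) * Poly_Mapping.lookup g (C t)"
    unfolding sum.delta[OF finite_keys] by (simp add: in_keys_iff)
  finally show ?thesis .
qed

lemma leading_coset: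
  assumes "f \<in> carrier R" "f \<noteq> 0"
  obtains s where "s \<in> S" "Poly_Mapping.lookup f (C s) \<noteq> 0" "dominated f s"
proof -
  let ?A = "{s \<in> S. C s \<in> Poly_Mapping.keys f}"
  have "finite ?A"
  proof (rule finite_imageD)
    show "finite (C ` ?A)" by (rule finite_subset[OF _ finite_keys[of f]]) blast
    show "inj_on C ?A" by (rule inj_on_subset[OF inj_C]) blast
  qed
  moreover obtain Z where "Z \<in> Poly_Mapping.keys f" 
    using assms(2) unfolding keys_eq_empty[symmetric] by blast
  then obtain s where "s \<in> S" "Z = C s" "Poly_Mapping.lookup f (C s) \<noteq> 0"
    by (rule carrier_key[OF assms(1)])
  then have "s \<in> ?A" by (simp add: in_keys_iff)
  then have "?A \<noteq> {}" by blast
  ultimately obtain s where s: "s \<in> ?A" "\<forall>t\<in>?A. level_le t s"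
    using level_le_max[of ?A] by (meson)
  show ?thesis
  proof (rule that)
    show "s \<in> S" "Poly_Mapping.lookup f (C s) \<noteq> 0" using s(1) by (simp_all add: in_keys_iff)
    show "dominated f s" unfolding dominated_def in_keys_iff[symmetric] using s(2) by blast
  qed
qed

lemma no_zero_divisors:
  assumes f: "f \<in> carrier R" "f \<noteq> 0" and g: "g \<in> carrier R" "g \<noteq> 0"
  shows "f \<otimes>\<^bsub>R\<^esub> g \<noteq> 0"
proof -
  obtain s where s: "s \<in> S" "Poly_Mapping.lookup f (C s) \<noteq> 0" "dominated f s"
    using leading_coset[OF f] .
  obtain t where t: "t \<in> S" "Poly_Mapping.lookup g (C t) \<noteq> 0" "dominated g t"
    using leading_coset[OF g] .
  have "Poly_Mapping.lookup (f \<otimes>\<^bsub>R\<^esub> g) (C (pair_times s t)) \<noteq> 0"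
    using lookup_mult_extremal[OF f(1) g(1) s(1) t(1) s(3) t(3)] s t by simp
  then show ?thesis by auto
qed

text \<open>The leading coefficient has to be exactly 1, so that leading terms can be eliminated
  with integer multiples.\<close>

definition monic :: "('a set \<Rightarrow>\<^sub>0 int) \<Rightarrow> nat \<times> nat \<Rightarrow> bool" where
  "monic f s \<longleftrightarrow> f \<in> carrier R \<and> s \<in> S \<and> Poly_Mapping.lookup f (C s) = 1 \<and> dominated f s"

lemma monic_frag_of: "s \<in> S \<Longrightarrow> monic (frag_of (C s)) s"
  using inj_C C_double_coset by (auto simp: monic_def dominated_def level_le_refl keys_frag_of dest: inj_onD)

lemma monic_mult:
  assumes "monic f s" "monic g t"
  shows "monic (f \<otimes>\<^bsub>R\<^esub> g) (pair_times s t)"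
proof -
  have f: "f \<in> carrier R" "s \<in> S" "Poly_Mapping.lookup f (C s) = 1" "dominated f s"
    using assms(1) by (auto simp: monic_def)
  have g: "g \<in> carrier R" "t \<in> S" "Poly_Mapping.lookup g (C t) = 1" "dominated g t"
    using assms(2) by (auto simp: monic_def)
  have "level_le u (pair_times s t)" if u: "u \<in> S" "Poly_Mapping.lookup (f \<otimes>\<^bsub>R\<^esub> g) (C u) \<noteq> 0" for u
  proof -
    obtain s' t' where st: "s' \<in> S" "t' \<in> S" "Poly_Mapping.lookup f (C s') \<noteq> 0" "Poly_Mapping.lookup g (C t') \<noteq> 0"
      "entry_level u \<le> entry_level s' * entry_level t'" "minor_level u \<le> minor_level s' * minor_level t'"
      using lookup_mult_nonzero[OF f(1) g(1) u] .
    show ?thesis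
      by (rule level_le_mult[OF S_pos[OF f(2)] S_pos[OF g(2)] dominatedD[OF f(4) st(1,3)] dominatedD[OF g(4) st(2,4)] st(5,6)])
  qed
  then have "dominated (f \<otimes>\<^bsub>R\<^esub> g) (pair_times s t)" by (simp only: dominated_def Ball_def, blast)
  then show ?thesis
    using lookup_mult_extremal[OF f(1) g(1) f(2) g(2) f(4) g(4)] hecke_mult_closed[where U = U and G = G and f = f and g = g]
      S_times[OF f(2) g(2)] f(3) g(3)
    unfolding monic_def by simp
qed

lemma monic_one: "monic \<one>\<^bsub>R\<^esub> (1, 1)"
  using monic_frag_of[OF S_one] unfolding C_one by simp

lemma monic_pow:
  assumes "monic f s"
  shows "monic (f [^]\<^bsub>R\<^esub> (n::nat)) (fst s ^ n, snd s ^ n)"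
proof (induction n)
  case 0
  have "f [^]\<^bsub>R\<^esub> (0::nat) = \<one>\<^bsub>R\<^esub>" by (simp add: nat_pow_def)
  then show ?case using monic_one by simp
next
  case (Suc n)
  have "f [^]\<^bsub>R\<^esub> Suc n = f [^]\<^bsub>R\<^esub> n \<otimes>\<^bsub>R\<^esub> f" by (simp add: nat_pow_def)
  then show ?case using monic_mult[OF Suc assms] by (simp add: pair_times_def mult.commute)
qed

end

locale cartan_pair_prime = cartan_pair +
  fixes p :: nat
  assumes p: "prime p" and S_eq: "S = range (\<lambda>(i, j). (p ^ i, p ^ j))"
begin

abbreviation X where "X \<equiv> frag_of (C (p, 1))"
abbreviation Y where "Y \<equiv> frag_of (C (1, p))"
abbreviation monomial where
  "monomial m \<equiv> X [^]\<^bsub>R\<^esub> (fst m :: nat) \<otimes>\<^bsub>R\<^esub> Y [^]\<^bsub>R\<^esub> (snd m :: nat)"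
abbreviation expo :: "nat \<times> nat \<Rightarrow> nat \<times> nat" where
  "expo m \<equiv> (p ^ fst m, p ^ snd m)"

lemma gens_in_S: "(p, 1) \<in> S" "(1, p) \<in> S"
proof -
  have "(p ^ 1, p ^ 0) \<in> S" "(p ^ 0, p ^ 1) \<in> S" unfolding S_eq by (rule range_eqI[of _ _ "(1, 0)"], simp, rule range_eqI[of _ _ "(0, 1)"], simp)
  then show "(p, 1) \<in> S" "(1, p) \<in> S" by (simp_all only: power_0 power_one_right)
qed

lemma monic_monomial: "monic (monomial m) (expo m)"
  using monic_mult[OF monic_pow[OF monic_frag_of[OF gens_in_S(1)], of "fst m"] monic_pow[OF monic_frag_of[OF gens_in_S(2)], of "snd m"]]
  by (simp add: pair_times_def)

lemma expo_in_S: "expo m \<in> S" by (auto simp: S_eq)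

lemma inj_expo: "inj expo"
  using p prime_gt_1_nat by (auto simp: inj_def prod_eq_iff)

lemma eval_poly2_eq_sum:
  assumes "finite A" "Poly_Mapping.keys P \<subseteq> A"
  shows "eval_poly2 R P X Y = (\<Sum>m\<in>A. frag_cmul (Poly_Mapping.lookup P m) (monomial m))"
  unfolding eval_poly2_hecke using assms
  by (intro sum.mono_neutral_left) (auto simp: in_keys_iff)

lemma eval_poly2_add: "eval_poly2 R (P + Q) X Y = eval_poly2 R P X Y + eval_poly2 R Q X Y"
proof -
  let ?A = "Poly_Mapping.keys P \<union> Poly_Mapping.keys Q"
  have fin: "finite ?A" by simp
  show ?thesis
    unfolding eval_poly2_eq_sum[OF fin keys_add] eval_poly2_eq_sum[OF fin Un_upper1]
      eval_poly2_eq_sum[OF fin Un_upper2] lookup_add frag_cmul_distrib sum.distrib ..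
qed

lemma eval_poly2_single: "eval_poly2 R (Poly_Mapping.single m k) X Y = frag_cmul k (monomial m)"
  by (subst eval_poly2_eq_sum[of "{m}"]) (auto split: if_splits)

lemma eval_poly2_carrier: "eval_poly2 R P X Y \<in> carrier R"
proof -
  have "Poly_Mapping.keys (eval_poly2 R P X Y) \<subseteq> (\<Union>m\<in>Poly_Mapping.keys P. Poly_Mapping.keys (frag_cmul (Poly_Mapping.lookup P m) (monomial m)))"
    unfolding eval_poly2_hecke by (rule keys_sum)
  also have "\<dots> \<subseteq> (\<Union>m\<in>Poly_Mapping.keys P. Poly_Mapping.keys (monomial m))"
    using keys_cmul by blast
  also have "\<dots> \<subseteq> double_cosets G U" using monic_monomial by (auto simp: monic_def)
  finally show ?thesis by simp
qed

text \<open>Distinct monomials have distinct leading pairs. At the largest pair among those of a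
  nonzero polynomial every other monomial vanishes, so the coefficient of the polynomial survives
  there.\<close>

lemma algebraically_independent: "algebraically_independent2 R X Y"
proof -
  have "X \<otimes>\<^bsub>R\<^esub> Y = Y \<otimes>\<^bsub>R\<^esub> X"
    using double_coset_prod_commute[OF gens_in_S] by (simp add: hecke_algebra_def)
  moreover have "P = 0" if P: "eval_poly2 R P X Y = 0" for P
  proof (rule ccontr)
    assume "P \<noteq> 0"
    then have ne: "expo ` Poly_Mapping.keys P \<noteq> {}" by simp
    obtain s where "s \<in> expo ` Poly_Mapping.keys P" "\<forall>t\<in>expo ` Poly_Mapping.keys P. level_le t s"
      using level_le_max[OF _ ne] by auto
    then obtain m where m: "m \<in> Poly_Mapping.keys P"
      "\<And>m'. m' \<in> Poly_Mapping.keys P \<Longrightarrow> level_le (expo m') (expo m)" by auto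
    have z: "Poly_Mapping.lookup (monomial m') (C (expo m)) = (if m' = m then 1 else 0)"
      if "m' \<in> Poly_Mapping.keys P" for m'
    proof (cases "m' = m")
      case True then show ?thesis using monic_monomial[of m] by (simp add: monic_def)
    next
      case False
      then have "expo m' \<noteq> expo m" using injD[OF inj_expo] by blast
      then have "\<not> level_le (expo m) (expo m')"
        using level_le_antisym[OF m(2)[OF that] _ S_pos[OF expo_in_S] S_pos[OF expo_in_S]] by blast
      then have "Poly_Mapping.lookup (monomial m') (C (expo m)) = 0"
        using monic_monomial[of m'] dominatedD[OF _ expo_in_S] unfolding monic_def by blast
      then show ?thesis using False by simp
    qed
    have "Poly_Mapping.lookup (eval_poly2 R P X Y) (C (expo m)) =
      (\<Sum>m'\<in>Poly_Mapping.keys P. if m' = m then Poly_Mapping.lookup P m else 0)"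
      unfolding eval_poly2_hecke lookup_sum_poly_mapping lookup_frag_cmul by (intro sum.cong refl) (simp only: z, simp)
    also have "\<dots> \<noteq> 0" using m(1) by (simp add: sum.delta in_keys_iff)
    finally show False using P by simp
  qed
  ultimately show ?thesis
    unfolding algebraically_independent2_def using C_double_coset gens_in_S
    by (auto simp: keys_frag_of)
qed

text \<open>Subtracting the leading coefficient times the monic monomial with the same leading pair
  lowers that pair. The induction runs over an arbitrary bound \<open>s\<close> of \<open>f\<close>,
  which need not be attained; every pair in \<open>S\<close> is a pair of powers of p, so the
  required monomial always exists.\<close>

lemma generated:
  assumes "f \<in> carrier R"
  shows "\<exists>P. f = eval_poly2 R P X Y"
proof -
  have "\<exists>P. f = eval_poly2 R P X Y"
    if "f \<in> carrier R" "dominated f s" for f s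
    using that
  proof (induction s arbitrary: f rule: wf_induct_rule[OF wf_measures[of "[entry_level, minor_level]"]])
    case (1 s)
    show ?case
    proof (cases "f = 0")
      case True then show ?thesis by (intro exI[of _ 0]) (simp add: eval_poly2_hecke)
    next
      case False
      then obtain u where u: "u \<in> S" "Poly_Mapping.lookup f (C u) \<noteq> 0" "dominated f u"
        using leading_coset[OF 1(2)] by blast
      obtain i j where "u = (p ^ i, p ^ j)" using u(1) by (auto simp: S_eq)
      then have m: "u = expo (i, j)" by simp
      let ?m = "(i, j)"
      define k where "k = Poly_Mapping.lookup f (C u)"
      define h where "h = f - frag_cmul k (monomial ?m)"
      note mm = monic_monomial[of ?m]
      have h: "h \<in> carrier R"
        using 1(2) mm keys_diff[of f "frag_cmul k (monomial ?m)"] keys_cmul[of k "monomial ?m"]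
        unfolding h_def monic_def by auto
      have h': "level_le t u \<and> t \<noteq> u" if "t \<in> S" "Poly_Mapping.lookup h (C t) \<noteq> 0" for t
      proof
        show "level_le t u"
          using that dominatedD[OF u(3), of t] dominatedD[of "monomial ?m" u t] mm
          unfolding h_def monic_def m[symmetric] by (cases "Poly_Mapping.lookup f (C t) = 0") (simp_all add: lookup_minus)
        show "t \<noteq> u"
          using that(2) mm unfolding h_def monic_def k_def m[symmetric] by (force simp: lookup_minus)
      qed
      have "\<exists>P. h = eval_poly2 R P X Y"
      proof (cases "h = 0")
        case True then show ?thesis by (intro exI[of _ 0]) (simp add: eval_poly2_hecke)
      next
        case False
        then obtain v where v: "v \<in> S" "Poly_Mapping.lookup h (C v) \<noteq> 0" "dominated h v"
          using leading_coset[OF h] by blast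
        have "level_le v u" "v \<noteq> u" using h'[OF v(1,2)] by auto
        then have "\<not> level_le u v"
          using level_le_antisym[OF _ _ S_pos[OF v(1)] S_pos[OF u(1)]] by blast
        moreover have "level_le u s" using dominatedD[OF 1(3) u(1,2)] .
        \<comment> \<open>\<open>v\<close> lies strictly below the leading pair \<open>u\<close> of
          \<open>f\<close>, and \<open>u\<close> lies below the bound \<open>s\<close>.\<close>
        ultimately have "(v, s) \<in> measures [entry_level, minor_level]"
          by (auto simp: level_le_def)
        then show ?thesis using "1.IH" h v(3) by blast
      qed
      then obtain P where "h = eval_poly2 R P X Y" by blast
      then have "f = eval_poly2 R (P + Poly_Mapping.single ?m k) X Y"
        unfolding eval_poly2_add eval_poly2_single by (simp only: h_def diff_eq_eq)
      then show ?thesis by blast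
    qed
  qed
  moreover have "\<exists>s. dominated f s"
  proof (cases "f = 0")
    case False
    then show ?thesis by (rule leading_coset[OF assms]) blast
  qed (simp add: dominated_def)
  ultimately show ?thesis using assms by blast
qed

lemma carrier_eq: "carrier R = {eval_poly2 R P X Y | P. True}"
  using generated eval_poly2_carrier by blast

end

section \<open>The orthogonal group and its identity component\<close>

lemma exhaust_5:
  fixes x :: 5
  shows "x = 1 \<or> x = 2 \<or> x = 3 \<or> x = 4 \<or> x = 5"
proof (induct x)
  case (of_int z)
  then have "z = 0 \<or> z = 1 \<or> z = 2 \<or> z = 3 \<or> z = 4" by fastforce
  then show ?case by auto
qed

lemma forall_5: "(\<forall>i::5. P i) \<longleftrightarrow> P 1 \<and> P 2 \<and> P 3 \<and> P 4 \<and> P 5"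
  by (metis exhaust_5)

lemma UNIV_5: "UNIV = {1, 2, 3, 4, 5::5}"
  using exhaust_5 by auto

lemma sum_5: "sum f (UNIV::5 set) = f 1 + f 2 + f 3 + f 4 + f 5"
  unfolding UNIV_5 by (simp add: ac_simps)

lemma vector_5 [simp]:
  "(vector [x1, x2, x3, x4, x5] :: 'a::zero^5) $ 1 = x1"
  "(vector [x1, x2, x3, x4, x5] :: 'a::zero^5) $ 2 = x2"
  "(vector [x1, x2, x3, x4, x5] :: 'a::zero^5) $ 3 = x3"
  "(vector [x1, x2, x3, x4, x5] :: 'a::zero^5) $ 4 = x4"
  "(vector [x1, x2, x3, x4, x5] :: 'a::zero^5) $ 5 = x5"
  unfolding vector_def by simp_all

lemma mat_1_5:
  "(mat 1 :: real^5^5) = vector [vector [1, 0, 0, 0, 0], vector [0, 1, 0, 0, 0],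
     vector [0, 0, 1, 0, 0], vector [0, 0, 0, 1, 0], vector [0, 0, 0, 0, 1]]"
  by (simp add: vec_eq_iff forall_5 mat_def)

lemma continuous_on_vector_5:
  fixes f1 f2 f3 f4 f5 :: "'a::topological_space \<Rightarrow> 'b::real_normed_vector"
  assumes "continuous_on A f1" "continuous_on A f2" "continuous_on A f3"
    "continuous_on A f4" "continuous_on A f5"
  shows "continuous_on A (\<lambda>t. vector [f1 t, f2 t, f3 t, f4 t, f5 t] :: 'b^5)"
proof -
  have "continuous_on A (\<lambda>t. \<chi> i. (vector [f1 t, f2 t, f3 t, f4 t, f5 t] :: 'b^5) $ i)"
  proof (rule continuous_on_vec_lambda)
    fix i :: 5
    show "continuous_on A (\<lambda>t. (vector [f1 t, f2 t, f3 t, f4 t, f5 t] :: 'b^5) $ i)"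
      using exhaust_5[of i] assms by auto
  qed
  then show ?thesis by simp
qed

lemma continuous_on_matrix_mult:
  fixes f g :: "'a::topological_space \<Rightarrow> real^'n^'n"
  assumes "continuous_on A f" "continuous_on A g"
  shows "continuous_on A (\<lambda>t. f t ** g t)"
  unfolding matrix_matrix_mult_def using assms by (intro continuous_intros)

lemma continuous_on_det:
  fixes f :: "'a::topological_space \<Rightarrow> real^'n^'n"
  assumes "continuous_on A f"
  shows "continuous_on A (\<lambda>t. det (f t))"
  unfolding det_def using assms by (intro continuous_intros)

text \<open>The bilinear form with Gram matrix \<open>S_hat N\<close>; half of
  \<open>bil N v v\<close> is the quadratic form v1 v5 + v2 v4 - N v3^2.\<close>

definition bil :: "nat \<Rightarrow> real^5 \<Rightarrow> real^5 \<Rightarrow> real" where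
  "bil N v w = v$1 * w$5 + v$5 * w$1 + v$2 * w$4 + v$4 * w$2 - 2 * real N * v$3 * w$3"

definition orth :: "nat \<Rightarrow> (real^5^5) set" where
  "orth N = {M. congruent_by (S_hat N) M = S_hat N}"

lemma S_hat_transpose_vec: "(transpose A ** S_hat N ** B) $ i $ j = bil N (column i A) (column j B)"
  by (simp add: matrix_matrix_mult_def transpose_def sum_5 S_hat_def bil_def column_def algebra_simps)

lemma orth_iff: "M \<in> orth N \<longleftrightarrow> (\<forall>i j. bil N (column i M) (column j M) = S_hat N $ i $ j)"
  unfolding orth_def congruent_by_def mem_Collect_eq vec_eq_iff S_hat_transpose_vec ..

lemma bil_matrix_vector:
  assumes "M \<in> orth N"
  shows "bil N (M *v v) (M *v w) = bil N v w"
proof -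
  have b: "bil N x y = x \<bullet> (S_hat N *v y)" for x y
    by (simp add: bil_def inner_vec_def matrix_vector_mult_def sum_5 S_hat_def algebra_simps)
  have "(M *v v) \<bullet> (S_hat N *v (M *v w)) = v \<bullet> ((transpose M ** S_hat N ** M) *v w)"
    by (metis dot_lmul_matrix matrix_vector_mul_assoc transpose_matrix_vector inner_commute)
  then show ?thesis using assms by (simp add: b orth_def congruent_by_def)
qed

definition S_inv :: "nat \<Rightarrow> real^5^5" where
  "S_inv N = vector [vector [0, 0, 0, 0, 1],
                     vector [0, 0, 0, 1, 0],
                     vector [0, 0, - 1 / (2 * real N), 0, 0],
                     vector [0, 1, 0, 0, 0],
                     vector [1, 0, 0, 0, 0]]"

lemma S_inv_S: "N > 0 \<Longrightarrow> S_inv N ** S_hat N = mat 1"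
  by (simp add: vec_eq_iff forall_5 matrix_matrix_mult_def sum_5 S_inv_def S_hat_def mat_1_5)

lemma det_S_hat: "N > 0 \<Longrightarrow> det (S_hat N) \<noteq> 0"
  using arg_cong[OF S_inv_S, of N det] by (auto simp: det_mul)

text \<open>The inverse of an orthogonal matrix, written so that denominators can be read off: in
  \<open>adj_entries\<close> a division by 2N occurs only in the third row, off the
  diagonal.\<close>

definition adj :: "nat \<Rightarrow> real^5^5 \<Rightarrow> real^5^5" where
  "adj N M = S_inv N ** transpose M ** S_hat N"

lemma adj_left: "N > 0 \<Longrightarrow> M \<in> orth N \<Longrightarrow> adj N M ** M = mat 1"
  using S_inv_S by (simp add: adj_def orth_def congruent_by_def matrix_mul_assoc[symmetric])

lemma adj_right: "N > 0 \<Longrightarrow> M \<in> orth N \<Longrightarrow> M ** adj N M = mat 1"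
  using adj_left matrix_left_right_inverse by blast

lemma adj_entries:
  assumes "N > 0"
  shows "adj N M = vector [
    vector [M$5$5, M$4$5, - 2 * real N * M$3$5, M$2$5, M$1$5],
    vector [M$5$4, M$4$4, - 2 * real N * M$3$4, M$2$4, M$1$4],
    vector [- M$5$3 / (2 * real N), - M$4$3 / (2 * real N), M$3$3, - M$2$3 / (2 * real N), - M$1$3 / (2 * real N)],
    vector [M$5$2, M$4$2, - 2 * real N * M$3$2, M$2$2, M$1$2],
    vector [M$5$1, M$4$1, - 2 * real N * M$3$1, M$2$1, M$1$1]]"
  using assms by (simp add: adj_def vec_eq_iff forall_5 matrix_matrix_mult_def sum_5 S_inv_def S_hat_def transpose_def)

text \<open>The dual form, with Gram matrix \<open>S_inv N\<close>. It governs the rows of an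
  orthogonal matrix as \<open>bil\<close> governs the columns.\<close>

definition bil' :: "nat \<Rightarrow> real^5 \<Rightarrow> real^5 \<Rightarrow> real" where
  "bil' N v w = v$1 * w$5 + v$5 * w$1 + v$2 * w$4 + v$4 * w$2 - v$3 * w$3 / (2 * real N)"

lemma orth_rows:
  assumes "N > 0" "M \<in> orth N"
  shows "bil' N (M $ i) (M $ j) = S_inv N $ i $ j"
proof -
  have "S_hat N ** S_inv N = mat 1" using S_inv_S[OF assms(1)] matrix_left_right_inverse by blast
  moreover have "M ** (S_inv N ** transpose M ** S_hat N) = mat 1"
    using adj_right[OF assms] by (simp add: adj_def)
  then have "M ** (S_inv N ** transpose M ** S_hat N) ** S_inv N = S_inv N" by simp
  ultimately have "M ** S_inv N ** transpose M = S_inv N"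
    by (simp add: matrix_mul_assoc[symmetric])
  moreover have "(M ** S_inv N ** transpose M) $ i $ j = bil' N (M $ i) (M $ j)"
    by (simp add: matrix_matrix_mult_def transpose_def sum_5 S_inv_def bil'_def algebra_simps)
  ultimately show ?thesis by simp
qed

lemma orth_mult: "A \<in> orth N \<Longrightarrow> B \<in> orth N \<Longrightarrow> A ** B \<in> orth N"
proof -
  assume A: "A \<in> orth N" and B: "B \<in> orth N"
  have "transpose (A ** B) ** S_hat N ** (A ** B) = transpose B ** (transpose A ** S_hat N ** A) ** B"
    by (simp add: matrix_transpose_mul matrix_mul_assoc)
  then show ?thesis using A B by (simp add: orth_def congruent_by_def)
qed

lemma orth_one: "mat 1 \<in> orth N"
  by (simp add: orth_def congruent_by_def)

lemma orth_adj:
  assumes "N > 0" "M \<in> orth N"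
  shows "adj N M \<in> orth N"
proof -
  have "transpose (adj N M) ** S_hat N ** adj N M
      = transpose (adj N M) ** (transpose M ** S_hat N ** M) ** adj N M"
    using assms(2) by (simp add: orth_def congruent_by_def)
  also have "\<dots> = transpose (M ** adj N M) ** S_hat N ** (M ** adj N M)"
    by (simp add: matrix_transpose_mul matrix_mul_assoc)
  finally show ?thesis
    by (simp only: orth_def congruent_by_def mem_Collect_eq adj_right[OF assms] transpose_mat
        matrix_mul_lid matrix_mul_rid)
qed

section \<open>The identity component\<close>

lemma SO_hat_orth: "M \<in> SO_hat N \<longleftrightarrow> det M = 1 \<and> M \<in> orth N"
  by (simp add: SO_hat_def orth_def)

lemma det_orth:
  assumes "N > 0" "M \<in> orth N"
  shows "det M = 1 \<or> det M = -1"
proof -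
  have "det (transpose M ** S_hat N ** M) = det (S_hat N)"
    using assms by (simp add: orth_def congruent_by_def)
  then have "(det M)\<^sup>2 = 1"
    using det_S_hat[OF assms(1)] by (simp add: det_mul det_transpose power2_eq_square)
  then show ?thesis by (simp add: power2_eq_1_iff)
qed

text \<open>The determinant takes only the values 1 and -1 on \<open>orth N\<close>, so it is
  constant on a connected set. For the explicit families below it is therefore enough to check the
  form; their determinants are never computed.\<close>

lemma connected_subset_SO0:
  assumes N: "N > 0" and T: "connected T" "mat 1 \<in> T" "T \<subseteq> orth N"
  shows "T \<subseteq> SO0_hat N"
proof -
  have "connected (det ` T)"
    using T(1) by (intro connected_continuous_image continuous_on_det continuous_on_id)
  moreover have "1 \<in> det ` T" using T(2) by (metis det_I image_eqI)
  moreover have "0 \<notin> det ` T" using det_orth[OF N] T(3) by force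
  ultimately have "-1 \<notin> det ` T" using connectedD_interval[of "det ` T" "-1" 1 0] by auto
  then have "T \<subseteq> SO_hat N" using det_orth[OF N] T(3) by (force simp: SO_hat_orth)
  then show ?thesis unfolding SO0_hat_def using T by (intro connected_component_maximal) auto
qed

lemma SO0_orth: "M \<in> SO0_hat N \<Longrightarrow> M \<in> orth N"
  unfolding SO0_hat_def using connected_component_subset SO_hat_orth by blast

lemma SO0_det: "M \<in> SO0_hat N \<Longrightarrow> det M = 1"
  unfolding SO0_hat_def using connected_component_subset SO_hat_orth by blast

lemma SO0_one: "mat 1 \<in> SO0_hat N"
  unfolding SO0_hat_def by (simp add: SO_hat_orth orth_one)

lemma SO0_connected: "connected (SO0_hat N)"
  unfolding SO0_hat_def by simp

text \<open>The left translate of the identity component by \<open>A\<close> is connected. It meets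
  the component in \<open>A\<close> if \<open>A\<close> belongs to it, and it contains 1 if
  \<open>A\<close> is inverse to an element \<open>B\<close> of it; the disjunction covers products
  and inverses together.\<close>

lemma SO0_mult_aux:
  assumes N: "N > 0" and A: "A \<in> orth N" and B: "B \<in> SO0_hat N" "A ** B = mat 1 \<or> A \<in> SO0_hat N"
    and X: "X \<in> SO0_hat N"
  shows "A ** X \<in> SO0_hat N"
proof -
  let ?T = "(\<lambda>X. A ** X) ` SO0_hat N"
  have c: "connected ?T"
    using SO0_connected by (intro connected_continuous_image continuous_on_matrix_mult continuous_intros)
  have o: "?T \<subseteq> orth N" using A SO0_orth orth_mult by blast
  show ?thesis
  proof (cases "A \<in> SO0_hat N")
    case True
    have "A \<in> ?T" using SO0_one[of N] by (metis image_eqI matrix_mul_rid)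
    then have "connected (?T \<union> SO0_hat N)"
      using True c SO0_connected[of N] by (intro connected_Un) auto
    moreover have "mat 1 \<in> ?T \<union> SO0_hat N" using SO0_one by blast
    moreover have "?T \<union> SO0_hat N \<subseteq> orth N" using o SO0_orth by blast
    ultimately show ?thesis using connected_subset_SO0[OF N, of "?T \<union> SO0_hat N"] X by blast
  next
    case False
    then have "mat 1 \<in> ?T" using B by (metis image_eqI)
    then show ?thesis using connected_subset_SO0[OF N c _ o] X by blast
  qed
qed

lemma SO0_mult: "N > 0 \<Longrightarrow> A \<in> SO0_hat N \<Longrightarrow> B \<in> SO0_hat N \<Longrightarrow> A ** B \<in> SO0_hat N"
  using SO0_mult_aux SO0_orth by blast

lemma SO0_adj: "N > 0 \<Longrightarrow> A \<in> SO0_hat N \<Longrightarrow> adj N A \<in> SO0_hat N"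
  using SO0_mult_aux[of N "adj N A" A "mat 1"] SO0_one[of N] adj_left[of N A] orth_adj[of N A] SO0_orth[of A N]
  by simp

text \<open>The determinant of the compression of \<open>M\<close> to the positive definite plane spanned by
  \<open>e\<^sub>1 + e\<^sub>5\<close> and \<open>e\<^sub>2 + e\<^sub>4\<close>; its sign separates the components of the orthogonal group.\<close>
definition plane_det :: "real^5^5 \<Rightarrow> real" where
  "plane_det M = (M$1$1 + M$1$5 + M$5$1 + M$5$5) * (M$2$2 + M$2$4 + M$4$2 + M$4$4)
     - (M$2$1 + M$2$5 + M$4$1 + M$4$5) * (M$1$2 + M$1$4 + M$5$2 + M$5$4)"

text \<open>A singular compression would give a nonzero vector of the positive definite plane whose
  image is orthogonal to that plane. The form is negative semidefinite on the orthogonal complement,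
  yet \<open>M\<close> preserves its values.\<close>

lemma plane_det_nonzero:
  assumes "M \<in> orth N"
  shows "plane_det M \<noteq> 0"
proof
  assume 0: "plane_det M = 0"
  define a b c d where "a = M$1$1 + M$1$5 + M$5$1 + M$5$5" and "b = M$1$2 + M$1$4 + M$5$2 + M$5$4"
    and "c = M$2$1 + M$2$5 + M$4$1 + M$4$5" and "d = M$2$2 + M$2$4 + M$4$2 + M$4$4"
  have ad: "a * d - c * b = 0" using 0 by (simp add: plane_det_def a_def b_def c_def d_def)
  obtain s t where st: "a * s + b * t = 0" "c * s + d * t = 0" "s \<noteq> 0 \<or> t \<noteq> 0"
  proof (cases "a = 0 \<and> b = 0")
    case True
    show ?thesis
    proof (cases "c = 0 \<and> d = 0")
      case True then show ?thesis using that[of 1 0] \<open>a = 0 \<and> b = 0\<close> by auto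
    next
      case False then show ?thesis using that[of d "-c"] \<open>a = 0 \<and> b = 0\<close> by auto
    qed
  next
    case False then show ?thesis using that[of b "-a"] ad by (auto simp: algebra_simps)
  qed
  define x :: "real^5" where "x = vector [s, t, 0, t, s]"
  define v where "v = M *v x"
  have v1: "v$5 = - v$1"
    using st(1) by (simp add: v_def x_def matrix_vector_mult_def sum_5 a_def b_def algebra_simps)
  have v2: "v$4 = - v$2"
    using st(2) by (simp add: v_def x_def matrix_vector_mult_def sum_5 c_def d_def algebra_simps)
  have "bil N v v = bil N x x" unfolding v_def using assms by (rule bil_matrix_vector)
  then have "s\<^sup>2 + t\<^sup>2 = - ((v$1)\<^sup>2 + (v$2)\<^sup>2 + real N * (v$3)\<^sup>2)"
    by (simp add: bil_def x_def v1 v2 power2_eq_square algebra_simps)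
  moreover have "(v$1)\<^sup>2 + (v$2)\<^sup>2 + real N * (v$3)\<^sup>2 \<ge> 0" by simp
  moreover have "s\<^sup>2 + t\<^sup>2 > 0" using st(3) by (simp add: sum_power2_gt_zero_iff)
  ultimately show False by linarith
qed

text \<open>A continuous function without zeros keeps its sign on a connected set, and its value at
  the identity is 4.\<close>

lemma plane_det_pos:
  assumes "M \<in> SO0_hat N"
  shows "plane_det M > 0"
proof (rule ccontr)
  assume "\<not> plane_det M > 0"
  then have "plane_det M \<le> 0" by simp
  moreover have "connected (plane_det ` SO0_hat N)"
    unfolding plane_det_def
    by (intro connected_continuous_image SO0_connected continuous_intros)
  moreover have "plane_det (mat 1) \<ge> 0" by (simp add: plane_det_def mat_1_5)
  ultimately have "0 \<in> plane_det ` SO0_hat N"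
    using connectedD_interval[of "plane_det ` SO0_hat N" "plane_det M" "plane_det (mat 1)" 0]
      assms SO0_one[of N] by blast
  then show False using plane_det_nonzero SO0_orth by force
qed

section \<open>SL(2, R) as a source of elements of the identity component\<close>

definition SL2 :: "(real \<times> real \<times> real \<times> real) set" where
  "SL2 = {(a, b, c, d). a * d - b * c = 1}"

text \<open>A matrix with lower left entry c nonzero is a product of an upper, a lower and an upper
  unipotent matrix, and all three parameters can be scaled down to 0 at once. If c = 0, adding
  multiples of the second column to the first leads to the case c nonzero.\<close>

lemma SL2_connected: "connected SL2"
proof -
  have path: "connected_component SL2 (f 0) (f 1)"
    if "continuous_on {0..1} f" "\<And>t. f t \<in> SL2" for f :: "real \<Rightarrow> _"
  proof -
    have "connected (f ` {0..1})" using that(1) by (intro connected_continuous_image) auto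
    then show ?thesis using that(2) unfolding connected_component_def
      by (intro exI[of _ "f ` {0..1}"]) auto
  qed
  have c: "connected_component SL2 (1, 0, 0, 1) (a, b, c, d)" if h: "(a, b, c, d) \<in> SL2" "c \<noteq> 0" for a b c d
  proof -
    define x y where "x = (a - 1) / c" and "y = (d - 1) / c"
    define f where "f t = (1 + t * x * (t * c), (1 + t * x * (t * c)) * (t * y) + t * x, t * c, t * c * (t * y) + 1)" for t
    have "f t \<in> SL2" for t by (simp add: f_def SL2_def algebra_simps)
    moreover have "continuous_on {0..1} f" unfolding f_def by (intro continuous_intros)
    ultimately have "connected_component SL2 (f 0) (f 1)" by (rule path[rotated])
    moreover have "f 0 = (1, 0, 0, 1)" by (simp add: f_def)
    moreover have "1 + x * c = a" "c * y + 1 = d" using h(2) by (simp_all add: x_def y_def)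
    then have "f 1 = (a, a * y + x, c, d)" by (simp add: f_def)
    moreover have "a * y + x = b"
    proof -
      have "c * (a * y + x) = a * (c * y) + x * c" by (simp add: algebra_simps)
      also have "\<dots> = a * (d - 1) + (a - 1)" using h(2) by (simp add: x_def y_def)
      also have "\<dots> = c * b" using h(1) by (simp add: SL2_def algebra_simps)
      finally show ?thesis using h(2) by simp
    qed
    ultimately show ?thesis by simp
  qed
  have "connected_component SL2 (1, 0, 0, 1) z" if z: "z \<in> SL2" for z
  proof -
    obtain a b c' d where abcd: "z = (a, b, c', d)" by (metis prod_cases4)
    show ?thesis
    proof (cases "c' = 0")
      case False then show ?thesis using c z abcd by blast
    next
      case True
      then have ad: "a * d = 1" "d \<noteq> 0" using z abcd by (auto simp: SL2_def)
      define f where "f t = (a + b * t, b, d * t, d)" for t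
      have f: "f t \<in> SL2" for t using ad by (simp add: f_def SL2_def algebra_simps)
      moreover have "continuous_on {0..1} f" unfolding f_def by (intro continuous_intros)
      ultimately have "connected_component SL2 (f 0) (f 1)" by (rule path[rotated])
      moreover have "f 0 = z" using True abcd by (simp add: f_def)
      moreover have "connected_component SL2 (1, 0, 0, 1) (f 1)"
        using f[of 1] ad by (auto simp: f_def intro!: c)
      ultimately show ?thesis by (metis connected_component_sym connected_component_trans)
    qed
  qed
  then have "connected_component_set SL2 (1, 0, 0, 1) = SL2"
    using connected_component_subset by blast
  then show ?thesis by (metis connected_connected_component)
qed

lemma SL2_rep_SO0:
  assumes N: "N > 0" and F: "continuous_on SL2 F" "F (1, 0, 0, 1) = mat 1"
    and o: "\<And>a b c d. a * d - b * c = 1 \<Longrightarrow> F (a, b, c, d) \<in> orth N"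
    and "a * d - b * c = 1"
  shows "F (a, b, c, d) \<in> SO0_hat N"
proof -
  have "connected (F ` SL2)" using F(1) SL2_connected by (rule connected_continuous_image)
  moreover have "(1, 0, 0, 1) \<in> SL2" by (simp add: SL2_def)
  then have "mat 1 \<in> F ` SL2" using F(2) by (metis imageI)
  moreover have "F ` SL2 \<subseteq> orth N" using o by (auto simp: SL2_def)
  ultimately have "F ` SL2 \<subseteq> SO0_hat N" by (rule connected_subset_SO0[OF N])
  then show ?thesis using assms(5) by (auto simp: SL2_def)
qed

text \<open>On the hyperbolic part, \<open>left_mat\<close> and \<open>right_mat\<close> are multiplication by a matrix of
  determinant 1 on the \<open>2 \<times> 2\<close> matrix \<open>((x\<^sub>1, x\<^sub>2), (- x\<^sub>4, x\<^sub>5))\<close>, whose determinant is the quadratic form.\<close>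
definition left_mat :: "real \<Rightarrow> real \<Rightarrow> real \<Rightarrow> real \<Rightarrow> real^5^5" where
  "left_mat a b c d = vector [
    vector [a, 0, 0, - b, 0],
    vector [0, a, 0, 0, b],
    vector [0, 0, 1, 0, 0],
    vector [- c, 0, 0, d, 0],
    vector [0, c, 0, 0, d]]"

definition right_mat :: "real \<Rightarrow> real \<Rightarrow> real \<Rightarrow> real \<Rightarrow> real^5^5" where
  "right_mat a b c d = vector [
    vector [a, c, 0, 0, 0],
    vector [b, d, 0, 0, 0],
    vector [0, 0, 1, 0, 0],
    vector [0, 0, 0, a, - c],
    vector [0, 0, 0, - b, d]]"

text \<open>The action \<open>X \<mapsto> h X h'\<close> on the symmetric matrix \<open>X = ((x\<^sub>2, \<surd>N x\<^sub>3), (\<surd>N x\<^sub>3, x\<^sub>4))\<close>.\<close>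
definition sym_mat :: "nat \<Rightarrow> real \<Rightarrow> real \<Rightarrow> real \<Rightarrow> real \<Rightarrow> real^5^5" where
  "sym_mat N a b c d = vector [
    vector [1, 0, 0, 0, 0],
    vector [0, a\<^sup>2, 2 * sqrt N * a * b, b\<^sup>2, 0],
    vector [0, a * c / sqrt N, a * d + b * c, b * d / sqrt N, 0],
    vector [0, c\<^sup>2, 2 * sqrt N * c * d, d\<^sup>2, 0],
    vector [0, 0, 0, 0, 1]]"

text \<open>Eichler transformations. \<open>low_mat\<close> fixes e5, and its first column is the
  general isotropic vector with first coordinate 1; \<open>upp_mat\<close> below is the counterpart
  fixing e1.\<close>

definition low_mat :: "nat \<Rightarrow> real \<Rightarrow> real \<Rightarrow> real \<Rightarrow> real^5^5" where
  "low_mat N b2 b3 b4 = vector [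
    vector [1, 0, 0, 0, 0],
    vector [b2, 1, 0, 0, 0],
    vector [b3, 0, 1, 0, 0],
    vector [b4, 0, 0, 1, 0],
    vector [real N * b3\<^sup>2 - b2 * b4, - b4, 2 * real N * b3, - b2, 1]]"

definition upp_mat :: "nat \<Rightarrow> real \<Rightarrow> real \<Rightarrow> real \<Rightarrow> real^5^5" where
  "upp_mat N b2 b3 b4 = vector [
    vector [1, - b4, 2 * real N * b3, - b2, real N * b3\<^sup>2 - b2 * b4],
    vector [0, 1, 0, 0, b2],
    vector [0, 0, 1, 0, b3],
    vector [0, 0, 0, 1, b4],
    vector [0, 0, 0, 0, 1]]"

definition torus :: "real \<Rightarrow> real \<Rightarrow> real^5^5" where
  "torus x y = diag5 (1 / x) (1 / y) 1 y x"

lemmas orth5_simps = orth_iff forall_5 bil_def column_def S_hat_def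

lemma left_mat_SO0: "N > 0 \<Longrightarrow> a * d - b * c = 1 \<Longrightarrow> left_mat a b c d \<in> SO0_hat N"
proof -
  assume N: "N > 0" and d: "a * d - b * c = 1"
  let ?F = "\<lambda>(a, b, c, d). left_mat a b c d"
  have "?F (a, b, c, d) \<in> SO0_hat N"
  proof (rule SL2_rep_SO0[OF N _ _ _ d])
    show "continuous_on SL2 ?F"
      unfolding left_mat_def case_prod_beta by (intro continuous_on_vector_5 continuous_intros)
    show "?F (1, 0, 0, 1) = mat 1" by (simp add: left_mat_def mat_1_5)
    show "?F (a, b, c, d) \<in> orth N" if "a * d - b * c = 1" for a b c d
      using that by (simp add: orth5_simps left_mat_def algebra_simps)
  qed
  then show ?thesis by simp
qed

lemma right_mat_SO0: "N > 0 \<Longrightarrow> a * d - b * c = 1 \<Longrightarrow> right_mat a b c d \<in> SO0_hat N"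
proof -
  assume N: "N > 0" and d: "a * d - b * c = 1"
  let ?F = "\<lambda>(a, b, c, d). right_mat a b c d"
  have "?F (a, b, c, d) \<in> SO0_hat N"
  proof (rule SL2_rep_SO0[OF N _ _ _ d])
    show "continuous_on SL2 ?F"
      unfolding right_mat_def case_prod_beta by (intro continuous_on_vector_5 continuous_intros)
    show "?F (1, 0, 0, 1) = mat 1" by (simp add: right_mat_def mat_1_5)
    show "?F (a, b, c, d) \<in> orth N" if "a * d - b * c = 1" for a b c d
      using that by (simp add: orth5_simps right_mat_def algebra_simps)
  qed
  then show ?thesis by simp
qed

lemma sym_mat_orth:
  assumes N: "N > 0" and d: "a * d - b * c = 1"
  shows "sym_mat N a b c d \<in> orth N"
proof -
  define r where "r = sqrt N"
  have r: "real N = r * r" "r \<noteq> 0" using N by (auto simp: r_def)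
  have 1: "(a * d - b * c) * (a * d - b * c) = 1" using d by simp
  \<comment> \<open>The (3, 3) entry of the Gram matrix is -2N (ad - bc)^2; fact 2 is the resulting
    condition in expanded form.\<close>
  have "2 * r * r * ((a * d - b * c) * (a * d - b * c)) = 2 * r * r" using d by simp
  then have 2: "r * (r * 2) + a * (b * (c * (d * (r * (r * 4))))) =
      a * (a * (d * (d * (r * (r * 2))))) + b * (b * (c * (c * (r * (r * 2)))))"
    by (simp add: algebra_simps)
  have "(\<forall>i j. bil N (column i (sym_mat N a b c d)) (column j (sym_mat N a b c d)) = S_hat N $ i $ j)"
    unfolding sym_mat_def r_def[symmetric]
    using r(2) 1 by (simp add: orth5_simps r(1) field_simps power2_eq_square 2)
  then show ?thesis unfolding orth_iff .
qed

lemma sym_mat_SO0: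
  assumes N: "N > 0" and d: "a * d - b * c = 1"
  shows "sym_mat N a b c d \<in> SO0_hat N"
proof -
  let ?F = "\<lambda>(a, b, c, d). sym_mat N a b c d"
  have "?F (a, b, c, d) \<in> SO0_hat N"
  proof (rule SL2_rep_SO0[OF N _ _ _ d])
    show "continuous_on SL2 ?F"
      unfolding sym_mat_def case_prod_beta using N by (intro continuous_on_vector_5 continuous_intros) auto
    show "?F (1, 0, 0, 1) = mat 1" by (simp add: sym_mat_def mat_1_5)
    show "?F (a, b, c, d) \<in> orth N" if "a * d - b * c = 1" for a b c d
      using sym_mat_orth[OF N that] by simp
  qed
  then show ?thesis by simp
qed

lemma path_SO0:
  assumes N: "N > 0" and f: "continuous_on {0..1} f" "f 0 = mat 1" "\<And>t. t \<in> {0..1} \<Longrightarrow> f t \<in> orth N"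
  shows "f (1::real) \<in> SO0_hat N"
proof -
  have "connected (f ` {0..1})" using f(1) by (intro connected_continuous_image) auto
  moreover have "mat 1 \<in> f ` {0..1}" using f(2) by (force simp: image_iff)
  ultimately have "f ` {0..1} \<subseteq> SO0_hat N" using f(3) by (intro connected_subset_SO0[OF N]) auto
  then show ?thesis by auto
qed

lemma low_mat_SO0: "N > 0 \<Longrightarrow> low_mat N b2 b3 b4 \<in> SO0_hat N"
proof -
  assume N: "N > 0"
  have "(\<lambda>t. low_mat N (t * b2) (t * b3) (t * b4)) 1 \<in> SO0_hat N"
  proof (rule path_SO0[OF N])
    show "continuous_on {0..1} (\<lambda>t. low_mat N (t * b2) (t * b3) (t * b4))"
      unfolding low_mat_def by (intro continuous_on_vector_5 continuous_intros)
  qed (simp_all add: low_mat_def mat_1_5 orth5_simps power2_eq_square algebra_simps)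
  then show ?thesis by simp
qed

lemma upp_mat_SO0: "N > 0 \<Longrightarrow> upp_mat N b2 b3 b4 \<in> SO0_hat N"
proof -
  assume N: "N > 0"
  have "(\<lambda>t. upp_mat N (t * b2) (t * b3) (t * b4)) 1 \<in> SO0_hat N"
  proof (rule path_SO0[OF N])
    show "continuous_on {0..1} (\<lambda>t. upp_mat N (t * b2) (t * b3) (t * b4))"
      unfolding upp_mat_def by (intro continuous_on_vector_5 continuous_intros)
  qed (simp_all add: upp_mat_def mat_1_5 orth5_simps power2_eq_square algebra_simps)
  then show ?thesis by simp
qed

lemma torus_SO0:
  assumes N: "N > 0" and xy: "x > 0" "y > 0"
  shows "torus x y \<in> SO0_hat N"
proof -
  have pos: "1 - t + t * z > 0" if "z > 0" "t \<in> {0..1}" for t z :: real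
  proof (cases "t = 1")
    case False
    then have "1 - t > 0" "t * z \<ge> 0" using that by auto
    then show ?thesis by linarith
  qed (use that in simp)
  have "(\<lambda>t. torus (1 - t + t * x) (1 - t + t * y)) 1 \<in> SO0_hat N"
  proof (rule path_SO0[OF N, of "\<lambda>t. torus (1 - t + t * x) (1 - t + t * y)"])
    show "continuous_on {0..1} (\<lambda>t. torus (1 - t + t * x) (1 - t + t * y))"
      unfolding torus_def diag5_def using pos[OF xy(1)] pos[OF xy(2)]
      by (intro continuous_on_vector_5 continuous_intros) force+
    show "(\<lambda>t. torus (1 - t + t * x) (1 - t + t * y)) 0 = mat 1" by (simp add: torus_def diag5_def mat_1_5)
    show "torus (1 - t + t * x) (1 - t + t * y) \<in> orth N" if "t \<in> {0..1}" for t
      using pos[OF xy(1) that] pos[OF xy(2) that] by (simp add: orth5_simps torus_def diag5_def)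
  qed
  then show ?thesis by simp
qed

text \<open>With g = gcd(2N, r), the cofactor m of 2N is coprime to that of r. The hypothesis then
  gives m | g, so m^2 | 2N, and it remains to see that m is a unit.\<close>

lemma dvd_of_four_mult_dvd_square:
  fixes r :: int
  assumes "squarefree N" "4 * int N dvd r\<^sup>2"
  shows "2 * int N dvd r"
proof -
  have N: "N \<noteq> 0" using assms(1) by (metis not_squarefree_0)
  have sf: "x\<^sup>2 dvd int N \<Longrightarrow> is_unit x" for x :: int
  proof -
    assume "x\<^sup>2 dvd int N"
    then have "int ((nat \<bar>x\<bar>)\<^sup>2) dvd int N" by simp
    then have "(nat \<bar>x\<bar>)\<^sup>2 dvd N" by (simp only: int_dvd_int_iff)
    then have "nat \<bar>x\<bar> = 1" using assms(1) squarefreeD by fastforce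
    then show "is_unit x" by simp
  qed
  define g where "g = gcd (2 * int N) r"
  have g0: "g > 0" using N by (simp add: g_def)
  obtain m where m: "2 * int N = g * m" by (metis dvd_def g_def gcd_dvd1)
  obtain s where s: "r = g * s" by (metis dvd_def g_def gcd_dvd2)
  have cop: "coprime m s"
  proof -
    have "gcd (g * m) (g * s) = g" unfolding m[symmetric] s[symmetric] by (simp add: g_def)
    then have "g * gcd m s = g" using g0 by (simp add: gcd_mult_left)
    then show ?thesis using g0 by (simp add: coprime_iff_gcd_eq_1)
  qed
  have "2 * (g * m) dvd g * (g * s\<^sup>2)"
    using assms(2) unfolding s m[symmetric] by (simp add: power2_eq_square mult_ac)
  then have "g * (2 * m) dvd g * (g * s\<^sup>2)" by (simp add: mult_ac)
  then have 1: "2 * m dvd g * s\<^sup>2" using g0 by simp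
  have "coprime m (s\<^sup>2)" using cop by simp
  moreover have "m dvd g * s\<^sup>2" using 1 by (rule dvd_mult_right)
  ultimately have mg: "m dvd g" by (simp add: coprime_dvd_mult_left_iff)
  then obtain k where k: "g = m * k" by blast
  have "2 * m dvd m * (k * s\<^sup>2)" using 1 k by (simp add: mult_ac)
  moreover have m0: "m \<noteq> 0" using m N by auto
  ultimately have "2 dvd k * s\<^sup>2" by (metis dvd_mult_cancel_left mult.commute)
  have Nm: "2 * int N = m\<^sup>2 * k" using m k by (simp add: power2_eq_square mult_ac)
  have "is_unit m"
  proof (cases "even m")
    case False
    then have "coprime (m\<^sup>2) 2" by simp
    moreover have "m\<^sup>2 dvd 2 * int N" using Nm by simp
    ultimately have "m\<^sup>2 dvd int N" by (simp add: coprime_dvd_mult_right_iff)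
    then show ?thesis by (rule sf)
  next
    case True
    then have "odd s" using cop by (meson coprime_def odd_one)
    then have "even k" using \<open>2 dvd k * s\<^sup>2\<close> by simp
    then obtain l where "k = 2 * l" by blast
    then have "int N = m\<^sup>2 * l" using Nm by simp
    then have "m\<^sup>2 dvd int N" by simp
    then show ?thesis by (rule sf)
  qed
  then have "2 * int N dvd g" using m by (metis dvd_mult_unit_iff' dvd_refl mult.commute)
  then show ?thesis using s by simp
qed

text \<open>The square of the reduced denominator of \<open>v\<close> must divide N.\<close>

lemma Ints_of_squarefree_mult_square:
  assumes "squarefree N" "v \<in> \<rat>" "real N * v\<^sup>2 \<in> \<int>"
  shows "v \<in> \<int>"
proof -
  obtain a b :: int where ab: "v = of_int a / of_int b" "b > 0" "coprime a b"
    using assms(2) by (rule Rats_cases')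
  obtain k :: int where "real N * v\<^sup>2 = of_int k" using assms(3) by (rule Ints_cases)
  then have "real N * of_int a ^ 2 = of_int k * of_int b ^ 2"
    using ab by (simp add: power_divide field_simps)
  then have "real_of_int (int N * a\<^sup>2) = real_of_int (k * b\<^sup>2)" by simp
  then have "int N * a\<^sup>2 = k * b\<^sup>2" by (simp only: of_int_eq_iff)
  then have "b\<^sup>2 dvd int N * a\<^sup>2" by simp
  moreover have "coprime (b\<^sup>2) (a\<^sup>2)" using ab(3) by (simp add: coprime_commute)
  ultimately have "b\<^sup>2 dvd int N" by (simp add: coprime_dvd_mult_left_iff)
  then have "int ((nat b)\<^sup>2) dvd int N" using ab(2) by simp
  then have "(nat b)\<^sup>2 dvd N" by (simp only: int_dvd_int_iff)
  then have "nat b = 1" using assms(1) squarefreeD by fastforce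
  then have "b = 1" using ab(2) by simp
  then show ?thesis using ab by simp
qed

section \<open>Denominators of entries and of 2 x 2 minors\<close>

definition int_scaled :: "real \<Rightarrow> real^'n^'m \<Rightarrow> bool" where
  "int_scaled c M \<longleftrightarrow> (\<forall>i j. c * M$i$j \<in> \<int>)"

definition minor2 :: "real^'n^'m \<Rightarrow> 'm \<Rightarrow> 'm \<Rightarrow> 'n \<Rightarrow> 'n \<Rightarrow> real" where
  "minor2 M i j k l = M$i$k * M$j$l - M$i$l * M$j$k"

definition minors_int_scaled :: "real \<Rightarrow> real^'n^'m \<Rightarrow> bool" where
  "minors_int_scaled c M \<longleftrightarrow> (\<forall>i j k l. c * minor2 M i j k l \<in> \<int>)"

lemma integral_iff_int_scaled: "integral_matrix M \<longleftrightarrow> int_scaled 1 M"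
  by (simp add: integral_matrix_def int_scaled_def)

lemma int_scaled_mult:
  assumes "int_scaled c A" "int_scaled d B"
  shows "int_scaled (c * d) (A ** B)"
  unfolding int_scaled_def
proof (intro allI)
  fix i j
  have "c * d * (A ** B)$i$j = (\<Sum>k\<in>UNIV. (c * A$i$k) * (d * B$k$j))"
    by (simp add: matrix_matrix_mult_def sum_distrib_left mult_ac)
  then show "c * d * (A ** B)$i$j \<in> \<int>"
    using assms Ints_mult[of "c * A$i$_" "d * B$_$j"] by (auto simp only: int_scaled_def intro!: Ints_sum)
qed

text \<open>The Cauchy-Binet formula, summed over the ten pairs of inner indices.\<close>

lemma minor2_mult:
  fixes A B :: "real^5^5"
  shows "minor2 (A ** B) i j k l =
    minor2 A i j 1 2 * minor2 B 1 2 k l + minor2 A i j 1 3 * minor2 B 1 3 k l +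
    minor2 A i j 1 4 * minor2 B 1 4 k l + minor2 A i j 1 5 * minor2 B 1 5 k l +
    minor2 A i j 2 3 * minor2 B 2 3 k l + minor2 A i j 2 4 * minor2 B 2 4 k l +
    minor2 A i j 2 5 * minor2 B 2 5 k l + minor2 A i j 3 4 * minor2 B 3 4 k l +
    minor2 A i j 3 5 * minor2 B 3 5 k l + minor2 A i j 4 5 * minor2 B 4 5 k l"
  by (simp add: minor2_def matrix_matrix_mult_def sum_5 algebra_simps)

lemma minors_int_scaled_mult:
  fixes A B :: "real^5^5"
  assumes "minors_int_scaled c A" "minors_int_scaled d B"
  shows "minors_int_scaled (c * d) (A ** B)"
  unfolding minors_int_scaled_def
proof (intro allI)
  fix i j k l
  have *: "c * d * (x * y) = (c * x) * (d * y)" for x y by simp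
  have **: "(c * minor2 A i j p q) * (d * minor2 B p q k l) \<in> \<int>" for p q
    using assms by (simp add: minors_int_scaled_def)
  show "c * d * minor2 (A ** B) i j k l \<in> \<int>"
    unfolding minor2_mult distrib_left * by (intro Ints_add **)
qed

lemma int_scaled_minors:
  assumes "int_scaled 1 A"
  shows "minors_int_scaled 1 A"
  using assms by (simp add: int_scaled_def minors_int_scaled_def minor2_def)

lemma real_quotient_Ints: "n > 0 \<Longrightarrow> real c / real n \<in> \<int> \<Longrightarrow> n dvd c"
proof -
  assume n: "n > 0" and "real c / real n \<in> \<int>"
  then obtain k where "real c / real n = of_int k" by (auto elim: Ints_cases)
  then have "real_of_int (int c) = real_of_int (k * int n)" using n by (simp add: field_simps)
  then have "int c = k * int n" by (simp only: of_int_eq_iff)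
  then have "int n dvd int c" by simp
  then show ?thesis by simp
qed

definition D_mat :: "nat \<times> nat \<Rightarrow> real^5^5" where
  "D_mat s = torus (real (entry_level s)) (real (snd s))"

lemma D_mat_int_scaled:
  assumes "pos_pair s"
  shows "int_scaled (real (entry_level s)) (D_mat s)"
  using assms
  by (simp add: int_scaled_def forall_5 D_mat_def torus_def diag5_def entry_level_def pos_pair_def)

lemma D_mat_int_scaled_dvd:
  assumes "pos_pair s" "int_scaled (real c) (D_mat s)"
  shows "entry_level s dvd c"
proof -
  have "real c * D_mat s $ 1 $ 1 \<in> \<int>" using assms(2) by (simp only: int_scaled_def)
  then have "real c / real (entry_level s) \<in> \<int>" by (simp add: D_mat_def torus_def diag5_def)
  then show ?thesis using level_pos(1)[OF assms(1)] by (rule real_quotient_Ints[rotated])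
qed

lemma D_mat_minors:
  assumes "pos_pair s"
  shows "minors_int_scaled (real (minor_level s)) (D_mat s)"
proof -
  define t where "t i = D_mat s $ i $ i" for i
  have d: "D_mat s $ i $ j = (if i = j then t i else 0)" for i j
    using exhaust_5[of i] exhaust_5[of j]
    by (auto simp: t_def D_mat_def torus_def diag5_def)
  have "\<forall>i j. i \<noteq> j \<longrightarrow> real (minor_level s) * (t i * t j) \<in> \<int>"
    using assms unfolding forall_5
    by (simp add: t_def D_mat_def torus_def diag5_def minor_level_def entry_level_def pos_pair_def power2_eq_square)
  then have tt: "real (minor_level s) * (t i * t j) \<in> \<int>" if "i \<noteq> j" for i j using that by blast
  have "real (minor_level s) * minor2 (D_mat s) i j k l \<in> \<int>" for i j k l
    using tt[of i j] by (auto simp: minor2_def d)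
  then show ?thesis by (simp add: minors_int_scaled_def)
qed

lemma D_mat_minors_dvd:
  assumes "pos_pair s" "minors_int_scaled (real c) (D_mat s)"
  shows "minor_level s dvd c"
proof -
  have "real c * minor2 (D_mat s) 1 2 1 2 \<in> \<int>" using assms(2) by (simp only: minors_int_scaled_def)
  then have "real c / real (minor_level s) \<in> \<int>"
    by (simp add: minor2_def D_mat_def torus_def diag5_def entry_level_def minor_level_def power2_eq_square mult_ac)
  then show ?thesis using level_pos(2)[OF assms(1)] by (rule real_quotient_Ints[rotated])
qed

section \<open>Primitive isotropic vectors\<close>

lemma of_int_div_Ints: "p > 0 \<Longrightarrow> real_of_int a / real p \<in> \<int> \<longleftrightarrow> int p dvd a"
proof
  assume p: "p > 0"
  show "int p dvd a" if q: "real_of_int a / real p \<in> \<int>"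
  proof -
    obtain k where "real_of_int a / real p = of_int k" using q by (rule Ints_cases)
    then have "real_of_int a = real_of_int (k * int p)" using p by (simp add: field_simps)
    then have "a = k * int p" by (simp only: of_int_eq_iff)
    then show ?thesis by simp
  qed
  show "real_of_int a / real p \<in> \<int>" if "int p dvd a"
    using that p by (auto simp: dvd_def)
qed

text \<open>With integers y = c x, isotropy for the dual form reads y3^2 = 4N (y1 y5 + y2 y4), so 2N
  divides y3. This removes the denominators 2N that occur in inverses.\<close>

lemma isotropic_third_coordinate:
  assumes N: "squarefree N" and iso: "2 * (x1 * x5 + x2 * x4) = x3 * x3 / (2 * real N)"
    and int: "c * x1 \<in> \<int>" "c * x2 \<in> \<int>" "c * x3 \<in> \<int>" "c * x4 \<in> \<int>" "c * x5 \<in> \<int>"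
  shows "c * x3 / (2 * real N) \<in> \<int>"
proof -
  have N0: "N > 0" using N by (metis gr0I not_squarefree_0)
  obtain y1 y2 y3 y4 y5 where y: "c * x1 = of_int y1" "c * x2 = of_int y2" "c * x3 = of_int y3"
    "c * x4 = of_int y4" "c * x5 = of_int y5" using int by (auto elim!: Ints_cases)
  have "x3 * x3 = 4 * real N * (x1 * x5 + x2 * x4)" using iso N0 by (simp add: field_simps)
  then have "(c * x3) * (c * x3) = 4 * real N * ((c * x1) * (c * x5) + (c * x2) * (c * x4))"
    by (simp add: algebra_simps)
  then have "real_of_int (y3 * y3) = real_of_int (4 * int N * (y1 * y5 + y2 * y4))"
    unfolding y by simp
  then have "y3\<^sup>2 = 4 * int N * (y1 * y5 + y2 * y4)"
    by (simp only: of_int_eq_iff power2_eq_square)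
  then have "4 * int N dvd y3\<^sup>2" by simp
  then have "int (2 * N) dvd y3" using dvd_of_four_mult_dvd_square[OF N] by simp
  then show ?thesis using of_int_div_Ints[of "2 * N" y3] N0 by (simp add: y)
qed

lemma row_isotropic:
  assumes N: "squarefree N" and M: "M \<in> orth N" and i: "i \<noteq> 3"
  shows "2 * (M$i$1 * M$i$5 + M$i$2 * M$i$4) = M$i$3 * M$i$3 / (2 * real N)"
proof -
  have N0: "N > 0" using N by (metis gr0I not_squarefree_0)
  have "bil' N (M$i) (M$i) = S_inv N $ i $ i" using orth_rows[OF N0 M] .
  moreover have "S_inv N $ i $ i = 0" using i exhaust_5[of i] by (auto simp: S_inv_def)
  ultimately show ?thesis by (simp add: bil'_def algebra_simps)
qed

text \<open>The entries that \<open>adj\<close> divides by 2N are third coordinates of rows other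
  than the third, and these rows are isotropic for the dual form.\<close>

lemma int_scaled_adj:
  assumes N: "squarefree N" and M: "M \<in> orth N" and c: "int_scaled c M"
  shows "int_scaled c (adj N M)"
proof -
  have N0: "N > 0" using N by (metis gr0I not_squarefree_0)
  have e: "c * M$i$j \<in> \<int>" for i j using c by (simp add: int_scaled_def)
  have r: "c * M$i$3 / (2 * real N) \<in> \<int>" if "i \<noteq> 3" for i
    by (rule isotropic_third_coordinate[OF N row_isotropic[OF N M that] e e e e e])
  have m: "c * (2 * real N * M$i$j) \<in> \<int>" for i j
  proof -
    have "(2 * real N) * (c * M$i$j) \<in> \<int>" by (rule Ints_mult[OF _ e]) simp
    then show ?thesis by (simp add: mult_ac)
  qed
  show ?thesis
    unfolding int_scaled_def forall_5 adj_entries[OF N0]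
    using e m r[of 1] r[of 2] r[of 4] r[of 5] by simp
qed

section \<open>The integral group\<close>

lemma Gamma_iff: "M \<in> Gamma_hat N \<longleftrightarrow> M \<in> SO0_hat N \<and> int_scaled 1 M"
  by (simp add: Gamma_hat_def integral_iff_int_scaled)

lemma Gamma_SO0: "M \<in> Gamma_hat N \<Longrightarrow> M \<in> SO0_hat N"
  by (simp add: Gamma_iff)

lemma Gamma_orth: "M \<in> Gamma_hat N \<Longrightarrow> M \<in> orth N"
  by (simp add: Gamma_iff SO0_orth)

lemma Gamma_int: "M \<in> Gamma_hat N \<Longrightarrow> int_scaled 1 M"
  by (simp add: Gamma_iff)

lemma squarefree_pos: "squarefree N \<Longrightarrow> N > (0::nat)"
  by (metis gr0I not_squarefree_0)

lemma Gamma_mult: "squarefree N \<Longrightarrow> A \<in> Gamma_hat N \<Longrightarrow> B \<in> Gamma_hat N \<Longrightarrow> A ** B \<in> Gamma_hat N"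
  using int_scaled_mult[of 1 A 1 B] SO0_mult[OF squarefree_pos] by (simp add: Gamma_iff)

lemma Gamma_adj: "squarefree N \<Longrightarrow> A \<in> Gamma_hat N \<Longrightarrow> adj N A \<in> Gamma_hat N"
  using int_scaled_adj[of N A 1] SO0_adj[OF squarefree_pos] SO0_orth by (simp add: Gamma_iff)

lemma Gamma_one: "mat 1 \<in> Gamma_hat N"
  unfolding Gamma_iff by (simp add: SO0_one) (simp add: int_scaled_def mat_def)

lemma left_mat_Gamma:
  "squarefree N \<Longrightarrow> a * d - b * c = 1 \<Longrightarrow> left_mat (of_int a) (of_int b) (of_int c) (of_int d) \<in> Gamma_hat N"
  using left_mat_SO0[OF squarefree_pos, of N "of_int a" "of_int d" "of_int b" "of_int c"]
  by (simp add: Gamma_iff int_scaled_def forall_5 left_mat_def flip: of_int_mult of_int_diff)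

lemma right_mat_Gamma:
  "squarefree N \<Longrightarrow> a * d - b * c = 1 \<Longrightarrow> right_mat (of_int a) (of_int b) (of_int c) (of_int d) \<in> Gamma_hat N"
  using right_mat_SO0[OF squarefree_pos, of N "of_int a" "of_int d" "of_int b" "of_int c"]
  by (simp add: Gamma_iff int_scaled_def forall_5 right_mat_def flip: of_int_mult of_int_diff)

lemma low_mat_Gamma: "squarefree N \<Longrightarrow> low_mat N (of_int b2) (of_int b3) (of_int b4) \<in> Gamma_hat N"
  using low_mat_SO0[OF squarefree_pos, of N]
  by (simp add: Gamma_iff int_scaled_def forall_5 low_mat_def)

lemma upp_mat_Gamma: "squarefree N \<Longrightarrow> upp_mat N (of_int b2) (of_int b3) (of_int b4) \<in> Gamma_hat N"
  using upp_mat_SO0[OF squarefree_pos, of N]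
  by (simp add: Gamma_iff int_scaled_def forall_5 upp_mat_def)

definition primitive :: "real^5 \<Rightarrow> bool" where
  "primitive w \<longleftrightarrow> (\<forall>i. w$i \<in> \<int>) \<and> (\<forall>p::nat. prime p \<longrightarrow> (\<exists>i. w$i / real p \<notin> \<int>))"

lemma int_scaled_vec:
  assumes "int_scaled 1 A" "\<forall>i. (w::real^5)$i / c \<in> \<int>"
  shows "(A *v w)$i / c \<in> \<int>"
proof -
  have "(A *v w)$i / c = (\<Sum>j\<in>UNIV. A$i$j * (w$j / c))"
    by (simp add: matrix_vector_mult_def sum_divide_distrib)
  moreover have "A$i$j * (w$j / c) \<in> \<int>" for j
    by (rule Ints_mult) (use assms in \<open>simp_all add: int_scaled_def\<close>)
  ultimately show ?thesis by (auto intro!: Ints_sum)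
qed

lemma primitive_Gamma:
  assumes N: "squarefree N" and A: "A \<in> Gamma_hat N" and w: "primitive w"
  shows "primitive (A *v w)"
proof -
  have inv: "adj N A *v (A *v w) = w"
    using adj_left[OF squarefree_pos[OF N] Gamma_orth[OF A]] by (simp add: matrix_vector_mul_assoc)
  have "\<exists>i. (A *v w)$i / real p \<notin> \<int>" if "prime p" for p
  proof (rule ccontr)
    assume "\<not> ?thesis"
    then have "w$i / real p \<in> \<int>" for i
      using int_scaled_vec[OF Gamma_int[OF Gamma_adj[OF N A]], of "A *v w" "real p" i] inv by simp
    then show False using w that by (auto simp: primitive_def)
  qed
  moreover have "(A *v w)$i \<in> \<int>" for i
    using int_scaled_vec[OF Gamma_int[OF A], of w 1 i] w by (simp add: primitive_def)
  ultimately show ?thesis by (simp add: primitive_def)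
qed

text \<open>Among the nonzero first coordinates occurring in the orbit of \<open>w\<close> choose one of least
  absolute value \<open>c\<close>; then \<open>c\<close> divides all coordinates of the hyperbolic part, so \<open>c\<^sup>2\<close> divides
  \<open>N w\<^sub>3\<^sup>2\<close>, which forces \<open>c = 1\<close>.\<close>
lemma primitive_isotropic_transitive:
  assumes N: "squarefree N" and w: "primitive w" and iso: "bil N w w = 0"
  shows "\<exists>A \<in> Gamma_hat N. A *v w = vector [1, 0, 0, 0, 0]"
proof -
  note N0 = squarefree_pos[OF N]
  define P where "P c \<longleftrightarrow> c > 0 \<and> (\<exists>A\<in>Gamma_hat N. (A *v w)$1 = real c)" for c
  have left: "(left_mat a b c d *v v)$1 = a * v$1 - b * v$4" "(left_mat a b c d *v v)$2 = a * v$2 + b * v$5"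
    for a b c d v by (simp_all add: matrix_vector_mult_def sum_5 left_mat_def)
  have orbit: "\<exists>c. P c \<and> int c = \<bar>k\<bar>" if A: "A \<in> Gamma_hat N" "(A *v w)$1 = of_int k" "k \<noteq> 0" for A k
  proof (cases "k > 0")
    case True
    then show ?thesis using that by (intro exI[of _ "nat k"]) (auto simp: P_def)
  next
    case False
    let ?B = "left_mat (of_int (-1)) (of_int 0) (of_int 0) (of_int (-1)) ** A"
    have "?B \<in> Gamma_hat N" using A left_mat_Gamma[OF N, of "-1" "-1" 0 0] by (intro Gamma_mult[OF N]) auto
    moreover have "(?B *v w)$1 = real (nat (-k))"
      using False A(2) by (simp add: matrix_vector_mul_assoc[symmetric] left)
    ultimately show ?thesis using False that by (intro exI[of _ "nat (-k)"]) (auto simp: P_def)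
  qed
  have right: "(right_mat a b c d *v v)$1 = a * v$1 + c * v$2" "(right_mat a b c d *v v)$4 = a * v$4 - c * v$5"
    for a b c d v by (simp_all add: matrix_vector_mult_def sum_5 right_mat_def)
  \<comment> \<open>A left multiplication following a right one brings the last coordinate into
    first position, with two free integers \<open>h'\<close> and \<open>k'\<close> for reducing
    it.\<close>
  have two: "\<exists>B\<in>Gamma_hat N. (B *v (A *v w))$1 = h * k * (A *v w)$1 + h * (A *v w)$2 - k * (A *v w)$4 + (A *v w)$5"
    if "h = of_int h'" "k = of_int k'" for A h k h' k'
  proof -
    let ?B = "left_mat (of_int h') (of_int 1) (of_int (-1)) (of_int 0) ** right_mat (of_int k') (of_int (-1)) (of_int 1) (of_int 0)"
    have "?B \<in> Gamma_hat N" by (intro Gamma_mult[OF N] left_mat_Gamma[OF N] right_mat_Gamma[OF N]) auto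
    moreover have "(?B *v (A *v w))$1 = h * k * (A *v w)$1 + h * (A *v w)$2 - k * (A *v w)$4 + (A *v w)$5"
      using that by (simp add: matrix_vector_mul_assoc[symmetric] left right algebra_simps)
    ultimately show ?thesis by blast
  qed
  obtain x1 x2 x3 x4 x5 where x: "w$1 = of_int x1" "w$2 = of_int x2" "w$3 = of_int x3"
    "w$4 = of_int x4" "w$5 = of_int x5"
    using w by (meson primitive_def Ints_cases)
  have ex: "\<exists>c. P c"
  proof -
    consider "x1 \<noteq> 0" | "x2 \<noteq> 0" | "x4 \<noteq> 0" | "x5 \<noteq> 0" | "x1 = 0" "x2 = 0" "x4 = 0" "x5 = 0" by blast
    then show ?thesis
    proof cases
      case 1 then show ?thesis using orbit[OF Gamma_one, of x1] x by auto
    next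
      case 2
      then show ?thesis
        using orbit[OF right_mat_Gamma[OF N, of 0 0 "-1" 1], of x2] x right(1) by auto
    next
      case 3
      then show ?thesis
        using orbit[OF left_mat_Gamma[OF N, of 0 0 1 "-1"], of "-x4"] x left(1) by auto
    next
      case 4
      obtain B where "B \<in> Gamma_hat N" "(B *v (mat 1 *v w))$1 = 0 * 0 * (mat 1 *v w)$1 + 0 * (mat 1 *v w)$2 - 0 * (mat 1 *v w)$4 + (mat 1 *v w)$5"
        using two[of 0 0 0 0 "mat 1"] by auto
      then show ?thesis using orbit[of B x5] x 4 by auto
    next
      case 5
      then have "real N * (w$3 * w$3) = 0" using iso x by (simp add: bil_def)
      then have "w$3 = 0" using N0 by simp
      then have "w$i / real 2 \<in> \<int>" for i using 5 x exhaust_5[of i] by auto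
      moreover have "\<exists>i. w$i / real 2 \<notin> \<int>" using w two_is_prime_nat unfolding primitive_def by blast
      ultimately show ?thesis by blast
    qed
  qed
  define c where "c = (LEAST c. P c)"
  have Pc: "P c" unfolding c_def using ex by (rule LeastI_ex)
  then obtain A where A: "A \<in> Gamma_hat N" "(A *v w)$1 = real c" and c0: "c > 0" by (auto simp: P_def)
  have min: "k = 0" if B: "B \<in> Gamma_hat N" "(B *v (A *v w))$1 = of_int k" "\<bar>k\<bar> < int c" for B k
  proof (rule ccontr)
    assume "k \<noteq> 0"
    then obtain c' where c': "P c'" "int c' = \<bar>k\<bar>"
      using orbit[OF Gamma_mult[OF N B(1) A(1)], of k] B(2) by (auto simp: matrix_vector_mul_assoc)
    then have "c \<le> c'" unfolding c_def by (intro Least_le)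
    then show False using c' B(3) by simp
  qed
  define v where "v = A *v w"
  have v: "primitive v" unfolding v_def by (rule primitive_Gamma[OF N A(1) w])
  have viso: "bil N v v = 0" unfolding v_def bil_matrix_vector[OF Gamma_orth[OF A(1)]] by (rule iso)
  obtain y2 y3 y4 y5 where y: "v$2 = of_int y2" "v$3 = of_int y3" "v$4 = of_int y4" "v$5 = of_int y5"
    using v by (meson primitive_def Ints_cases)
  have y1: "v$1 = of_int (int c)" using A(2) by (simp add: v_def)
  have small: "\<bar>a mod int c\<bar> < int c" for a using c0 by simp
  have "y2 mod int c = 0"
  proof (rule min[OF right_mat_Gamma[OF N, of "- (y2 div int c)" 0 "-1" 1] _ small])
    show "(right_mat (of_int (- (y2 div int c))) (of_int (-1)) (of_int 1) (of_int 0) *v (A *v w))$1 = of_int (y2 mod int c)"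
      unfolding right v_def[symmetric] y y1 by (simp flip: of_int_mult of_int_diff add: minus_div_mult_eq_mod[symmetric] del: of_int_of_nat_eq)
  qed simp
  then obtain m2 where m2: "y2 = int c * m2" by (auto simp: mod_eq_0_iff_dvd)
  have "- (y4 mod int c) = 0"
  proof (rule min[OF left_mat_Gamma[OF N, of "y4 div int c" 0 1 "-1"]])
    show "(left_mat (of_int (y4 div int c)) (of_int 1) (of_int (-1)) (of_int 0) *v (A *v w))$1 = of_int (- (y4 mod int c))"
      unfolding left v_def[symmetric] y y1 by (simp flip: of_int_mult of_int_diff add: minus_div_mult_eq_mod[symmetric] del: of_int_of_nat_eq)
    show "\<bar>- (y4 mod int c)\<bar> < int c" using small[of y4] by simp
  qed simp
  then obtain m4 where m4: "y4 = int c * m4" by (auto simp: mod_eq_0_iff_dvd)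
  have "y5 mod int c = 0"
  proof -
    \<comment> \<open>With y2 = c m2 and y4 = c m4 the combination in \<open>two\<close> equals c h
      (k + m2) - c k m4 + y5. The choice k = 1 - m2 makes the coefficient of h equal to c, and h is
      then solved for so that the remainder of y5 is left.\<close>
    define h where "h = m4 - y5 div int c - m2 * m4"
    define k where "k = 1 - m2"
    obtain B where B: "B \<in> Gamma_hat N" "(B *v (A *v w))$1 = of_int h * of_int k * (A *v w)$1 + of_int h * (A *v w)$2 - of_int k * (A *v w)$4 + (A *v w)$5"
      using two by blast
    have "h * k * int c + h * y2 - k * y4 + y5 = y5 mod int c"
      unfolding h_def k_def m2 m4 minus_div_mult_eq_mod[symmetric] by (simp add: algebra_simps)
    then have "(B *v (A *v w))$1 = of_int (y5 mod int c)"
      unfolding v_def[symmetric] B(2)[folded v_def] y y1 by (simp flip: of_int_mult of_int_diff of_int_add del: of_int_of_nat_eq)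
    then show ?thesis using min[OF B(1) _ small] by blast
  qed
  then obtain m5 where m5: "y5 = int c * m5" by (auto simp: mod_eq_0_iff_dvd)
  have q: "int c * y5 + y2 * y4 = int N * y3\<^sup>2"
  proof -
    have "real_of_int (int c * y5 + y2 * y4) = real_of_int (int N * y3\<^sup>2)"
      using viso by (simp add: bil_def y y1 power2_eq_square algebra_simps)
    then show ?thesis by (simp only: of_int_eq_iff)
  qed
  have "c = 1"
  proof (rule ccontr)
    assume "c \<noteq> 1"
    then obtain p where p: "prime p" "p dvd c" using prime_factor_nat by blast
    have pc: "int p dvd int c" using p by simp
    have "\<not> int p dvd y3"
    proof
      assume "int p dvd y3"
      moreover have "int p dvd y2" "int p dvd y4" "int p dvd y5" using pc m2 m4 m5 by auto
      ultimately have "v$i / real p \<in> \<int>" for i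
        using exhaust_5[of i] y y1 pc p(1) prime_gt_0_nat[OF p(1)]
        by (auto simp: of_int_div_Ints simp del: of_int_of_nat_eq)
      then show False using v p(1) by (auto simp: primitive_def)
    qed
    then have cop: "coprime ((int p)\<^sup>2) (y3\<^sup>2)"
      using p(1) by (simp add: prime_imp_coprime)
    have "(int p)\<^sup>2 dvd (int c)\<^sup>2" using pc by (simp add: dvd_power_same)
    moreover have "(int c)\<^sup>2 dvd int c * y5 + y2 * y4"
      unfolding m2 m4 m5 by (simp add: power2_eq_square algebra_simps)
    ultimately have "(int p)\<^sup>2 dvd int N * y3\<^sup>2" unfolding q[symmetric] by (rule dvd_trans)
    then have "(int p)\<^sup>2 dvd int N" using cop by (simp add: coprime_dvd_mult_left_iff)
    then have "p\<^sup>2 dvd N" by (metis of_nat_dvd_iff of_nat_power)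
    then show False using N p(1) squarefreeD by (metis not_prime_unit)
  qed
  \<comment> \<open>The inverse of the Eichler transformation that takes e1 to
    \<open>v\<close>.\<close>
  let ?B = "low_mat N (of_int (- y2)) (of_int (- y3)) (of_int (- y4))"
  have v1: "v$1 = 1" using y1 \<open>c = 1\<close> by simp
  have v5: "v$5 = real N * (v$3)\<^sup>2 - v$2 * v$4" using viso v1 by (simp add: bil_def power2_eq_square)
  have "?B *v v = vector [1, 0, 0, 0, 0]"
    unfolding low_mat_def matrix_vector_mult_def vec_eq_iff forall_5 sum_5
    by (simp add: v1 v5 y[symmetric] power2_eq_square algebra_simps)
  then have "(?B ** A) *v w = vector [1, 0, 0, 0, 0]" by (simp add: v_def matrix_vector_mul_assoc)
  then show ?thesis using Gamma_mult[OF N low_mat_Gamma[OF N] A(1)] by blast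
qed

section \<open>Splitting off the outer hyperbolic plane\<close>

lemma crt_primes:
  fixes u :: "nat \<Rightarrow> nat"
  assumes "finite P" "\<And>p. p \<in> P \<Longrightarrow> prime p"
  shows "\<exists>x. \<forall>p\<in>P. [int x = int (u p)] (mod int p)"
proof -
  have "\<exists>x. \<forall>p\<in>P. [x = u p] (mod id p)"
    using assms by (intro chinese_remainder_nat) (auto intro: primes_coprime)
  then show ?thesis by (simp add: cong_int_iff)
qed

definition block :: "real \<Rightarrow> real^5^5 \<Rightarrow> bool" where
  "block x h \<longleftrightarrow> h$1$1 = 1 / x \<and> h$5$5 = x \<and> (\<forall>j. j \<noteq> 1 \<longrightarrow> h$1$j = 0 \<and> h$j$1 = 0) \<and>
     (\<forall>j. j \<noteq> 5 \<longrightarrow> h$5$j = 0 \<and> h$j$5 = 0)"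

lemma rational_common_denominator:
  fixes g :: "real^'n^'m"
  assumes "rational_matrix g"
  shows "\<exists>M>0. int_scaled (real M) g"
proof -
  have "\<exists>d::nat. d > 0 \<and> real d * g$i$j \<in> \<int>" for i j
  proof -
    have "g$i$j \<in> \<rat>" using assms by (simp add: rational_matrix_def)
    then obtain a b :: int where "g$i$j = of_int a / of_int b" "b > 0" by (rule Rats_cases')
    then show ?thesis by (intro exI[of _ "nat b"]) auto
  qed
  then obtain d where d: "\<And>i j. d i j > (0::nat)" "\<And>i j. real (d i j) * g$i$j \<in> \<int>" by metis
  define M where "M = (\<Prod>i\<in>UNIV. \<Prod>j\<in>UNIV. d i j)"
  have "M > 0" using d(1) by (simp add: M_def prod_pos)
  moreover have "real M * g$i$j \<in> \<int>" for i j
  proof -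
    have "d i j dvd (\<Prod>j\<in>UNIV. d i j)" by (rule dvd_prodI) auto
    also have "\<dots> dvd M" unfolding M_def by (rule dvd_prodI) auto
    finally obtain k where "M = d i j * k" by blast
    then have e: "real M * g$i$j = real k * (real (d i j) * g$i$j)" by simp
    show ?thesis unfolding e by (rule Ints_mult[OF _ d(2)]) simp
  qed
  ultimately show ?thesis by (auto simp: int_scaled_def)
qed

text \<open>The isotropic vectors (1, b2, b3, b4, N b3^2 - b2 b4) span everything modulo each prime
  p: five small choices of the parameters already isolate the five columns of \<open>A\<close>. So
  an integral matrix that is nonzero modulo p does not kill all of them, and the local choices are
  glued by the Chinese remainder theorem.\<close>

lemma primitive_image_exists:
  assumes M: "M > 0" "\<And>i j. real_of_int (A i j) = real M * g$i$j"
    and prim: "\<And>p. prime p \<Longrightarrow> p dvd M \<Longrightarrow> \<exists>i j. \<not> int p dvd A i (j::5)"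
  shows "\<exists>b2 b3 b4 :: nat. \<forall>p. prime p \<longrightarrow> p dvd M \<longrightarrow>
    (\<exists>i. \<not> int p dvd A i 1 + A i 2 * int b2 + A i 3 * int b3 + A i 4 * int b4 +
        A i 5 * (int N * (int b3)\<^sup>2 - int b2 * int b4))"
proof -
  let ?W = "\<lambda>i b2 b3 b4. A i 1 + A i 2 * b2 + A i 3 * b3 + A i 4 * b4 + A i 5 * (int N * b3\<^sup>2 - b2 * b4)"
  have "\<exists>c2 c3 c4. \<exists>i. \<not> int p dvd ?W i (int c2) (int c3) (int c4)" if p: "prime p" "p dvd M" for p
  proof (rule ccontr)
    assume "\<not> ?thesis"
    then have all: "int p dvd ?W i (int c2) (int c3) (int c4)" for i c2 c3 c4 by blast
    have 1: "int p dvd A i 1" for i using all[of i 0 0 0] by simp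
    have 2: "int p dvd A i 2" for i using all[of i 1 0 0] 1[of i] by (simp add: dvd_add_right_iff)
    have 4: "int p dvd A i 4" for i using all[of i 0 0 1] 1[of i] by (simp add: dvd_add_right_iff)
    have 5: "int p dvd A i 5" for i
    proof -
      have "int p dvd (A i 1 + A i 2 + A i 4) - (A i 1 + A i 2 + A i 4 - A i 5)"
      proof (rule dvd_diff)
        show "int p dvd A i 1 + A i 2 + A i 4" using 1 2 4 by (intro dvd_add)
        show "int p dvd A i 1 + A i 2 + A i 4 - A i 5" using all[of i 1 0 1] by (simp add: algebra_simps)
      qed
      then show ?thesis by simp
    qed
    have 3: "int p dvd A i 3" for i
    proof -
      have "int p dvd (A i 1 + A i 3 + A i 5 * int N) - (A i 1 + A i 5 * int N)"
      proof (rule dvd_diff)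
        show "int p dvd A i 1 + A i 5 * int N" using 1 5 by (intro dvd_add dvd_mult2)
        show "int p dvd A i 1 + A i 3 + A i 5 * int N" using all[of i 0 1 0] by (simp add: algebra_simps)
      qed
      then show ?thesis by simp
    qed
    have "int p dvd A i j" for i j using exhaust_5[of j] 1 2 3 4 5 by metis
    then show False using prim[OF p] by blast
  qed
  then obtain c2 c3 c4 where c: "\<And>p. prime p \<Longrightarrow> p dvd M \<Longrightarrow> \<exists>i. \<not> int p dvd ?W i (int (c2 p)) (int (c3 p)) (int (c4 p))"
    by metis
  let ?P = "{p. prime p \<and> p dvd M}"
  have fin: "finite ?P" using M(1) by (auto intro: finite_subset[of _ "{..M}"] dest: dvd_imp_le)
  obtain b2 where b2: "\<forall>p\<in>?P. [int b2 = int (c2 p)] (mod int p)" using crt_primes[OF fin] by blast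
  obtain b3 where b3: "\<forall>p\<in>?P. [int b3 = int (c3 p)] (mod int p)" using crt_primes[OF fin] by blast
  obtain b4 where b4: "\<forall>p\<in>?P. [int b4 = int (c4 p)] (mod int p)" using crt_primes[OF fin] by blast
  have "\<exists>i. \<not> int p dvd ?W i (int b2) (int b3) (int b4)" if p: "prime p" "p dvd M" for p
  proof -
    obtain i where i: "\<not> int p dvd ?W i (int (c2 p)) (int (c3 p)) (int (c4 p))" using c[OF p] by blast
    have "[?W i (int b2) (int b3) (int b4) = ?W i (int (c2 p)) (int (c3 p)) (int (c4 p))] (mod int p)"
      using p b2 b3 b4 by (intro cong_add cong_mult cong_diff cong_pow cong_refl) auto
    then have "\<not> int p dvd ?W i (int b2) (int b3) (int b4)" using i cong_dvd_iff by blast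
    then show ?thesis by blast
  qed
  then show ?thesis by blast
qed

lemma matrix_mult_column: "(A ** B)$i$j = (A *v column j B)$i"
  by (simp add: matrix_matrix_mult_def matrix_vector_mult_def column_def)

text \<open>After scaling by x the first row is integral with third entry divisible by 2N, so an
  integral unipotent fixing e1 clears entries 2 to 4. Isotropy of the first row clears the last one.
  Pairing with the first column and the first row then determines the fifth row and the fifth
  column.\<close>

lemma block_of_first_column:
  assumes N: "squarefree N" and h: "h \<in> SO0_hat N" "int_scaled x h" and x: "x > 0"
    and col: "column 1 h = vector [1 / x, 0, 0, 0, 0]"
  shows "\<exists>B\<in>Gamma_hat N. block x (h ** B)"
proof -
  note N0 = squarefree_pos[OF N]
  have e: "x * h$i$j \<in> \<int>" for i j using h(2) by (simp add: int_scaled_def)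
  have "x * h$1$3 / (2 * real N) \<in> \<int>"
    by (rule isotropic_third_coordinate[OF N row_isotropic[OF N SO0_orth[OF h(1)]] e e e e e]) simp
  then obtain b3 where b3: "x * h$1$3 / (2 * real N) = of_int b3" by (rule Ints_cases)
  obtain b4 where b4: "x * h$1$2 = of_int b4" using e by (rule Ints_cases)
  obtain b2 where b2: "x * h$1$4 = of_int b2" using e by (rule Ints_cases)
  define B where "B = upp_mat N (of_int b2) (of_int (- b3)) (of_int b4)"
  have B: "B \<in> Gamma_hat N" unfolding B_def by (rule upp_mat_Gamma[OF N])
  define k where "k = h ** B"
  have k: "k \<in> orth N" unfolding k_def by (intro orth_mult SO0_orth[OF h(1)] Gamma_orth[OF B])
  have c: "h$i$1 = (vector [1 / x, 0, 0, 0, 0] :: real^5)$i" for i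
    using arg_cong[OF col, of "\<lambda>v. v$i"] by (simp add: column_def)
  have k1: "k$i$1 = (vector [1 / x, 0, 0, 0, 0] :: real^5)$i" for i
    using c[of i] by (simp add: k_def B_def upp_mat_def matrix_matrix_mult_def sum_5)
  have r: "h$1$2 = of_int b4 / x" "h$1$4 = of_int b2 / x" "h$1$3 = 2 * real N * of_int b3 / x"
    using x N0 b2 b4 b3 by (simp_all add: field_simps)
  have k12: "k$1$2 = 0"
    using c[of 1] r by (simp add: k_def B_def upp_mat_def matrix_matrix_mult_def sum_5)
  have k14: "k$1$4 = 0"
    using c[of 1] r by (simp add: k_def B_def upp_mat_def matrix_matrix_mult_def sum_5)
  have k13: "k$1$3 = 0"
    using c[of 1] r by (simp add: k_def B_def upp_mat_def matrix_matrix_mult_def sum_5)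
  have k15: "k$1$5 = 0"
    using row_isotropic[OF N k, of 1] k1[of 1] k12 k13 k14 x by simp
  have k5: "k$5$j = (vector [0, 0, 0, 0, x] :: real^5)$j" for j
  proof -
    have "bil N (column 1 k) (column j k) = S_hat N $ 1 $ j" using k by (simp only: orth_iff)
    then have "k$5$j / x = S_hat N $ 1 $ j" by (simp add: bil_def column_def k1)
    then show ?thesis using exhaust_5[of j] x by (auto simp: S_hat_def field_simps)
  qed
  have kj5: "k$j$5 = (vector [0, 0, 0, 0, x] :: real^5)$j" for j
  proof -
    have "bil' N (k$1) (k$j) = S_inv N $ 1 $ j" by (rule orth_rows[OF N0 k])
    then have "k$j$5 / x = S_inv N $ 1 $ j" by (simp add: bil'_def k1 k12 k13 k14 k15)
    then show ?thesis using exhaust_5[of j] x by (auto simp: S_inv_def field_simps)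
  qed
  have "block x k"
    unfolding block_def forall_5 using k1 k12 k13 k14 k15 k5 kj5 by simp
  then show ?thesis using B k_def by blast
qed

text \<open>As M is the least common denominator of g, the matrix M g is nonzero modulo every prime
  dividing M. Hence B can be chosen with M g B e1 nonzero modulo these primes, and the remaining
  primes cause no trouble. This primitive isotropic vector is moved to e1, so that the new first
  column is e1 / M.\<close>

lemma block_reduction:
  assumes N: "squarefree N" and g: "g \<in> SO0_hat N" "rational_matrix g"
  shows "\<exists>A\<in>Gamma_hat N. \<exists>B\<in>Gamma_hat N. \<exists>M>0. int_scaled (real M) (A ** g ** B) \<and> block (real M) (A ** g ** B)"
proof -
  note N0 = squarefree_pos[OF N]
  define Q where "Q c \<longleftrightarrow> c > 0 \<and> int_scaled (real c) g" for c :: nat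
  define M where "M = (LEAST c. Q c)"
  have "\<exists>c. Q c" using rational_common_denominator[OF g(2)] by (auto simp: Q_def)
  then have QM: "Q M" unfolding M_def by (rule LeastI_ex)
  then have M: "M > 0" "int_scaled (real M) g" by (auto simp: Q_def)
  have "\<forall>i j. \<exists>a. real_of_int a = real M * g$i$j"
    using M(2) unfolding int_scaled_def by (metis Ints_cases)
  then obtain A where A: "\<And>i j. real_of_int (A i j) = real M * g$i$j" by metis
  have prim: "\<exists>i j. \<not> int p dvd A i j" if p: "prime p" "p dvd M" for p
  proof (rule ccontr)
    assume "\<not> ?thesis"
    then have all: "int p dvd A i j" for i j by blast
    obtain c where c: "M = p * c" using p by blast
    have p1: "p > 1" using p prime_gt_1_nat by blast
    have c0: "c > 0" "c < M" using c M(1) p1 by auto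
    have "real c * g$i$j \<in> \<int>" for i j
    proof -
      have "real c * g$i$j = real_of_int (A i j) / real p" using A[of i j] c p1 by simp
      then show ?thesis using all[of i j] of_int_div_Ints[of p "A i j"] p1 by simp
    qed
    then have "Q c" using c0 by (simp add: Q_def int_scaled_def)
    then have "M \<le> c" unfolding M_def by (rule Least_le)
    then show False using c0 by simp
  qed
  obtain b2 b3 b4 :: nat where b: "\<And>p. prime p \<Longrightarrow> p dvd M \<Longrightarrow>
    (\<exists>i. \<not> int p dvd A i 1 + A i 2 * int b2 + A i 3 * int b3 + A i 4 * int b4 +
        A i 5 * (int N * (int b3)\<^sup>2 - int b2 * int b4))"
    using primitive_image_exists[OF M(1) A prim, of N] by blast
  define B where "B = low_mat N (of_int (int b2)) (of_int (int b3)) (of_int (int b4))"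
  have B: "B \<in> Gamma_hat N" unfolding B_def by (rule low_mat_Gamma[OF N])
  define w where "w = real M *\<^sub>R column 1 (g ** B)"
  define W where "W i = A i 1 + A i 2 * int b2 + A i 3 * int b3 + A i 4 * int b4 +
        A i 5 * (int N * (int b3)\<^sup>2 - int b2 * int b4)" for i
  have wW: "w$i = of_int (W i)" for i
    unfolding w_def W_def
    by (simp add: A column_def matrix_matrix_mult_def sum_5 B_def low_mat_def algebra_simps)
  have "\<exists>i. w$i / real p \<notin> \<int>" if p: "prime p" for p
  proof (cases "p dvd M")
    case True
    then obtain i where "\<not> int p dvd W i" using b[OF p True] unfolding W_def by blast
    then show ?thesis unfolding wW using of_int_div_Ints prime_gt_0_nat[OF p] by blast
  next
    case False
    show ?thesis
    proof (rule ccontr)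
      assume "\<not> ?thesis"
      then have all: "\<forall>i. w$i / real p \<in> \<int>" by blast
      have 1: "int_scaled 1 (real M *\<^sub>R adj N g)"
        using int_scaled_adj[OF N SO0_orth[OF g(1)] M(2)] by (simp add: int_scaled_def)
      \<comment> \<open>M times the inverse of g is integral and takes \<open>w\<close> to M^2 times
        the first column of B, which begins with 1. A prime dividing \<open>w\<close> therefore
        divides M^2.\<close>
      have "(real M *\<^sub>R adj N g) *v w = real M ^ 2 *\<^sub>R (adj N g *v (g *v column 1 B))"
        unfolding w_def by (simp add: vec_eq_iff matrix_mult_column matrix_vector_mult_def column_def
            matrix_matrix_mult_def sum_5 power2_eq_square algebra_simps)
      also have "adj N g *v (g *v column 1 B) = column 1 B"
        using adj_left[OF N0 SO0_orth[OF g(1)]] by (simp add: matrix_vector_mul_assoc)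
      finally have "((real M *\<^sub>R adj N g) *v w)$1 = real M ^ 2"
        by (simp add: B_def low_mat_def column_def)
      then have "real_of_int (int (M ^ 2)) / real p \<in> \<int>"
        using int_scaled_vec[OF 1 all, of 1] by simp
      then have "int p dvd int (M ^ 2)" using of_int_div_Ints prime_gt_0_nat[OF p] by blast
      then have "p dvd M ^ 2" by (simp only: int_dvd_int_iff)
      then have "p dvd M" using p prime_dvd_power by blast
      then show False using False by blast
    qed
  qed
  then have prim_w: "primitive w" unfolding primitive_def by (simp add: wW)
  have "bil N (column 1 B) (column 1 B) = 0"
    by (simp add: bil_def column_def B_def low_mat_def power2_eq_square)
  then have "bil N (g *v column 1 B) (g *v column 1 B) = 0"
    by (simp only: bil_matrix_vector[OF SO0_orth[OF g(1)]])
  moreover have "w = real M *\<^sub>R (g *v column 1 B)"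
    unfolding w_def by (simp add: vec_eq_iff column_def[of _ "g ** B"] matrix_mult_column)
  moreover have "bil N (x *\<^sub>R v) (x *\<^sub>R v) = x\<^sup>2 * bil N v v" for x v
    by (simp add: bil_def power2_eq_square algebra_simps)
  ultimately have "bil N w w = 0" by simp
  then obtain C where C: "C \<in> Gamma_hat N" "C *v w = vector [1, 0, 0, 0, 0]"
    using primitive_isotropic_transitive[OF N prim_w] by blast
  define h where "h = C ** g ** B"
  have h: "h \<in> SO0_hat N" unfolding h_def by (intro SO0_mult[OF N0] Gamma_SO0[OF C(1)] Gamma_SO0[OF B] g(1))
  have hM: "int_scaled (real M) h"
    unfolding h_def using int_scaled_mult[OF int_scaled_mult[OF Gamma_int[OF C(1)] M(2)] Gamma_int[OF B]] by simp
  have hw: "real M * h$i$1 = (C *v w)$i" for i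
    unfolding h_def w_def
    by (simp add: matrix_mul_assoc[symmetric] matrix_mult_column[of C] matrix_vector_mult_def sum_distrib_left mult_ac)
  have "h$i$1 = (vector [1, 0, 0, 0, 0] :: real^5)$i / real M" for i
    using M(1) hw[of i] unfolding C(2) by (simp add: field_simps)
  then have "column 1 h = vector [1 / real M, 0, 0, 0, 0]"
    by (simp add: vec_eq_iff forall_5 column_def)
  then obtain B' where B': "B' \<in> Gamma_hat N" "block (real M) (h ** B')"
    using block_of_first_column[OF N h hM] M(1) by auto
  have e: "h ** B' = C ** g ** (B ** B')" by (simp add: h_def matrix_mul_assoc)
  have "int_scaled (real M) (h ** B')" using int_scaled_mult[OF hM Gamma_int[OF B'(1)]] by simp
  then show ?thesis
    using B' C(1) M(1) Gamma_mult[OF N B B'(1)] unfolding e by blast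
qed

section \<open>The ternary form\<close>

lemma coprime_if_no_prime:
  fixes a b :: nat
  assumes "\<And>p. prime p \<Longrightarrow> p dvd a \<Longrightarrow> p dvd b \<Longrightarrow> False"
  shows "coprime a b"
  using assms by (metis coprime_iff_gcd_eq_1 dvd_trans gcd_dvd1 gcd_dvd2 prime_factor_nat)

lemma squarefree_prime_factors:
  fixes d e p :: nat
  assumes "squarefree (d * e)" "prime p" "p dvd d" "p dvd e"
  shows False
proof -
  have "p\<^sup>2 dvd d * e" using assms by (simp add: power2_eq_square mult_dvd_mono)
  then have "p dvd 1" using assms(1) by (rule squarefreeD[rotated])
  then show False using assms(2) by simp
qed

text \<open>The case of \<open>sym_mat\<close> in which the radicals cancel because N = d e. Its
  second column is the isotropic vector (d s^2, s t, e t^2) of the ternary form.\<close>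

definition al_mat :: "nat \<Rightarrow> nat \<Rightarrow> int \<Rightarrow> int \<Rightarrow> int \<Rightarrow> int \<Rightarrow> real^5^5" where
  "al_mat d e s t x y = vector [
    vector [1, 0, 0, 0, 0],
    vector [0, d * s\<^sup>2, 2 * (real d * real e) * s * y, e * y\<^sup>2, 0],
    vector [0, s * t, d * s * x + e * t * y, x * y, 0],
    vector [0, e * t\<^sup>2, 2 * (real d * real e) * t * x, d * x\<^sup>2, 0],
    vector [0, 0, 0, 0, 1]]"

text \<open>These are the Atkin--Lehner type elements \<open>((\<surd>d s, \<surd>e y), (\<surd>e t, \<surd>d x))\<close> in the
  symmetric square picture.\<close>
lemma al_mat_Gamma:
  assumes N: "squarefree N" "N = d * e" and det: "int d * s * x - int e * t * y = 1"
  shows "al_mat d e s t x y \<in> Gamma_hat N"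
proof -
  define a b where "a = sqrt d" and "b = sqrt e"
  have N0: "N > 0" using squarefree_pos[OF N(1)] .
  then have de: "d > 0" "e > 0" using N(2) by auto
  have ab: "a * a = real d" "b * b = real e" "a \<noteq> 0" "b \<noteq> 0" "sqrt N = a * b"
    using de N(2) by (simp_all add: a_def b_def real_sqrt_mult)
  have "real_of_int (int d * s * x - int e * t * y) = 1" using det by simp
  then have det': "a * s * (a * x) - b * y * (b * t) = 1"
    by (simp add: ab(1,2)[symmetric] mult_ac)
  have "al_mat d e s t x y = sym_mat N (a * s) (b * y) (b * t) (a * x)"
    unfolding al_mat_def sym_mat_def ab(5) ab(1,2)[symmetric] using ab(3,4)
    by (simp add: vec_eq_iff forall_5 power2_eq_square mult_ac)
  then have "al_mat d e s t x y \<in> SO0_hat N" using sym_mat_SO0[OF N0 det'] by simp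
  then show ?thesis by (simp add: Gamma_iff int_scaled_def forall_5 al_mat_def)
qed

text \<open>With d = gcd(u2, N) and N = d e, the quotients u2 / d and u4 / e are coprime with
  product u3^2, so both are squares. That e divides u4 uses that u2 / d is coprime to e, as a common
  prime would divide both d and e.\<close>

lemma isotropic_parametrization_nat:
  fixes N u2 u3 u4 :: nat
  assumes N: "squarefree N" and q: "u2 * u4 = N * u3\<^sup>2"
    and prim: "\<And>p. prime p \<Longrightarrow> p dvd u2 \<Longrightarrow> p dvd u3 \<Longrightarrow> p dvd u4 \<Longrightarrow> False"
  shows "\<exists>d e s t. N = d * e \<and> u2 = d * s\<^sup>2 \<and> u3 = s * t \<and> u4 = e * t\<^sup>2 \<and> coprime (d * s) (e * t)"
proof -
  note N0 = squarefree_pos[OF N]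
  define d where "d = gcd u2 N"
  obtain e where e: "N = d * e" unfolding d_def by (metis dvdE gcd_dvd2)
  obtain a where a: "u2 = d * a" unfolding d_def by (metis dvdE gcd_dvd1)
  have d0: "d > 0" and e0: "e > 0" using N0 e by auto
  have N': "squarefree (d * e)" using N e by simp
  have ae: "coprime a e"
  proof (rule coprime_if_no_prime)
    fix p assume p: "prime p" "p dvd a" "p dvd e"
    then have "p dvd d" unfolding d_def using a e by simp
    then show False using squarefree_prime_factors[OF N'] p by blast
  qed
  have q': "a * u4 = e * u3\<^sup>2" using q d0 unfolding a e by (simp add: mult_ac)
  then have "e dvd a * u4" by simp
  then have "e dvd u4" using ae by (simp add: coprime_dvd_mult_right_iff coprime_commute)
  then obtain b where b: "u4 = e * b" by blast
  have ab: "a * b = u3\<^sup>2" using q' e0 unfolding b by (simp add: mult_ac)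
  have cab: "coprime a b"
  proof (rule coprime_if_no_prime)
    fix p assume p: "prime p" "p dvd a" "p dvd b"
    then have "p dvd u3\<^sup>2" unfolding ab[symmetric] by simp
    then have "p dvd u3" using p(1) prime_dvd_power by blast
    then show False using prim[of p] p a b by simp
  qed
  have "is_nth_power 2 (a * b)" unfolding ab by simp
  then have "is_nth_power 2 a \<and> is_nth_power 2 b"
    using is_nth_power_mult_coprime_natD[OF cab] cab by (cases "a = 0"; cases "b = 0") auto
  then have "is_nth_power 2 a" "is_nth_power 2 b" by auto
  then obtain s t where st: "a = s\<^sup>2" "b = t\<^sup>2" by (auto elim!: is_nth_powerE)
  have "u3\<^sup>2 = (s * t)\<^sup>2" using ab unfolding st by (simp add: power_mult_distrib)
  then have u3: "u3 = s * t" by simp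
  have "coprime (d * s) (e * t)"
  proof (rule coprime_if_no_prime)
    fix p assume p: "prime p" "p dvd d * s" "p dvd e * t"
    have "p dvd d \<or> p dvd s" "p dvd e \<or> p dvd t" using p prime_dvd_mult_iff by blast+
    then consider "p dvd d" "p dvd e" | "p dvd d" "p dvd t" | "p dvd s" "p dvd e" | "p dvd s" "p dvd t" by blast
    then show False
    proof cases
      case 1 then show ?thesis using squarefree_prime_factors[OF N' p(1)] by blast
    next
      case 2
      then show ?thesis using prim[OF p(1)] a b st u3 by (simp add: power2_eq_square)
    next
      case 3
      then have "p dvd a" using st by (simp add: power2_eq_square)
      then show ?thesis using 3 ae p(1) by (meson coprime_common_divisor_nat not_prime_1 coprime_def not_prime_unit)
    next
      case 4
      then have "p dvd a" "p dvd b" using st by (simp_all add: power2_eq_square)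
      then show ?thesis using cab p(1) by (meson coprime_def not_prime_unit)
    qed
  qed
  then show ?thesis using e a b st u3 by blast
qed

lemma al_mat_exists:
  assumes N: "squarefree N" "N = d * e" and cop: "coprime (int d * s) (int e * t)"
  shows "\<exists>x y. al_mat d e s t x y \<in> Gamma_hat N"
proof -
  obtain u v where "u * (int d * s) + v * (int e * t) = gcd (int d * s) (int e * t)"
    using bezout_int by blast
  then have "int d * s * u - int e * t * (- v) = 1" using cop by (simp add: mult_ac)
  then show ?thesis using al_mat_Gamma[OF N] by blast
qed

text \<open>The ternary counterpart of \<open>primitive_image_exists\<close>: an integral matrix
  with columns \<open>a2\<close>, \<open>a3\<close>, \<open>a4\<close>, nonzero modulo each prime of
  k, gets an isotropic vector with image nonzero modulo these primes. The coprimality condition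
  makes the vector a column of some \<open>al_mat\<close>.\<close>

lemma isotropic_column_exists:
  fixes a2 a3 a4 :: "'i \<Rightarrow> int"
  assumes N: "squarefree N" and k: "k > 0"
    and prim: "\<And>p. prime p \<Longrightarrow> p dvd k \<Longrightarrow> \<exists>i\<in>I. \<not> int p dvd a2 i \<or> \<not> int p dvd a3 i \<or> \<not> int p dvd a4 i"
  shows "\<exists>d e s t. N = d * e \<and> coprime (d * s) (e * t) \<and>
    (\<forall>p. prime p \<longrightarrow> p dvd k \<longrightarrow>
      (\<exists>i\<in>I. \<not> int p dvd a2 i * (int d * (int s)\<^sup>2) + a3 i * (int s * int t) + a4 i * (int e * (int t)\<^sup>2)))"
proof -
  note N0 = squarefree_pos[OF N]
  \<comment> \<open>d collects the primes of N and k modulo which \<open>a2\<close> and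
    \<open>a3\<close> vanish. There only the term \<open>a4 i * (int e * t^2)\<close> can survive,
    so such a prime must not divide e. Any other prime of N divides e and kills this term, but if it
    divides k then \<open>a2\<close> or \<open>a3\<close> is nonzero modulo it.\<close>
  define D where "D = gcd (int N) (gcd (int k) (Gcd (a2 ` I \<union> a3 ` I)))"
  define d where "d = nat D"
  have D0: "D > 0" using N0 by (simp add: D_def gcd_pos_int)
  have dD: "int d = D" using D0 by (simp add: d_def)
  have "int d dvd int N" unfolding dD D_def by simp
  then have "d dvd N" by simp
  then obtain e where e: "N = d * e" by blast
  have N': "squarefree (d * e)" using N e by simp
  have pd: "p dvd d \<longleftrightarrow> p dvd N \<and> p dvd k \<and> (\<forall>i\<in>I. int p dvd a2 i \<and> int p dvd a3 i)" for p
  proof -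
    have "p dvd d \<longleftrightarrow> int p dvd D" unfolding dD[symmetric] by simp
    also have "\<dots> \<longleftrightarrow> int p dvd int N \<and> int p dvd int k \<and> (\<forall>x\<in>a2 ` I \<union> a3 ` I. int p dvd x)"
      unfolding D_def gcd_greatest_iff dvd_Gcd_iff by blast
    finally show ?thesis by auto
  qed
  let ?W = "\<lambda>i s t. a2 i * (int d * s\<^sup>2) + a3 i * (s * t) + a4 i * (int e * t\<^sup>2)"
  let ?P = "{p. prime p \<and> p dvd k * N}"
  have finP: "finite {p. prime p \<and> p dvd m}" if "m > 0" for m :: nat
    using that by (auto intro: finite_subset[of _ "{..m}"] dest: dvd_imp_le)
  \<comment> \<open>Residues 0 and 1 suffice. The conditions at the primes of e and d, and the
    requirement that s or t is 1, keep \<open>d * s\<close> and \<open>e * t\<close> coprime after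
    gluing.\<close>
  have loc: "\<exists>s t :: nat. (p dvd k \<longrightarrow> (\<exists>i\<in>I. \<not> int p dvd ?W i (int s) (int t))) \<and>
      (p dvd e \<longrightarrow> s = 1) \<and> (p dvd d \<longrightarrow> t = 1) \<and> (s = 1 \<or> t = 1)" if p: "prime p" for p
  proof (cases "p dvd k")
    case False
    then show ?thesis by (intro exI[of _ 1]) auto
  next
    case True
    have ip: "prime (int p)" using p by simp
    obtain i where i: "i \<in> I" "\<not> int p dvd a2 i \<or> \<not> int p dvd a3 i \<or> \<not> int p dvd a4 i"
      using prim[OF p True] by blast
    show ?thesis
    proof (cases "p dvd d")
      case pd1: True
      then have pe: "\<not> int p dvd int e" using squarefree_prime_factors[OF N' p] by auto
      have "\<not> int p dvd a4 i" using pd1 i unfolding pd by blast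
      then have "\<not> int p dvd ?W i (int 0) (int 1)"
        using pe ip by (simp add: prime_dvd_mult_iff)
      then show ?thesis using i(1) pe by (intro exI[of _ 0] exI[of _ 1]) auto
    next
      case pd0: False
      then have pd': "\<not> int p dvd int d" by simp
      show ?thesis
      proof (cases "\<exists>i\<in>I. \<not> int p dvd a2 i")
        case True
        then obtain j where j: "j \<in> I" "\<not> int p dvd a2 j" by blast
        then have "\<not> int p dvd ?W j (int 1) (int 0)"
          using pd' ip by (simp add: prime_dvd_mult_iff)
        then show ?thesis using j(1) pd0 by (intro exI[of _ 1] exI[of _ 0]) auto
      next
        case a2: False
        then have a2': "int p dvd a2 j" if "j \<in> I" for j using that by blast
        have add: "\<not> int p dvd ?W j (int 1) (int 1)" if j: "j \<in> I" "\<not> int p dvd a3 j" "int p dvd a4 j * int e" for j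
        proof
          assume "int p dvd ?W j (int 1) (int 1)"
          then have "int p dvd ?W j (int 1) (int 1) - a2 j * int d - a4 j * int e"
            using a2'[OF j(1)] j(3) by (intro dvd_diff) auto
          then show False using j(2) by simp
        qed
        show ?thesis
        proof (cases "p dvd e")
          case True
          then have "p dvd N" using e by simp
          then obtain j where j: "j \<in> I" "\<not> int p dvd a3 j" using pd0 a2' \<open>p dvd k\<close> unfolding pd by blast
          moreover have "int p dvd a4 j * int e" using True by simp
          ultimately have "\<not> int p dvd ?W j (int 1) (int 1)" by (rule add)
          then show ?thesis using j(1) by (intro exI[of _ 1]) blast
        next
          case False
          then have pe: "\<not> int p dvd int e" by simp
          show ?thesis
          proof (cases "\<exists>i\<in>I. \<not> int p dvd a4 i")
            case True
            then obtain j where j: "j \<in> I" "\<not> int p dvd a4 j" by blast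
            then have "\<not> int p dvd ?W j (int 0) (int 1)"
              using pe ip by (simp add: prime_dvd_mult_iff)
            then show ?thesis using j(1) False by (intro exI[of _ 0] exI[of _ 1]) auto
          next
            case a4: False
            then have "\<not> int p dvd a3 i" "int p dvd a4 i * int e" using i a2' by auto
            then have "\<not> int p dvd ?W i (int 1) (int 1)" using i(1) by (intro add)
            then show ?thesis using i(1) by (intro exI[of _ 1]) blast
          qed
        qed
      qed
    qed
  qed
  then obtain f g :: "nat \<Rightarrow> nat" where fg:
    "\<And>p. prime p \<Longrightarrow> (p dvd k \<longrightarrow> (\<exists>i\<in>I. \<not> int p dvd ?W i (int (f p)) (int (g p)))) \<and>
      (p dvd e \<longrightarrow> f p = 1) \<and> (p dvd d \<longrightarrow> g p = 1) \<and> (f p = 1 \<or> g p = 1)"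
    by metis
  have P0: "k * N > 0" using k N0 by simp
  obtain t0 where t0: "\<forall>p\<in>?P. [int t0 = int (g p)] (mod int p)" using crt_primes[OF finP[OF P0]] by blast
  \<comment> \<open>Adding \<open>k * N\<close> keeps all residues and makes t positive, so that t
    has only finitely many prime factors.\<close>
  define t where "t = t0 + k * N"
  have t: "[int t = int (g p)] (mod int p)" if "p \<in> ?P" for p
  proof -
    have "[int t0 + int (k * N) = int (g p) + 0] (mod int p)"
      using that t0 by (intro cong_add) (auto simp: cong_0_iff simp del: of_nat_mult)
    then show ?thesis by (simp add: t_def)
  qed
  have t1: "t > 0" using P0 by (simp add: t_def)
  let ?Q = "{p. prime p \<and> p dvd k * N * t}"
  \<comment> \<open>At primes of t outside \<open>k * N\<close> the residue 1 is prescribed for s,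
    so that s stays coprime to t.\<close>
  define f' where "f' p = (if p dvd k * N then f p else 1)" for p
  have "k * N * t > 0" using P0 t1 by simp
  then obtain s where s: "\<forall>p\<in>?Q. [int s = int (f' p)] (mod int p)" using crt_primes[OF finP] by blast
  have not0: "\<not> p dvd x" if "prime p" "[int x = int 1] (mod int p)" for p x :: nat
    using that by (metis cong_dvd_iff int_dvd_int_iff not_prime_unit)
  have sP: "[int s = int (f p)] (mod int p)" if "p \<in> ?P" for p
    using s that by (auto simp: f'_def)
  have "coprime (d * s) (e * t)"
  proof (rule coprime_if_no_prime)
    fix p assume p: "prime p" "p dvd d * s" "p dvd e * t"
    have "p dvd d \<or> p dvd s" "p dvd e \<or> p dvd t" using p prime_dvd_mult_iff by blast+
    then consider "p dvd d" "p dvd e" | "p dvd d" "p dvd t" | "p dvd s" "p dvd e" | "p dvd s" "p dvd t" by blast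
    then show False
    proof cases
      case 1 then show ?thesis using squarefree_prime_factors[OF N' p(1)] by blast
    next
      case 2
      then have "p \<in> ?P" "g p = 1" using p e fg[OF p(1)] by auto
      then show ?thesis using not0[OF p(1)] t[of p] 2 by metis
    next
      case 3
      then have "p \<in> ?P" "f p = 1" using p e fg[OF p(1)] by auto
      then show ?thesis using not0[OF p(1)] sP[of p] 3 by metis
    next
      case 4
      show ?thesis
      proof (cases "p dvd k * N")
        case True
        then have "p \<in> ?P" using p by simp
        then show ?thesis using fg[OF p(1)] t[of p] sP[of p] not0[OF p(1)] 4 by metis
      next
        case False
        then have "p \<in> ?Q" "f' p = 1" using p 4 by (auto simp: f'_def)
        then show ?thesis using s not0[OF p(1)] 4 by metis
      qed
    qed
  qed
  moreover have "\<exists>i\<in>I. \<not> int p dvd ?W i (int s) (int t)" if p: "prime p" "p dvd k" for p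
  proof -
    obtain i where i: "i \<in> I" "\<not> int p dvd ?W i (int (f p)) (int (g p))" using fg[OF p(1)] p(2) by blast
    have "p \<in> ?P" using p by simp
    then have "[?W i (int s) (int t) = ?W i (int (f p)) (int (g p))] (mod int p)"
      using sP t by (intro cong_add cong_mult cong_pow cong_refl) auto
    then show ?thesis using i cong_dvd_iff by blast
  qed
  ultimately show ?thesis using e by blast
qed

section \<open>Diagonalizing the ternary block\<close>

definition block_int_scaled :: "real \<Rightarrow> real^5^5 \<Rightarrow> bool" where
  "block_int_scaled c h \<longleftrightarrow> (\<forall>i\<in>{2, 3, 4}. \<forall>j\<in>{2, 3, 4}. c * h$i$j \<in> \<int>)"

lemma block_int_scaledD:
  "block_int_scaled c h \<Longrightarrow> i \<in> {2, 3, 4} \<Longrightarrow> j \<in> {2, 3, 4} \<Longrightarrow> c * h$i$j \<in> \<int>"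
  unfolding block_int_scaled_def by blast

lemma block_mult: "block x A \<Longrightarrow> block y B \<Longrightarrow> block (x * y) (A ** B)"
  by (simp add: block_def forall_5 matrix_matrix_mult_def sum_5)

lemma block_al_mat: "block 1 (al_mat d e s t x y)"
  by (simp add: block_def forall_5 al_mat_def)

lemma block_adj: "N > 0 \<Longrightarrow> block 1 A \<Longrightarrow> block 1 (adj N A)"
  by (simp add: block_def forall_5 adj_entries)

lemma block_mult_entry:
  assumes "block x A" "i \<in> {2, 3, 4}"
  shows "(A ** B)$i$j = A$i$2 * B$2$j + A$i$3 * B$3$j + A$i$4 * B$4$j"
  using assms by (auto simp: block_def forall_5 matrix_matrix_mult_def sum_5)

lemma block_int_scaled_mult:
  assumes "block x A" "block_int_scaled c A" "block_int_scaled d B"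
  shows "block_int_scaled (c * d) (A ** B)"
  unfolding block_int_scaled_def
proof (intro ballI)
  fix i j :: 5 assume i: "i \<in> {2, 3, 4}" and j: "j \<in> {2, 3, 4}"
  have m: "(c * A$i$k) * (d * B$k$j) \<in> \<int>" if "k \<in> {2, 3, 4}" for k
    by (rule Ints_mult) (use assms i j that in \<open>simp_all only: block_int_scaled_def\<close>)
  have "c * d * (A ** B)$i$j = (c * A$i$2) * (d * B$2$j) + (c * A$i$3) * (d * B$3$j) + (c * A$i$4) * (d * B$4$j)"
    unfolding block_mult_entry[OF assms(1) i] by (simp add: algebra_simps)
  also have "\<dots> \<in> \<int>" using m[of 2] m[of 3] m[of 4] by (intro Ints_add) simp_all
  finally show "c * d * (A ** B)$i$j \<in> \<int>" .
qed

lemma block_row_third: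
  assumes N: "squarefree N" and h: "h \<in> orth N" "block x h" "block_int_scaled c h" and i: "i = 2 \<or> i = 4"
  shows "c * h$i$3 / (2 * real N) \<in> \<int>"
proof (rule isotropic_third_coordinate[OF N row_isotropic[OF N h(1)]])
  have "h$i$1 = 0" "h$i$5 = 0" using h(2) i by (auto simp: block_def forall_5)
  then show "c * h$i$1 \<in> \<int>" "c * h$i$5 \<in> \<int>" by simp_all
qed (use h(3) i in \<open>auto simp: block_int_scaled_def\<close>)

lemma block_int_scaled_adj:
  assumes N: "squarefree N" and h: "h \<in> orth N" "block x h" "block_int_scaled c h"
  shows "block_int_scaled c (adj N h)"
proof -
  have e: "c * h$i$j \<in> \<int>" if "i \<in> {2, 3, 4}" "j \<in> {2, 3, 4}" for i j
    using h(3) that by (simp only: block_int_scaled_def)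
  have m: "c * (2 * real N * h$i$j) \<in> \<int>" if "i \<in> {2, 3, 4}" "j \<in> {2, 3, 4}" for i j
  proof -
    have "(2 * real N) * (c * h$i$j) \<in> \<int>" by (rule Ints_mult[OF _ e[OF that]]) simp
    then show ?thesis by (simp add: mult_ac)
  qed
  show ?thesis
    unfolding block_int_scaled_def adj_entries[OF squarefree_pos[OF N]]
    using block_row_third[OF N h, of 2] block_row_third[OF N h, of 4] e m by simp
qed

lemma Gamma_block_int: "A \<in> Gamma_hat N \<Longrightarrow> block_int_scaled 1 A"
  by (simp add: Gamma_iff int_scaled_def block_int_scaled_def)

text \<open>Since w2 w4 is nonnegative, w2 and w4 share a sign \<epsilon>; the sign of w3 is
  absorbed into t.\<close>

lemma isotropic_parametrization:
  fixes w2 w3 w4 :: int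
  assumes N: "squarefree N" and q: "w2 * w4 = int N * w3\<^sup>2"
    and prim: "\<And>p. prime p \<Longrightarrow> int p dvd w2 \<Longrightarrow> int p dvd w3 \<Longrightarrow> int p dvd w4 \<Longrightarrow> False"
  shows "\<exists>\<epsilon> d e s t. (\<epsilon> = 1 \<or> \<epsilon> = -1) \<and> N = d * e \<and> coprime (int d * s) (int e * t) \<and>
    w2 = \<epsilon> * (int d * s\<^sup>2) \<and> w3 = \<epsilon> * (s * t) \<and> w4 = \<epsilon> * (int e * t\<^sup>2)"
proof -
  have "int (nat \<bar>w2\<bar> * nat \<bar>w4\<bar>) = int (N * (nat \<bar>w3\<bar>)\<^sup>2)"
    using arg_cong[OF q, of abs] by (simp add: abs_mult power_abs)
  then have q': "nat \<bar>w2\<bar> * nat \<bar>w4\<bar> = N * (nat \<bar>w3\<bar>)\<^sup>2" by (simp only: of_nat_eq_iff)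
  have "\<exists>d e s t. N = d * e \<and> nat \<bar>w2\<bar> = d * s\<^sup>2 \<and> nat \<bar>w3\<bar> = s * t \<and> nat \<bar>w4\<bar> = e * t\<^sup>2 \<and> coprime (d * s) (e * t)"
    by (rule isotropic_parametrization_nat[OF N q']) (use prim in \<open>auto simp: int_dvd_int_iff[symmetric] simp del: int_dvd_int_iff\<close>)
  then obtain d e s t where st: "N = d * e" "nat \<bar>w2\<bar> = d * s\<^sup>2" "nat \<bar>w3\<bar> = s * t" "nat \<bar>w4\<bar> = e * t\<^sup>2" "coprime (d * s) (e * t)"
    by blast
  have a: "\<bar>w2\<bar> = int d * (int s)\<^sup>2" "\<bar>w3\<bar> = int s * int t" "\<bar>w4\<bar> = int e * (int t)\<^sup>2"
    using arg_cong[OF st(2), of int] arg_cong[OF st(3), of int] arg_cong[OF st(4), of int] by simp_all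
  have cop: "coprime (int d * int s) (int e * int t)" using st(5) by (metis coprime_int_iff of_nat_mult)
  then have cop': "coprime (int d * int s) (int e * (- int t))" by simp
  have pos: "w2 * w4 \<ge> 0" unfolding q by simp
  define \<epsilon> :: int where "\<epsilon> = (if w2 \<ge> 0 \<and> w4 \<ge> 0 then 1 else -1)"
  have \<epsilon>: "\<epsilon> = 1 \<or> \<epsilon> = -1" by (simp add: \<epsilon>_def)
  have w24: "w2 = \<epsilon> * \<bar>w2\<bar>" "w4 = \<epsilon> * \<bar>w4\<bar>" using pos by (auto simp: \<epsilon>_def zero_le_mult_iff)
  show ?thesis
  proof (cases "\<epsilon> * w3 \<ge> 0")
    case True
    then have "w3 = \<epsilon> * \<bar>w3\<bar>" using \<epsilon> by auto
    then show ?thesis using w24 a cop \<epsilon> st(1) by metis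
  next
    case False
    then have "w3 = \<epsilon> * - \<bar>w3\<bar>" using \<epsilon> by auto
    then have "w3 = \<epsilon> * (int s * (- int t))" "w4 = \<epsilon> * (int e * (- int t)\<^sup>2)" using a w24 by simp_all
    then show ?thesis using w24(1) a(1) cop' \<epsilon> st(1) by metis
  qed
qed

text \<open>The ternary counterpart of \<open>block_of_first_column\<close>. It leaves diag(1/x,
  \<epsilon>/k, y, \<epsilon> k, x); the determinant settles y and the identity component settles
  \<epsilon>.\<close>

lemma torus_of_second_column:
  assumes N: "squarefree N" and h: "h \<in> SO0_hat N" "block x h" "block_int_scaled k h"
    and x: "x > 0" and k: "k > 0" and eps: "\<epsilon> = 1 \<or> \<epsilon> = (-1::int)"
    and col: "\<And>i. h$i$2 = (if i = 2 then of_int \<epsilon> / k else 0)"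
  shows "\<exists>B\<in>Gamma_hat N. h ** B = torus x k"
proof -
  note N0 = squarefree_pos[OF N]
  have eps2: "real_of_int \<epsilon> * real_of_int \<epsilon> = 1" "real_of_int \<epsilon> \<noteq> 0" using eps by auto
  have "k * h$2$3 / (2 * real N) \<in> \<int>" by (rule block_row_third[OF N SO0_orth[OF h(1)] h(2,3)]) simp
  then obtain r where r: "k * h$2$3 / (2 * real N) = of_int r" by (rule Ints_cases)
  have h23: "h$2$3 = 2 * real N * of_int r / k" using r k N0 by (simp add: field_simps)
  \<comment> \<open>This is unipotent and fixes e2; its second row is (0, 1, 2N y, N y^2, 0). The
    value y = -\<epsilon> r cancels the (2, 3) entry because \<epsilon>^2 = 1.\<close>
  define B where "B = al_mat 1 N 1 0 1 (- \<epsilon> * r)"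
  have B: "B \<in> Gamma_hat N" unfolding B_def by (rule al_mat_Gamma[OF N]) auto
  define g where "g = h ** B"
  have g0: "g \<in> SO0_hat N" unfolding g_def by (rule SO0_mult[OF N0 h(1) Gamma_SO0[OF B]])
  then have g: "g \<in> orth N" by (rule SO0_orth)
  have "block (x * 1) g" unfolding g_def B_def by (intro block_mult h(2) block_al_mat)
  then have gb: "block x g" by simp
  have g2: "g$i$2 = (if i = 2 then of_int \<epsilon> / k else 0)" for i
    using col[of i] by (simp add: g_def B_def al_mat_def matrix_matrix_mult_def sum_5)
  have g23: "g$2$3 = 0"
    using eps2 col[of 2] h23
    by (simp add: g_def B_def al_mat_def matrix_matrix_mult_def sum_5)
  have z: "g$1$2 = 0" "g$1$3 = 0" "g$1$4 = 0" "g$1$5 = 0" "g$2$1 = 0" "g$3$1 = 0" "g$4$1 = 0" "g$5$1 = 0"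
     "g$5$2 = 0" "g$5$3 = 0" "g$5$4 = 0" "g$2$5 = 0" "g$3$5 = 0" "g$4$5 = 0" "g$1$1 = 1 / x" "g$5$5 = x"
    using gb by (simp_all add: block_def forall_5)
  have "2 * (g$2$1 * g$2$5 + g$2$2 * g$2$4) = g$2$3 * g$2$3 / (2 * real N)"
    by (rule row_isotropic[OF N g]) simp
  then have g24: "g$2$4 = 0" using z g2[of 2] g23 eps2 k by simp
  have col2: "of_int \<epsilon> / k * g$4$j = S_hat N $ 2 $ j" for j
  proof -
    have "bil N (column 2 g) (column j g) = S_hat N $ 2 $ j" using g by (simp only: orth_iff)
    then show ?thesis by (simp add: bil_def column_def g2)
  qed
  have g43: "g$4$3 = 0" using col2[of 3] eps2 k by (simp add: S_hat_def)
  have g44: "g$4$4 = of_int \<epsilon> * k"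
    using col2[of 4] eps k by (auto simp: S_hat_def field_simps)
  have "bil' N (g$2) (g$3) = S_inv N $ 2 $ 3" by (rule orth_rows[OF N0 g])
  then have g34: "g$3$4 = 0" using eps2 k by (simp add: bil'_def g2 z g23 g24 S_inv_def)
  define y where "y = g$3$3"
  have gd: "g = diag5 (1 / x) (of_int \<epsilon> / k) y (of_int \<epsilon> * k) x"
    by (simp add: vec_eq_iff forall_5 diag5_def z g2 g23 g24 g43 g44 g34 y_def)
  have "det g = (\<Prod>i\<in>UNIV. g$i$i)"
  proof (rule det_diagonal)
    fix i j :: 5 assume "i \<noteq> j"
    then show "g$i$j = 0" unfolding gd using exhaust_5[of i] exhaust_5[of j] by (auto simp: diag5_def)
  qed
  also have "\<dots> = y" unfolding gd UNIV_5 using x k eps2 by (simp add: diag5_def)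
  finally have y: "y = 1" using SO0_det[OF g0] by simp
  \<comment> \<open>The sign \<epsilon> = -1 is compatible with determinant 1, but it would make
    \<open>plane_det\<close> negative.\<close>
  have "plane_det g = (1 / x + x) * (of_int \<epsilon> * (1 / k + k))"
    unfolding gd by (simp add: plane_det_def diag5_def algebra_simps)
  then have pd: "(1 / x + x) * (of_int \<epsilon> * (1 / k + k)) > 0" using plane_det_pos[OF g0] by simp
  moreover have "1 / x + x > 0" "1 / k + k > 0" using x k by (simp_all add: add_pos_pos)
  ultimately have "real_of_int \<epsilon> > 0" by (simp add: zero_less_mult_iff)
  then have "\<epsilon> = 1" using eps by auto
  then have "h ** B = torus x k" unfolding g_def[symmetric] gd y torus_def by simp
  then show ?thesis using B by blast
qed

text \<open>The argument of \<open>block_reduction\<close> repeated with the least denominator k of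
  the middle block. That k divides M is what makes M / k available as first component of the
  pair.\<close>

lemma torus_reduction:
  assumes N: "squarefree N" and h: "h \<in> SO0_hat N" "block (real M) h" "int_scaled (real M) h" and M: "M > 0"
  shows "\<exists>A\<in>Gamma_hat N. \<exists>B\<in>Gamma_hat N. \<exists>k>0. k dvd M \<and> A ** h ** B = torus (real M) (real k)"
proof -
  note N0 = squarefree_pos[OF N]
  define Q where "Q c \<longleftrightarrow> c > 0 \<and> block_int_scaled (real c) h" for c :: nat
  define k where "k = (LEAST c. Q c)"
  have QM: "Q M" using M h(3) by (simp add: Q_def int_scaled_def block_int_scaled_def)
  then have "Q k" unfolding k_def by (rule LeastI)
  then have k: "k > 0" "block_int_scaled (real k) h" by (auto simp: Q_def)
  have least: "c = 0" if "c < k" "block_int_scaled (real c) h" for c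
    using that not_less_Least[of c Q] unfolding k_def Q_def by auto
  have kM: "k dvd M"
  proof -
    \<comment> \<open>The remainder also clears the denominators of the block; being less than the
      least positive such factor, it must be 0.\<close>
    have "block_int_scaled (real (M mod k)) h"
      unfolding block_int_scaled_def
    proof (intro ballI)
      fix i j :: 5 assume ij: "i \<in> {2, 3, 4}" "j \<in> {2, 3, 4}"
      have "real M = real (M div k) * real k + real (M mod k)"
        by (metis div_mult_mod_eq of_nat_add of_nat_mult)
      then have e: "real (M mod k) * h$i$j = real M * h$i$j - real (M div k) * (real k * h$i$j)"
        by (simp add: algebra_simps)
      have "real (M div k) * (real k * h$i$j) \<in> \<int>"
        by (rule Ints_mult[OF _ block_int_scaledD[OF k(2) ij]]) simp
      moreover have "real M * h$i$j \<in> \<int>" using h(3) by (simp add: int_scaled_def)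
      ultimately show "real (M mod k) * h$i$j \<in> \<int>" unfolding e by (intro Ints_diff)
    qed
    then have "M mod k = 0" using least k(1) by simp
    then show ?thesis by auto
  qed
  have "\<forall>i j. \<exists>a. i \<in> {2, 3, 4} \<longrightarrow> j \<in> {2, 3, 4} \<longrightarrow> real_of_int a = real k * h$i$j"
    using k(2) unfolding block_int_scaled_def by (metis Ints_cases)
  then obtain A where A: "\<And>i j. i \<in> {2, 3, 4} \<Longrightarrow> j \<in> {2, 3, 4} \<Longrightarrow> real_of_int (A i j) = real k * h$i$j" by metis
  have prim: "\<exists>i\<in>{2, 3, 4}. \<not> int p dvd A i 2 \<or> \<not> int p dvd A i 3 \<or> \<not> int p dvd A i 4" if p: "prime p" "p dvd k" for p
  proof (rule ccontr)
    assume "\<not> ?thesis"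
    then have all: "int p dvd A i j" if "i \<in> {2, 3, 4}" "j \<in> {2, 3, 4}" for i j using that by blast
    obtain c where c: "k = p * c" using p by blast
    have p1: "p > 1" using p prime_gt_1_nat by blast
    have c0: "c > 0" "c < k" using c k(1) p1 by auto
    have "block_int_scaled (real c) h"
      unfolding block_int_scaled_def
    proof (intro ballI)
      fix i j :: 5 assume ij: "i \<in> {2, 3, 4}" "j \<in> {2, 3, 4}"
      have "real c * h$i$j = real_of_int (A i j) / real p" using A[OF ij] c p1 by simp
      then show "real c * h$i$j \<in> \<int>" using all[OF ij] of_int_div_Ints[of p "A i j"] p1 by simp
    qed
    then show False using least[OF c0(2)] c0(1) by blast
  qed
  obtain d e s t where st: "N = d * e" "coprime (d * s) (e * t)"
    "\<And>p. prime p \<Longrightarrow> p dvd k \<Longrightarrow> \<exists>i\<in>{2, 3, 4}. \<not> int p dvd A i 2 * (int d * (int s)\<^sup>2) +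
        A i 3 * (int s * int t) + A i 4 * (int e * (int t)\<^sup>2)"
    using isotropic_column_exists[OF N k(1) prim] by blast
  have "coprime (int d * int s) (int e * int t)" using st(2) by (metis coprime_int_iff of_nat_mult)
  then obtain x y where B0: "al_mat d e (int s) (int t) x y \<in> Gamma_hat N"
    using al_mat_exists[OF N st(1)] by blast
  define B where "B = al_mat d e (int s) (int t) x y"
  have B: "B \<in> Gamma_hat N" "block 1 B" using B0 block_al_mat by (simp_all add: B_def)
  have B2: "B$2$2 = real d * (real s)\<^sup>2" "B$3$2 = real s * real t" "B$4$2 = real e * (real t)\<^sup>2"
    by (simp_all add: B_def al_mat_def)
  define g where "g = h ** B"
  have gs: "g \<in> SO0_hat N" unfolding g_def by (rule SO0_mult[OF N0 h(1) Gamma_SO0[OF B(1)]])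
  have gb: "block (real M) g" unfolding g_def using block_mult[OF h(2) B(2)] by simp
  define W where "W i = A i 2 * (int d * (int s)\<^sup>2) + A i 3 * (int s * int t) + A i 4 * (int e * (int t)\<^sup>2)" for i
  have W: "real k * g$i$2 = of_int (W i)" if "i \<in> {2, 3, 4}" for i
  proof -
    have "real k * g$i$2 = real k * h$i$2 * B$2$2 + real k * h$i$3 * B$3$2 + real k * h$i$4 * B$4$2"
      unfolding g_def block_mult_entry[OF h(2) that] by (simp add: algebra_simps)
    then show ?thesis using A[OF that, of 2] A[OF that, of 3] A[OF that, of 4] by (simp add: B2 W_def)
  qed
  have Wprim: False if p: "prime p" and dvd: "int p dvd W 2" "int p dvd W 3" "int p dvd W 4" for p
  proof (cases "p dvd k")
    case True
    then show ?thesis using st(3)[OF p True] dvd unfolding W_def by auto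
  next
    case False
    have p0: "p > 0" using p prime_gt_0_nat by blast
    have ah: "block_int_scaled (real k) (adj N h)" by (rule block_int_scaled_adj[OF N SO0_orth[OF h(1)] h(2) k(2)])
    \<comment> \<open>Going back with k times the inverse of \<open>h\<close>, a prime p that
      divides \<open>W\<close> but not k would divide the second column of \<open>B\<close>, hence
      both d s^2 and e t^2.\<close>
    have "adj N h ** g = B"
      unfolding g_def matrix_mul_assoc using adj_left[OF N0 SO0_orth[OF h(1)]] by simp
    then have Bi: "B$i$2 = (\<Sum>j\<in>UNIV. adj N h$i$j * g$j$2)" for i
      by (auto simp: matrix_matrix_mult_def)
    have div: "real k * real k * B$i$2 / real p \<in> \<int>" if i: "i \<in> {2, 3, 4}" for i
    proof -
      have z: "g$1$2 = 0" "g$5$2 = 0" using gb by (simp_all add: block_def forall_5)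
      have "real k * real k * B$i$2 / real p = (real k * adj N h$i$2) * (real k * g$2$2 / real p)
         + (real k * adj N h$i$3) * (real k * g$3$2 / real p) + (real k * adj N h$i$4) * (real k * g$4$2 / real p)"
        unfolding Bi sum_5 using z by (simp add: add_divide_distrib algebra_simps)
      moreover have "real k * g$j$2 / real p \<in> \<int>" if "j \<in> {2, 3, 4}" for j
        unfolding W[OF that] using that dvd of_int_div_Ints[OF p0] by auto
      then have "(real k * adj N h$i$j) * (real k * g$j$2 / real p) \<in> \<int>" if "j \<in> {2, 3, 4}" for j
        using Ints_mult[OF block_int_scaledD[OF ah i that]] that by blast
      ultimately show ?thesis by (simp only: Ints_add insertI1 insertI2)
    qed
    have np: "p dvd z" if "real k * real k * real z / real p \<in> \<int>" for z
    proof -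
      have "real_of_int (int (k * k * z)) / real p \<in> \<int>" using that by simp
      then have "int p dvd int (k * k * z)" using of_int_div_Ints[OF p0] by blast
      then have "p dvd k * k * z" by (simp only: int_dvd_int_iff)
      then show ?thesis using False p by (simp add: prime_dvd_mult_iff)
    qed
    have "p dvd d * s\<^sup>2" "p dvd e * t\<^sup>2"
      using div[of 2] div[of 4] by (auto intro!: np simp: B2)
    then have "p dvd d * s" "p dvd e * t" using p by (auto simp: prime_dvd_mult_iff prime_dvd_power_iff)
    then show False using st(2) p by (meson coprime_def not_prime_unit)
  qed
  have Wq: "W 2 * W 4 = int N * (W 3)\<^sup>2"
  proof -
    have "bil N (column 2 g) (column 2 g) = S_hat N $ 2 $ 2" using SO0_orth[OF gs] by (simp only: orth_iff)
    then have "g$2$2 * g$4$2 = real N * (g$3$2 * g$3$2)"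
      using gb by (simp add: bil_def column_def S_hat_def block_def forall_5)
    then have "(real k * g$2$2) * (real k * g$4$2) = real N * ((real k * g$3$2) * (real k * g$3$2))"
      by (simp add: mult_ac)
    then have "real_of_int (W 2 * W 4) = real_of_int (int N * (W 3)\<^sup>2)"
      by (simp add: W power2_eq_square)
    then show ?thesis by (simp only: of_int_eq_iff)
  qed
  have "\<exists>\<epsilon> d e s t. (\<epsilon> = 1 \<or> \<epsilon> = -1) \<and> N = d * e \<and> coprime (int d * s) (int e * t) \<and>
    W 2 = \<epsilon> * (int d * s\<^sup>2) \<and> W 3 = \<epsilon> * (s * t) \<and> W 4 = \<epsilon> * (int e * t\<^sup>2)"
    by (rule isotropic_parametrization[OF N Wq]) (rule Wprim)
  then obtain \<epsilon> d' e' s' t' where p': "\<epsilon> = 1 \<or> \<epsilon> = (-1::int)" "N = d' * e'" "coprime (int d' * s') (int e' * t')"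
    "W 2 = \<epsilon> * (int d' * s'\<^sup>2)" "W 3 = \<epsilon> * (s' * t')" "W 4 = \<epsilon> * (int e' * t'\<^sup>2)"
    by (elim exE conjE) (rule that; assumption)
  obtain x' y' where C0: "al_mat d' e' s' t' x' y' \<in> Gamma_hat N" using al_mat_exists[OF N p'(2,3)] by blast
  \<comment> \<open>Its second column is \<epsilon> k times that of \<open>g\<close>, so the inverse
    of \<open>C\<close> turns the latter into \<epsilon>/k times e2.\<close>
  define C where "C = al_mat d' e' s' t' x' y'"
  have C: "C \<in> Gamma_hat N" "block 1 C" using C0 block_al_mat by (simp_all add: C_def)
  have gC: "g$i$2 = of_int \<epsilon> / real k * C$i$2" for i
  proof -
    have "real k * g$i$2 = of_int \<epsilon> * C$i$2" if "i \<in> {2, 3, 4}"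
      unfolding W[OF that] using that p'(4-6) by (auto simp: C_def al_mat_def)
    moreover have "g$1$2 = 0" "g$5$2 = 0" "C$1$2 = 0" "C$5$2 = 0" using gb C(2) by (simp_all add: block_def forall_5)
    ultimately have "real k * g$i$2 = of_int \<epsilon> * C$i$2" using exhaust_5[of i] by fastforce
    then show ?thesis using k(1) by (simp add: field_simps)
  qed
  define f where "f = adj N C ** g"
  have aC: "adj N C \<in> Gamma_hat N" by (rule Gamma_adj[OF N C(1)])
  have f0: "f \<in> SO0_hat N" unfolding f_def by (rule SO0_mult[OF N0 Gamma_SO0[OF aC] gs])
  have fb: "block (real M) f" unfolding f_def using block_mult[OF block_adj[OF N0 C(2)] gb] by simp
  have "block_int_scaled (real k * 1) g" unfolding g_def by (rule block_int_scaled_mult[OF h(2) k(2) Gamma_block_int[OF B(1)]])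
  then have fi: "block_int_scaled (real k) f"
    unfolding f_def using block_int_scaled_mult[OF block_adj[OF N0 C(2)] Gamma_block_int[OF aC], of "real k" g] by simp
  have f2: "f$i$2 = (if i = 2 then of_int \<epsilon> / real k else 0)" for i
  proof -
    have "f$i$2 = of_int \<epsilon> / real k * (adj N C ** C)$i$2"
      unfolding f_def matrix_matrix_mult_def by (simp add: gC sum_distrib_left mult_ac)
    then show ?thesis unfolding adj_left[OF N0 Gamma_orth[OF C(1)]] by (simp add: mat_def)
  qed
  obtain E where E: "E \<in> Gamma_hat N" "f ** E = torus (real M) (real k)"
    using torus_of_second_column[OF N f0 fb fi _ _ p'(1) f2] M k(1) by auto
  have "adj N C ** h ** (B ** E) = torus (real M) (real k)"
    using E(2) by (simp add: f_def g_def matrix_mul_assoc)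
  then show ?thesis using aC Gamma_mult[OF N B(1) E(1)] k(1) kM by blast
qed

lemma cartan_decomposition:
  assumes N: "squarefree N" and g: "g \<in> SO0_hat N" "rational_matrix g"
  shows "\<exists>s. pos_pair s \<and> (\<exists>A\<in>Gamma_hat N. \<exists>B\<in>Gamma_hat N. g = A ** D_mat s ** B)"
proof -
  note N0 = squarefree_pos[OF N]
  obtain A B M where 1: "A \<in> Gamma_hat N" "B \<in> Gamma_hat N" "M > 0"
    "int_scaled (real M) (A ** g ** B)" "block (real M) (A ** g ** B)"
    using block_reduction[OF N g] by blast
  have "A ** g ** B \<in> SO0_hat N" by (intro SO0_mult[OF N0] Gamma_SO0[OF 1(1)] Gamma_SO0[OF 1(2)] g(1))
  then obtain A' B' k where 2: "A' \<in> Gamma_hat N" "B' \<in> Gamma_hat N" "k > 0" "k dvd M"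
    "A' ** (A ** g ** B) ** B' = torus (real M) (real k)"
    using torus_reduction[OF N _ 1(5,4,3)] by blast
  define P Q where "P = A' ** A" and "Q = B ** B'"
  have P: "P \<in> Gamma_hat N" and Q: "Q \<in> Gamma_hat N" using 1 2 Gamma_mult[OF N] by (auto simp: P_def Q_def)
  have PgQ: "P ** g ** Q = torus (real M) (real k)" using 2(5) by (simp add: P_def Q_def matrix_mul_assoc)
  define s where "s = (M div k, k)"
  have "M div k > 0" using dvd_imp_le[OF 2(4) 1(3)] 2(3) by (simp add: div_greater_zero_iff)
  then have s: "pos_pair s" using 2(3) by (simp add: s_def pos_pair_def)
  have D: "D_mat s = P ** g ** Q"
    unfolding PgQ using 2(4) by (simp add: D_mat_def s_def entry_level_def)
  have "adj N P ** D_mat s ** adj N Q = (adj N P ** P) ** g ** (Q ** adj N Q)"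
    unfolding D by (simp add: matrix_mul_assoc)
  also have "\<dots> = g" using adj_left[OF N0 Gamma_orth[OF P]] adj_right[OF N0 Gamma_orth[OF Q]] by simp
  finally show ?thesis using s Gamma_adj[OF N P] Gamma_adj[OF N Q] by metis
qed

section \<open>The Hecke algebra\<close>

lemma pos_pair_times: "pos_pair s \<Longrightarrow> pos_pair t \<Longrightarrow> pos_pair (pair_times s t)"
  by (simp add: pos_pair_def pair_times_def)

lemma D_mat_times: "D_mat (pair_times s t) = D_mat s ** D_mat t"
proof -
  have "snd (pair_times s t) = snd s * snd t" by (simp add: pair_times_def)
  then show ?thesis
    by (simp add: D_mat_def level_times torus_def diag5_def vec_eq_iff forall_5
      matrix_matrix_mult_def sum_5)
qed

lemma D_mat_SO0: "N > 0 \<Longrightarrow> pos_pair s \<Longrightarrow> D_mat s \<in> SO0_hat N"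
  unfolding D_mat_def by (intro torus_SO0) (auto simp: level_pos pos_pair_def)

lemma D_mat_one: "D_mat (1, 1) = mat 1"
  by (simp add: D_mat_def entry_level_def torus_def diag5_def mat_1_5)

text \<open>The involution sending x to (-x5, -x4, x3, -x2, -x1), which inverts the torus under
  conjugation. Writing it as a product of \<open>left_mat\<close> and \<open>right_mat\<close> shows
  that it lies in the identity component.\<close>

definition weyl :: "real^5^5" where
  "weyl = left_mat 0 1 (-1) 0 ** right_mat 0 1 (-1) 0"

lemma weyl_Gamma: "squarefree N \<Longrightarrow> weyl \<in> Gamma_hat N"
  using Gamma_mult[OF _ left_mat_Gamma[of N 0 0 1 "-1"] right_mat_Gamma[of N 0 0 1 "-1"]]
  by (simp add: weyl_def)

lemma adj_D_mat:
  assumes "N > 0"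
  shows "adj N (D_mat s) = weyl ** D_mat s ** weyl"
  by (simp add: adj_entries[OF assms] D_mat_def torus_def diag5_def weyl_def left_mat_def right_mat_def
      vec_eq_iff forall_5 matrix_matrix_mult_def sum_5)

lemma adj_mult:
  assumes "N > 0" "A \<in> orth N" "B \<in> orth N"
  shows "adj N (A ** B) = adj N B ** adj N A"
proof -
  have "(adj N B ** adj N A) ** (A ** B) = adj N B ** (adj N A ** A) ** B"
    by (simp add: matrix_mul_assoc)
  also have "\<dots> = mat 1" using adj_left assms by simp
  finally have 1: "(adj N B ** adj N A) ** (A ** B) = mat 1" .
  have "adj N B ** adj N A = (adj N B ** adj N A) ** ((A ** B) ** adj N (A ** B))"
    using adj_right[OF assms(1) orth_mult[OF assms(2,3)]] by simp
  also have "\<dots> = adj N (A ** B)" using 1 by (simp add: matrix_mul_assoc)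
  finally show ?thesis ..
qed

lemma adj_double_coset:
  assumes N: "squarefree N" and s: "pos_pair s" and A: "A \<in> Gamma_hat N" and B: "B \<in> Gamma_hat N"
  shows "\<exists>A'\<in>Gamma_hat N. \<exists>B'\<in>Gamma_hat N. adj N (A ** D_mat s ** B) = A' ** D_mat s ** B'"
proof -
  note N0 = squarefree_pos[OF N]
  have D: "D_mat s \<in> orth N" by (rule SO0_orth[OF D_mat_SO0[OF N0 s]])
  have "adj N (A ** D_mat s ** B) = adj N B ** (adj N (D_mat s) ** adj N A)"
    by (simp add: adj_mult N0 orth_mult D Gamma_orth[OF A] Gamma_orth[OF B])
  also have "\<dots> = (adj N B ** weyl) ** D_mat s ** (weyl ** adj N A)"
    by (simp add: adj_D_mat[OF N0] matrix_mul_assoc)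
  finally show ?thesis
    using Gamma_mult[OF N Gamma_adj[OF N B] weyl_Gamma[OF N]] Gamma_mult[OF N weyl_Gamma[OF N] Gamma_adj[OF N A]]
    by blast
qed

lemma double_coset_int_scaled:
  assumes s: "pos_pair s" and A: "A \<in> Gamma_hat N" and B: "B \<in> Gamma_hat N"
  shows "int_scaled (real (entry_level s)) (A ** D_mat s ** B)"
    "minors_int_scaled (real (minor_level s)) (A ** D_mat s ** B)"
  using int_scaled_mult[OF int_scaled_mult[OF Gamma_int[OF A] D_mat_int_scaled[OF s]] Gamma_int[OF B]]
    minors_int_scaled_mult[OF minors_int_scaled_mult[OF int_scaled_minors[OF Gamma_int[OF A]] D_mat_minors[OF s]]
      int_scaled_minors[OF Gamma_int[OF B]]] by simp_all

lemma int_scaled_dvd: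
  assumes "squarefree N" "pos_pair s" "A \<in> Gamma_hat N" "B \<in> Gamma_hat N"
    "int_scaled (real c) (A ** D_mat s ** B)"
  shows "entry_level s dvd c"
proof -
  note N0 = squarefree_pos[OF assms(1)]
  have "adj N A ** (A ** D_mat s ** B) ** adj N B = (adj N A ** A) ** D_mat s ** (B ** adj N B)"
    by (simp add: matrix_mul_assoc)
  also have "\<dots> = D_mat s" using adj_left[OF N0 Gamma_orth[OF assms(3)]] adj_right[OF N0 Gamma_orth[OF assms(4)]] by simp
  finally have e: "adj N A ** (A ** D_mat s ** B) ** adj N B = D_mat s" .
  have "int_scaled (1 * real c * 1) (adj N A ** (A ** D_mat s ** B) ** adj N B)"
    by (intro int_scaled_mult assms(5) Gamma_int[OF Gamma_adj[OF assms(1,3)]] Gamma_int[OF Gamma_adj[OF assms(1,4)]])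
  then show ?thesis unfolding e using D_mat_int_scaled_dvd[OF assms(2)] by simp
qed

text \<open>Write \<open>a b = D\<close>. Then \<open>a = D b\<^sup>-\<^sup>1\<close> and \<open>b = a\<^sup>-\<^sup>1 D\<close> show that the lattice \<open>a \<int>\<^sup>5\<close> contains
  \<open>\<alpha> e\<^sub>5\<close> and \<open>\<alpha>\<^sup>-\<^sup>1 e\<^sub>1\<close>, where \<open>\<alpha>\<close> is the entry level of \<open>s\<close>. Pairing an arbitrary vector of the lattice with
  these in the \<open>2 \<times> 2\<close> minors controls its second and fourth coordinate, and the quadratic form,
  which is integral on the lattice, controls the third.\<close>
lemma extremal_factor:
  assumes N: "squarefree N" and s: "pos_pair s" and t: "pos_pair t"
    and a: "a \<in> SO0_hat N" "rational_matrix a" "int_scaled (real (entry_level s)) a"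
      "minors_int_scaled (real (minor_level s)) a"
    and b: "b \<in> SO0_hat N" "int_scaled (real (entry_level t)) b"
      "minors_int_scaled (real (minor_level t)) (adj N b)"
    and ab: "a ** b = D_mat (pair_times s t)"
  shows "adj N (D_mat s) ** a \<in> Gamma_hat N"
proof -
  note N0 = squarefree_pos[OF N]
  define \<alpha> \<beta> m n where "\<alpha> = real (entry_level s)" and "\<beta> = real (entry_level t)"
    and "m = real (snd s)" and "n = real (snd t)"
  have pos: "\<alpha> > 0" "\<beta> > 0" "m > 0" "n > 0"
    using s t level_pos by (auto simp: \<alpha>_def \<beta>_def m_def n_def pos_pair_def)
  have lev: "real (minor_level s) = \<alpha> * m" "real (minor_level t) = \<beta> * n"
    by (simp_all add: \<alpha>_def \<beta>_def m_def n_def minor_level_def entry_level_def power2_eq_square)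
  have D: "D_mat (pair_times s t) = diag5 (1 / (\<alpha> * \<beta>)) (1 / (m * n)) 1 (m * n) (\<alpha> * \<beta>)"
    by (simp add: D_mat_def torus_def level_times \<alpha>_def \<beta>_def m_def n_def) (simp add: pair_times_def)
  have "a ** (b ** adj N b) = D_mat (pair_times s t) ** adj N b"
    unfolding ab[symmetric] by (simp add: matrix_mul_assoc)
  then have aD: "a = D_mat (pair_times s t) ** adj N b" using adj_right[OF N0 SO0_orth[OF b(1)]] by simp
  have a4: "a$4$j = m * n * adj N b$4$j" and a5: "a$5$j = \<alpha> * \<beta> * adj N b$5$j" for j
    by (subst aD, simp add: D diag5_def matrix_matrix_mult_def sum_5)+
  have "(adj N a ** a) ** b = adj N a ** D_mat (pair_times s t)"
    unfolding ab[symmetric] by (simp add: matrix_mul_assoc)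
  then have bD: "b = adj N a ** D_mat (pair_times s t)" using adj_left[OF N0 SO0_orth[OF a(1)]] by simp
  have b1: "b$j$1 = adj N a$j$1 / (\<alpha> * \<beta>)" for j
    by (subst bD, simp add: D diag5_def matrix_matrix_mult_def sum_5)
  have adja: "int_scaled \<alpha> (adj N a)" unfolding \<alpha>_def by (rule int_scaled_adj[OF N SO0_orth[OF a(1)] a(3)])
  have adjb: "int_scaled \<beta> (adj N b)" unfolding \<beta>_def by (rule int_scaled_adj[OF N SO0_orth[OF b(1)] b(2)])
  have one: "(\<Sum>k\<in>UNIV. a$i$k * adj N a$k$j) = (if i = j then 1 else 0)" for i j
    using arg_cong[OF adj_right[OF N0 SO0_orth[OF a(1)]], of "\<lambda>M. M$i$j"]
    by (simp add: matrix_matrix_mult_def mat_def)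
  have v1: "\<alpha> * a$1$j \<in> \<int>" for j using a(3) by (simp add: int_scaled_def \<alpha>_def)
  have v5: "a$5$j / \<alpha> \<in> \<int>" for j
    using adjb pos unfolding a5 by (simp add: int_scaled_def)
  \<comment> \<open>The minors of rows 4 and 5, summed against column 5 of the inverse of
    \<open>a\<close>, leave \<alpha> a4j. These rows are multiples of rows of the inverse of
    \<open>b\<close>, whose minors have denominator \<beta> n; after cancellation a4j / m is a sum
    of integers.\<close>
  have v4: "a$4$j / m \<in> \<int>" for j
  proof -
    have "a$4$j * \<alpha> = (\<Sum>k\<in>UNIV. \<alpha> * adj N a$k$5 * minor2 a 4 5 j k)"
    proof -
      have "(\<Sum>k\<in>UNIV. \<alpha> * adj N a$k$5 * minor2 a 4 5 j k) =
        \<alpha> * (a$4$j * (\<Sum>k\<in>UNIV. a$5$k * adj N a$k$5) - a$5$j * (\<Sum>k\<in>UNIV. a$4$k * adj N a$k$5))"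
        by (simp add: minor2_def sum_5 algebra_simps)
      then show ?thesis unfolding one by simp
    qed
    also have "\<dots> = \<alpha> * m * (\<Sum>k\<in>UNIV. (\<alpha> * adj N a$k$5) * (\<beta> * n * minor2 (adj N b) 4 5 j k))"
      unfolding sum_distrib_left by (intro sum.cong refl) (simp add: minor2_def a4 a5 algebra_simps)
    finally have "a$4$j / m = (\<Sum>k\<in>UNIV. (\<alpha> * adj N a$k$5) * (\<beta> * n * minor2 (adj N b) 4 5 j k))"
      using pos by (simp add: field_simps)
    also have "\<dots> \<in> \<int>"
    proof (rule Ints_sum)
      fix k
      show "(\<alpha> * adj N a$k$5) * (\<beta> * n * minor2 (adj N b) 4 5 j k) \<in> \<int>"
        using adja b(3) unfolding int_scaled_def minors_int_scaled_def lev by (intro Ints_mult[of "\<alpha> * adj N a$k$5"]) blast+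
    qed
    finally show ?thesis .
  qed
  \<comment> \<open>Rows 1 and 2 are summed against column 1 of the inverse of \<open>a\<close>.
    That column is \<alpha> \<beta> times the first column of \<open>b\<close>, so it is divisible
    by \<alpha>.\<close>
  have v2: "m * a$2$j \<in> \<int>" for j
  proof -
    have "m * a$2$j = (\<Sum>k\<in>UNIV. (adj N a$k$1 / \<alpha>) * (\<alpha> * m * minor2 a 1 2 k j))"
    proof -
      have "(\<Sum>k\<in>UNIV. (adj N a$k$1 / \<alpha>) * (\<alpha> * m * minor2 a 1 2 k j)) = (\<Sum>k\<in>UNIV. m * (adj N a$k$1 * minor2 a 1 2 k j))"
        using pos by (intro sum.cong refl) simp
      also have "\<dots> = m * (a$2$j * (\<Sum>k\<in>UNIV. a$1$k * adj N a$k$1) - a$1$j * (\<Sum>k\<in>UNIV. a$2$k * adj N a$k$1))"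
        by (simp add: minor2_def sum_5 algebra_simps)
      finally show ?thesis unfolding one by simp
    qed
    also have "\<dots> \<in> \<int>"
    proof (rule Ints_sum)
      fix k
      have "\<beta> * b$k$1 \<in> \<int>" using b(2) by (simp add: int_scaled_def \<beta>_def)
      then have "adj N a$k$1 / \<alpha> \<in> \<int>" using pos by (simp add: b1)
      then show "(adj N a$k$1 / \<alpha>) * (\<alpha> * m * minor2 a 1 2 k j) \<in> \<int>"
        using a(4) unfolding minors_int_scaled_def lev by (intro Ints_mult[of "adj N a$k$1 / \<alpha>"]) blast+
    qed
    finally show ?thesis .
  qed
  \<comment> \<open>The form on column j is solved for N a3j^2; half of the diagonal entry of
    \<open>S_hat N\<close> is 0 or -N. For rational a3j and squarefree N this gives
    integrality.\<close>
  have v3: "a$3$j \<in> \<int>" for j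
  proof (rule Ints_of_squarefree_mult_square[OF N])
    show "a$3$j \<in> \<rat>" using a(2) by (simp add: rational_matrix_def)
    have "bil N (column j a) (column j a) = S_hat N $ j $ j" using SO0_orth[OF a(1)] by (simp only: orth_iff)
    then have "real N * (a$3$j)\<^sup>2 = (\<alpha> * a$1$j) * (a$5$j / \<alpha>) + (m * a$2$j) * (a$4$j / m) - S_hat N $ j $ j / 2"
      using pos by (simp add: bil_def column_def power2_eq_square field_simps)
    moreover have "S_hat N $ j $ j / 2 \<in> \<int>" using exhaust_5[of j] by (auto simp: S_hat_def)
    ultimately show "real N * (a$3$j)\<^sup>2 \<in> \<int>"
      using Ints_mult[OF v1 v5, of j j] Ints_mult[OF v2 v4, of j j] by (simp only: Ints_add Ints_diff)
  qed
  have "int_scaled 1 (adj N (D_mat s) ** a)"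
    using v1 v2 v3 v4 v5
    by (simp add: int_scaled_def forall_5 adj_entries[OF N0] D_mat_def torus_def diag5_def
        matrix_matrix_mult_def sum_5 \<alpha>_def m_def)
  then show ?thesis
    unfolding Gamma_iff using SO0_mult[OF N0 SO0_adj[OF N0 D_mat_SO0[OF N0 s]] a(1)] by simp
qed

section \<open>The full rational group and its p-primary part\<close>

lemma rational_mult: "rational_matrix A \<Longrightarrow> rational_matrix B \<Longrightarrow> rational_matrix (A ** B)"
  unfolding rational_matrix_def matrix_matrix_mult_def by (auto intro!: Rats_sum)

lemma int_scaled_rational:
  assumes "int_scaled (real c) M" "c > 0"
  shows "rational_matrix M"
  unfolding rational_matrix_def
proof (intro allI)
  fix i j
  have "real c * M$i$j \<in> \<rat>" using assms(1) Ints_subset_Rats by (auto simp: int_scaled_def)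
  then have "real c * M$i$j / real c \<in> \<rat>" by (intro Rats_divide) auto
  then show "M$i$j \<in> \<rat>" using assms(2) by simp
qed

lemma double_coset_matrix_group:
  "double_coset (matrix_group X) U g = {A ** g ** B | A B. A \<in> U \<and> B \<in> U}"
  by (auto simp: double_coset_def set_mult_def matrix_group_def)

lemma group_matrix_group:
  assumes "N > 0" "mat 1 \<in> X" "\<And>A B. A \<in> X \<Longrightarrow> B \<in> X \<Longrightarrow> A ** B \<in> X"
    "\<And>A. A \<in> X \<Longrightarrow> adj N A \<in> X" "X \<subseteq> orth N"
  shows "Group.group (matrix_group X)" "A \<in> X \<Longrightarrow> inv\<^bsub>matrix_group X\<^esub> A = adj N A"
proof -
  show g: "Group.group (matrix_group X)"
  proof (rule groupI)
    fix A assume "A \<in> carrier (matrix_group X)"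
    then show "\<exists>B\<in>carrier (matrix_group X). B \<otimes>\<^bsub>matrix_group X\<^esub> A = \<one>\<^bsub>matrix_group X\<^esub>"
      using assms adj_left by (intro bexI[of _ "adj N A"]) (auto simp: matrix_group_def)
  qed (use assms in \<open>auto simp: matrix_group_def matrix_mul_assoc\<close>)
  show "inv\<^bsub>matrix_group X\<^esub> A = adj N A" if "A \<in> X"
    by (rule group.inv_equality[OF g]) (use that assms adj_left in \<open>auto simp: matrix_group_def\<close>)
qed

text \<open>Common to both groups: \<open>X\<close> is the underlying set of matrices, and
  \<open>cover\<close> demands that \<open>S\<close> contain every pair whose double coset meets
  \<open>X\<close>.\<close>

lemma cartan_pair_matrix_group:
  assumes N: "squarefree N" and X: "X \<subseteq> {M \<in> SO0_hat N. rational_matrix M}" "Gamma_hat N \<subseteq> X"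
      "\<And>A B. A \<in> X \<Longrightarrow> B \<in> X \<Longrightarrow> A ** B \<in> X" "\<And>A. A \<in> X \<Longrightarrow> adj N A \<in> X"
    and S: "\<And>s. s \<in> S \<Longrightarrow> pos_pair s" "(1, 1) \<in> S" "\<And>s t. s \<in> S \<Longrightarrow> t \<in> S \<Longrightarrow> pair_times s t \<in> S"
      "\<And>s. s \<in> S \<Longrightarrow> D_mat s \<in> X"
    and cover: "\<And>g s A B. g \<in> X \<Longrightarrow> pos_pair s \<Longrightarrow> A \<in> Gamma_hat N \<Longrightarrow> B \<in> Gamma_hat N \<Longrightarrow>
      g = A ** D_mat s ** B \<Longrightarrow> s \<in> S"
  shows "cartan_pair (matrix_group X) (Gamma_hat N) D_mat S"
proof -
  note N0 = squarefree_pos[OF N]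
  let ?G = "matrix_group X" and ?U = "Gamma_hat N"
  have orth: "X \<subseteq> orth N" using X(1) SO0_orth by blast
  have one: "mat 1 \<in> X" using X(2) Gamma_one by blast
  have grp: "Group.group ?G" by (rule group_matrix_group(1)[OF N0 one _ _ orth]) (rule X(3,4); assumption)+
  have inv: "inv\<^bsub>?G\<^esub> A = adj N A" if "A \<in> X" for A
    by (rule group_matrix_group(2)[OF N0 one _ _ orth that]) (rule X(3,4); assumption)+
  have mem: "double_coset ?G ?U g = {A ** g ** B | A B. A \<in> ?U \<and> B \<in> ?U}" for g
    by (rule double_coset_matrix_group)
  have XS: "A \<in> SO0_hat N" "rational_matrix A" if "A \<in> X" for A using X(1) that by auto
  have in_X: "A ** D_mat s ** B \<in> X" if "A \<in> ?U" "B \<in> ?U" "s \<in> S" for A B s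
    using that X(2,3) S(4) by blast
  show ?thesis
  proof (intro cartan_pair.intro cartan_pair_axioms.intro grp)
    show "subgroup ?U ?G"
    proof (rule group.subgroupI[OF grp])
      show "?U \<subseteq> carrier ?G" using X(2) by (simp add: matrix_group_def)
      show "?U \<noteq> {}" using Gamma_one by blast
      show "inv\<^bsub>?G\<^esub> A \<in> ?U" if "A \<in> ?U" for A using inv[of A] Gamma_adj[OF N that] X(2) that by auto
      show "A \<otimes>\<^bsub>?G\<^esub> B \<in> ?U" if "A \<in> ?U" "B \<in> ?U" for A B
        using Gamma_mult[OF N that] by (simp add: matrix_group_def)
    qed
    show "D_mat s \<in> carrier ?G" if "s \<in> S" for s using S(4)[OF that] by (simp add: matrix_group_def)
    show "pos_pair s" if "s \<in> S" for s using S(1)[OF that] .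
    show "(1, 1) \<in> S" by (rule S(2))
    show "D_mat (1, 1) = \<one>\<^bsub>?G\<^esub>" using D_mat_one by (simp add: matrix_group_def)
    show "pair_times s t \<in> S" if "s \<in> S" "t \<in> S" for s t using S(3)[OF that] .
    show "D_mat (pair_times s t) = D_mat s \<otimes>\<^bsub>?G\<^esub> D_mat t" for s t
      by (simp add: D_mat_times matrix_group_def)
    show "\<exists>s\<in>S. g \<in> double_coset ?G ?U (D_mat s)" if "g \<in> carrier ?G" for g
    proof -
      have g: "g \<in> X" using that by (simp add: matrix_group_def)
      obtain s A B where s: "pos_pair s" "A \<in> ?U" "B \<in> ?U" "g = A ** D_mat s ** B"
        using cartan_decomposition[OF N XS[OF g]] by blast
      then show ?thesis unfolding mem using cover[OF g s] by blast
    qed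
    show "entry_level u dvd entry_level s * entry_level t \<and> minor_level u dvd minor_level s * minor_level t"
      if st: "s \<in> S" "t \<in> S" "u \<in> S"
        "D_mat u \<in> double_coset ?G ?U (D_mat s) <#>\<^bsub>?G\<^esub> double_coset ?G ?U (D_mat t)" for s t u
    proof -
      obtain A B A' B' where e: "A \<in> ?U" "B \<in> ?U" "A' \<in> ?U" "B' \<in> ?U"
        "D_mat u = (A ** D_mat s ** B) ** (A' ** D_mat t ** B')"
        using st(4) unfolding mem by (auto simp: set_mult_def matrix_group_def)
      have "int_scaled (real (entry_level s * entry_level t)) (D_mat u)"
        "minors_int_scaled (real (minor_level s * minor_level t)) (D_mat u)"
        unfolding e(5) of_nat_mult
        by (intro int_scaled_mult minors_int_scaled_mult
            double_coset_int_scaled[OF S(1)[OF st(1)] e(1,2)] double_coset_int_scaled[OF S(1)[OF st(2)] e(3,4)])+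
      then show ?thesis using D_mat_int_scaled_dvd D_mat_minors_dvd S(1)[OF st(3)] by blast
    qed
    show "inv\<^bsub>?G\<^esub> D_mat s \<otimes>\<^bsub>?G\<^esub> a \<in> ?U"
      if s: "s \<in> S" and t: "t \<in> S" and a: "a \<in> double_coset ?G ?U (D_mat s)"
        and b: "b \<in> double_coset ?G ?U (D_mat t)" and ab: "a \<otimes>\<^bsub>?G\<^esub> b = D_mat (pair_times s t)" for s t a b
    proof -
      obtain A B where a': "A \<in> ?U" "B \<in> ?U" "a = A ** D_mat s ** B" using a unfolding mem by blast
      obtain A' B' where b': "A' \<in> ?U" "B' \<in> ?U" "b = A' ** D_mat t ** B'" using b unfolding mem by blast
      have aX: "a \<in> X" and bX: "b \<in> X" using in_X a' b' s t by auto
      \<comment> \<open>The inverse of \<open>b\<close> lies in the same double coset as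
        \<open>b\<close>, so the bound on the denominators of minors holds for it too.\<close>
      obtain A'' B'' where b'': "A'' \<in> ?U" "B'' \<in> ?U" "adj N b = A'' ** D_mat t ** B''"
        using adj_double_coset[OF N S(1)[OF t] b'(1,2)] b'(3) by blast
      have "adj N (D_mat s) ** a \<in> ?U"
      proof (rule extremal_factor[OF N S(1)[OF s] S(1)[OF t] XS[OF aX] _ _ XS(1)[OF bX]])
        show "int_scaled (real (entry_level s)) a" "minors_int_scaled (real (minor_level s)) a"
          unfolding a'(3) using double_coset_int_scaled[OF S(1)[OF s] a'(1,2)] .
        show "int_scaled (real (entry_level t)) b"
          unfolding b'(3) using double_coset_int_scaled(1)[OF S(1)[OF t] b'(1,2)] .
        show "minors_int_scaled (real (minor_level t)) (adj N b)"
          unfolding b''(3) using double_coset_int_scaled(2)[OF S(1)[OF t] b''(1,2)] .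
        show "a ** b = D_mat (pair_times s t)" using ab by (simp add: matrix_group_def)
      qed
      then show ?thesis using inv[OF S(4)[OF s]] by (simp add: matrix_group_def)
    qed
    show "inv\<^bsub>?G\<^esub> D_mat s \<in> double_coset ?G ?U (D_mat s)" if "s \<in> S" for s
      unfolding mem inv[OF S(4)[OF that]]
      using adj_D_mat[OF N0] weyl_Gamma[OF N] by blast
  qed
qed

lemma cartan_pair_G_hat:
  assumes N: "squarefree N"
  shows "cartan_pair (G_hat N) (Gamma_hat N) D_mat {s. pos_pair s}"
proof -
  note N0 = squarefree_pos[OF N]
  show ?thesis
    unfolding G_hat_def
  proof (rule cartan_pair_matrix_group[OF N])
    show "Gamma_hat N \<subseteq> {M \<in> SO0_hat N. rational_matrix M}"
      using Ints_subset_Rats by (auto simp: Gamma_hat_def integral_matrix_def rational_matrix_def)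
    show "A ** B \<in> {M \<in> SO0_hat N. rational_matrix M}"
      if "A \<in> {M \<in> SO0_hat N. rational_matrix M}" "B \<in> {M \<in> SO0_hat N. rational_matrix M}" for A B
      using that SO0_mult[OF N0] rational_mult by blast
    show "adj N A \<in> {M \<in> SO0_hat N. rational_matrix M}" if "A \<in> {M \<in> SO0_hat N. rational_matrix M}" for A
    proof -
      have A: "A \<in> SO0_hat N" "rational_matrix A" using that by auto
      obtain c where "c > 0" "int_scaled (real c) A" using rational_common_denominator[OF A(2)] by blast
      then have "rational_matrix (adj N A)"
        using int_scaled_rational int_scaled_adj[OF N SO0_orth[OF A(1)]] by blast
      then show ?thesis using SO0_adj[OF N0 A(1)] by simp
    qed
    show "D_mat s \<in> {M \<in> SO0_hat N. rational_matrix M}" if "s \<in> {s. pos_pair s}" for s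
      using that D_mat_SO0[OF N0] int_scaled_rational[OF D_mat_int_scaled level_pos(1)] by blast
    show "(1, 1) \<in> {s. pos_pair s}" by (simp add: pos_pair_def)
  qed (auto simp: pos_pair_times)
qed

lemma G_hat_p_carrier:
  assumes p: "p > 0"
  shows "{g \<in> carrier (G_hat N). \<exists>(r::nat) M. integral_matrix M \<and> g = (1 / real p ^ r) *\<^sub>R M} =
    {g \<in> SO0_hat N. \<exists>r. int_scaled (real (p ^ r)) g}" (is "?L = ?R")
proof (intro equalityI subsetI)
  fix g assume "g \<in> ?L"
  then obtain r M where g: "g \<in> SO0_hat N" "integral_matrix M" "g = (1 / real p ^ r) *\<^sub>R M"
    by (auto simp: G_hat_def matrix_group_def)
  then have "int_scaled (real (p ^ r)) g" using p by (simp add: int_scaled_def integral_matrix_def)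
  then show "g \<in> ?R" using g(1) by blast
next
  fix g assume "g \<in> ?R"
  then obtain r where g: "g \<in> SO0_hat N" "int_scaled (real (p ^ r)) g" by blast
  have "rational_matrix g" using int_scaled_rational[OF g(2)] p by simp
  moreover have "integral_matrix (real p ^ r *\<^sub>R g)" using g(2) by (simp add: integral_matrix_def int_scaled_def)
  moreover have "g = (1 / real p ^ r) *\<^sub>R (real p ^ r *\<^sub>R g)" using p by simp
  ultimately have "\<exists>(r::nat) M. integral_matrix M \<and> g = (1 / real p ^ r) *\<^sub>R M" by blast
  then show "g \<in> ?L" using g(1) \<open>rational_matrix g\<close> by (simp add: G_hat_def matrix_group_def)
qed

lemma cartan_pair_prime_G_hat_p:
  assumes N: "squarefree N" and p: "prime p"
  shows "cartan_pair_prime (G_hat_p N p) (Gamma_hat N) D_mat (range (\<lambda>(i, j). (p ^ i, p ^ j))) p"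
proof -
  note N0 = squarefree_pos[OF N]
  have p0: "p > 0" using p prime_gt_0_nat by blast
  let ?X = "{g \<in> SO0_hat N. \<exists>r. int_scaled (real (p ^ r)) g}"
  let ?S = "range (\<lambda>(i, j). (p ^ i, p ^ j))"
  have S: "s \<in> ?S \<longleftrightarrow> (\<exists>i j. s = (p ^ i, p ^ j))" for s by auto
  have "cartan_pair (matrix_group ?X) (Gamma_hat N) D_mat ?S"
  proof (rule cartan_pair_matrix_group[OF N])
    show "?X \<subseteq> {M \<in> SO0_hat N. rational_matrix M}" using int_scaled_rational p0 by fastforce
    show "Gamma_hat N \<subseteq> ?X" using Gamma_iff by (auto intro!: exI[of _ 0])
    show "A ** B \<in> ?X" if AB: "A \<in> ?X" "B \<in> ?X" for A B
    proof -
      obtain i j where "int_scaled (real (p ^ i)) A" "int_scaled (real (p ^ j)) B" using AB by blast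
      from int_scaled_mult[OF this] have "int_scaled (real (p ^ (i + j))) (A ** B)" by (simp add: power_add)
      then show ?thesis using AB SO0_mult[OF N0] by blast
    qed
    show "adj N A \<in> ?X" if "A \<in> ?X" for A
      using that SO0_adj[OF N0] int_scaled_adj[OF N SO0_orth] by blast
    show "pos_pair s" if "s \<in> ?S" for s using that p0 by (auto simp: pos_pair_def)
    show "(1, 1) \<in> ?S" by (rule range_eqI[of _ _ "(0, 0)"]) simp
    show "pair_times s t \<in> ?S" if "s \<in> ?S" "t \<in> ?S" for s t
      using that unfolding S by (auto simp: pair_times_def power_add[symmetric])
    show "D_mat s \<in> ?X" if s: "s \<in> ?S" for s
    proof -
      obtain i j where ij: "s = (p ^ i, p ^ j)" using s unfolding S by blast
      have pos: "pos_pair s" using p0 by (simp add: ij pos_pair_def)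
      have "entry_level s = p ^ (i + j)" by (simp add: ij entry_level_def power_add)
      then show ?thesis using D_mat_int_scaled[OF pos] D_mat_SO0[OF N0 pos] by auto
    qed
    show "s \<in> ?S" if g: "g \<in> ?X" "pos_pair s" "A \<in> Gamma_hat N" "B \<in> Gamma_hat N" "g = A ** D_mat s ** B" for g s A B
    proof -
      obtain r where "int_scaled (real (p ^ r)) g" using g(1) by blast
      \<comment> \<open>Multiplication by integral matrices on both sides keeps denominators, so m n
        divides a power of p, and both m and n are powers of p.\<close>
      then have "entry_level s dvd p ^ r" using int_scaled_dvd[OF N g(2-4)] g(5) by blast
      then have "fst s dvd p ^ r" "snd s dvd p ^ r" unfolding entry_level_def by (auto dest: dvd_mult_left dvd_mult_right)
      then have "(\<exists>i. fst s = p ^ i) \<and> (\<exists>j. snd s = p ^ j)"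
        unfolding divides_primepow_nat[OF p] by blast
      then obtain i j where "fst s = p ^ i" "snd s = p ^ j" by (elim exE conjE)
      then have "s = (p ^ i, p ^ j)" by (simp add: prod_eq_iff)
      then show ?thesis unfolding S by (intro exI)
    qed
  qed
  then have "cartan_pair (G_hat_p N p) (Gamma_hat N) D_mat ?S"
    unfolding G_hat_p_def G_hat_p_carrier[OF p0] .
  then show ?thesis by (intro cartan_pair_prime.intro cartan_pair_prime_axioms.intro p refl)
qed

theorem theorem3:
  fixes N p :: nat
  assumes "squarefree N" and "prime p"
  shows "carrier (hecke_algebra (Gamma_hat N) (G_hat_p N p)) =
           {eval_poly2 (hecke_algebra (Gamma_hat N) (G_hat_p N p)) P (T1 N p) (T2 N p) | P. True}
       \<and> algebraically_independent2 (hecke_algebra (Gamma_hat N) (G_hat_p N p)) (T1 N p) (T2 N p)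
       \<and> (\<forall>f \<in> carrier (hecke_algebra (Gamma_hat N) (G_hat N)).
            \<forall>g \<in> carrier (hecke_algebra (Gamma_hat N) (G_hat N)).
              f \<otimes>\<^bsub>hecke_algebra (Gamma_hat N) (G_hat N)\<^esub> g
                = \<zero>\<^bsub>hecke_algebra (Gamma_hat N) (G_hat N)\<^esub> \<longrightarrow>
              f = \<zero>\<^bsub>hecke_algebra (Gamma_hat N) (G_hat N)\<^esub> \<or>
              g = \<zero>\<^bsub>hecke_algebra (Gamma_hat N) (G_hat N)\<^esub>)"
proof -
  interpret P: cartan_pair_prime "G_hat_p N p" "Gamma_hat N" D_mat "range (\<lambda>(i, j). (p ^ i, p ^ j))" p
    by (rule cartan_pair_prime_G_hat_p[OF assms])
  interpret G: cartan_pair "G_hat N" "Gamma_hat N" D_mat "{s. pos_pair s}"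
    by (rule cartan_pair_G_hat[OF assms(1)])
  have p0: "p > 0" using assms(2) prime_gt_0_nat by blast
  have dc: "double_coset (G_hat_p N p) U g = double_coset (G_hat N) U g" for U g
    unfolding G_hat_p_def G_hat_def double_coset_matrix_group ..
  have "(1 / real p) *\<^sub>R diag5 1 (real p) (real p) (real p) (real p ^ 2) = D_mat (p, 1)"
    using p0 by (simp add: D_mat_def torus_def entry_level_def diag5_def vec_eq_iff forall_5 power2_eq_square)
  then have T1: "T1 N p = frag_of (P.C (p, 1))" unfolding T1_def P.C_def dc by (simp only:)
  have "(1 / real p) *\<^sub>R diag5 1 1 (real p) (real p ^ 2) (real p ^ 2) = D_mat (1, p)"
    using p0 by (simp add: D_mat_def torus_def entry_level_def diag5_def vec_eq_iff forall_5 power2_eq_square)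
  then have T2: "T2 N p = frag_of (P.C (1, p))" unfolding T2_def P.C_def dc by (simp only:)
  show ?thesis
    unfolding T1 T2 using P.carrier_eq P.algebraically_independent G.no_zero_divisors by auto
qed

end
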